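(* Let $H$ be a finite index subgroup of R. Thompson's group $F$. Then $H$ is isomorphic to $F$ if and only if $H = K_{(a,b)}$ for some positive integers $a$ and $b$.
   Context: $F$ (R. Thompson's group $F$) is the group, under composition, of all piecewise-linear, orientation-preserving homeomorphisms of $[0,1]$ which admit finitely many breaks in slope, all breaks occurring over dyadic rationals (elements of $\mathbb{Z}[1/2]$), and all of whose affine pieces have slopes that are integral powers of $2$. For $f\in F$, $f'(0)$ denotes the right derivative at $0$ and $f'(1)$ the left derivative at $1$. The homomorphism $\phi:F\to\mathbb{Z}^2$ is defined by $\phi(f)=(\log_2 f'(0),\log_2 f'(1))$. For positive integers $a,b$, $\tilde K_{(a,b)}=\langle (a,0),(0,b)\rangle\le\mathbb{Z}^2$ and $K_{(a,b)}=\phi^{-1}(\tilde K_{(a,b)})\le F$. *)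

theory Defs
  imports
    "HOL-Analysis.Analysis"
    "HOL-Algebra.Bij"
    "HOL-Algebra.Generated_Groups"
    "HOL-Algebra.Elementary_Groups"
begin

definition dyadic :: "real set" where
  "dyadic = {of_int m / 2 ^ n | (m :: int) (n :: nat). True}"

text \<open>
  \<open>B\<close> contains all points at which the slope breaks: on every closed
  subinterval of the unit interval with no point of \<open>B\<close> in its interior,
  \<open>f\<close> is affine, and its slope there is an integral power of two.
\<close>

definition dyadic_PL :: "(real \<Rightarrow> real) \<Rightarrow> bool" where
  "dyadic_PL f \<longleftrightarrow>
     (\<exists>B. finite B \<and> B \<subseteq> dyadic \<and>
        (\<forall>u v. 0 \<le> u \<and> u < v \<and> v \<le> 1 \<and> {u<..<v} \<inter> B = {} \<longrightarrow>
           (\<exists>(k :: int) c. \<forall>x\<in>{u..v}. f x = 2 powi k * x + c)))"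

text \<open>
  Elements are \<^emph>\<open>extensional\<close> functions (equal to \<open>undefined\<close> outside the unit
  interval), so that each homeomorphism of the unit interval is represented
  by exactly one HOL function; multiplication and unit are those of \<^const>\<open>BijGroup\<close>.
\<close>

definition thompson_F_set :: "(real \<Rightarrow> real) set" where
  "thompson_F_set =
     {f \<in> extensional {0..1}.
        (\<exists>g. homeomorphism {0..1} {0..1} f g) \<and>
        strict_mono_on {0..1} f \<and>
        dyadic_PL f}"

definition thompson_F :: "(real \<Rightarrow> real) monoid" where
  "thompson_F = (BijGroup {0..1}) \<lparr>carrier := thompson_F_set\<rparr>"

text \<open>
  The floors serve only to land in the type \<^typ>\<open>int\<close>: for members of the group
  both logarithms are integers, see \<open>thompson_phi_exact\<close> below.
\<close>

definition thompson_phi :: "(real \<Rightarrow> real) \<Rightarrow> int \<times> int" where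
  "thompson_phi f =
     (\<lfloor>log 2 (vector_derivative f (at_right 0))\<rfloor>,
      \<lfloor>log 2 (vector_derivative f (at_left 1))\<rfloor>)"

definition K_tilde :: "int \<Rightarrow> int \<Rightarrow> (int \<times> int) set" where
  "K_tilde a b = generate (integer_group \<times>\<times> integer_group) {(a, 0), (0, b)}"

definition K :: "int \<Rightarrow> int \<Rightarrow> (real \<Rightarrow> real) set" where
  "K a b = {f \<in> carrier thompson_F. thompson_phi f \<in> K_tilde a b}"

lemma vector_derivative_affine_end:
  fixes f :: "real \<Rightarrow> real"
  assumes "d > 0" "x \<in> S" "T \<subseteq> S" "at x within T \<noteq> bot"
    and eq: "\<And>y. y \<in> S \<Longrightarrow> dist y x < d \<Longrightarrow> m * y + c = f y"
  shows "vector_derivative f (at x within T) = m"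
proof -
  have "((\<lambda>y. m * y + c) has_vector_derivative m) (at x within S)"
    by (auto intro!: derivative_eq_intros simp flip: has_real_derivative_iff_has_vector_derivative)
  then have "(f has_vector_derivative m) (at x within S)"
    by (rule has_vector_derivative_transform_within) (use assms in auto)
  then have "(f has_vector_derivative m) (at x within T)"
    using \<open>T \<subseteq> S\<close> by (rule has_vector_derivative_within_subset)
  then show ?thesis
    using assms(4) by (intro vector_derivative_within)
qed

lemma thompson_phi_exact:
  assumes "f \<in> thompson_F_set"
  shows "of_int (fst (thompson_phi f)) = log 2 (vector_derivative f (at_right 0))"
    and "of_int (snd (thompson_phi f)) = log 2 (vector_derivative f (at_left 1))"
    and "vector_derivative f (at_right 0) = 2 powi fst (thompson_phi f)"
    and "vector_derivative f (at_left 1) = 2 powi snd (thompson_phi f)"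
proof -
  obtain B where B: "finite B" and aff: "\<And>u v. 0 \<le> u \<Longrightarrow> u < v \<Longrightarrow> v \<le> 1 \<Longrightarrow> {u<..<v} \<inter> B = {} \<Longrightarrow>
      \<exists>(k :: int) c. \<forall>x\<in>{u..v}. f x = 2 powi k * x + c"
    using assms unfolding thompson_F_set_def dyadic_PL_def mem_Collect_eq by meson
  define v where "v = Min (insert 1 (B \<inter> {0<..}))"
  have fin: "finite (insert 1 (B \<inter> {0<..}))" using B by simp
  have v: "0 < v" "v \<le> 1" "{0<..<v} \<inter> B = {}" using fin by (auto simp: v_def)
  obtain k :: int and c where k: "\<And>x. x \<in> {0..v} \<Longrightarrow> f x = 2 powi k * x + c"
    using aff[of 0 v] v by auto
  have d0: "vector_derivative f (at_right 0) = 2 powi k"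
    by (rule vector_derivative_affine_end[where S = "{0..}" and d = v and c = c])
       (use v k in \<open>auto simp: dist_real_def\<close>)
  define u where "u = Max (insert 0 (B \<inter> {..<1}))"
  have fin': "finite (insert 0 (B \<inter> {..<1}))" using B by simp
  have u: "0 \<le> u" "u < 1" "{u<..<1} \<inter> B = {}" using fin' by (auto simp: u_def)
  obtain l :: int and e where l: "\<And>x. x \<in> {u..1} \<Longrightarrow> f x = 2 powi l * x + e"
    using aff[of u 1] u by auto
  have d1: "vector_derivative f (at_left 1) = 2 powi l"
    by (rule vector_derivative_affine_end[where S = "{..1}" and d = "1 - u" and c = e])
       (use u l in \<open>auto simp: dist_real_def\<close>)
  have lg: "log 2 (2 powi j) = of_int j" for j :: int
    by (simp flip: powr_real_of_int')
  show "of_int (fst (thompson_phi f)) = log 2 (vector_derivative f (at_right 0))"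
    "of_int (snd (thompson_phi f)) = log 2 (vector_derivative f (at_left 1))"
    "vector_derivative f (at_right 0) = 2 powi fst (thompson_phi f)"
    "vector_derivative f (at_left 1) = 2 powi snd (thompson_phi f)"
    by (simp_all add: thompson_phi_def d0 d1 lg)
qed

end

theory Submission
  imports Defs
begin

text \<open>
  Everything is moved from the unit interval to the line. The map \<open>chart\<close> is a piecewise
  linear homeomorphism from the line onto the open unit interval. It turns a translation by \<open>i\<close>
  far to the left into multiplication by \<open>2 powi i\<close> near \<open>0\<close>, and a translation by \<open>j\<close> far to the
  right into multiplication of the distance to \<open>1\<close> by \<open>2 powi (- j)\<close>. Conjugation by it
  (\<open>transfer_iso\<close>) identifies \<open>thompson_F\<close> with the group \<open>T\<close> of dyadic piecewise linear
  homeomorphisms of the line that are integer translations near both ends. The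
  homomorphism \<open>thompson_phi\<close> becomes the pair of translation numbers \<open>(i, j)\<close>, up to the sign
  of \<open>j\<close>, and \<open>K a b\<close> becomes the group \<open>K_T a b\<close> of the maps with \<open>i\<close> in \<open>a\<int>\<close> and \<open>j\<close> in \<open>b\<int>\<close>.

  The group \<open>K_T a b\<close> is conjugate to \<open>T\<close> (\<open>K_T_iso_T\<close>): for a homeomorphism \<open>h\<close> with
  \<open>h (x + b) = h x + 1\<close> on the right and \<open>h (x + a) = h x + 1\<close> on the left, conjugation by \<open>h\<close> divides
  \<open>i\<close> by \<open>a\<close> and \<open>j\<close> by \<open>b\<close>. Such an \<open>h\<close> exists because a unit interval can be cut into
  any number of intervals whose lengths are powers of two.

  Conversely, let \<open>H\<close> have finite index. The core of \<open>H\<close> is a normal subgroup that contains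
  arbitrarily long translations, and a long translation moves the support of a compactly supported
  map off itself. This puts all commutators of compactly supported maps into the core. By the relations
  between the standard generators \<open>stretch n\<close>, these generators are then all congruent
  modulo the core, and a compactly supported map, suitably rescaled, is a quotient of two maps that are
  both a fixed translation times a product of equally many generators. So \<open>H\<close> contains every
  compactly supported map (\<open>T_c_subset_of_powers\<close>), that is, the kernel of the homomorphism to pairs of translation numbers, and \<open>H\<close> is
  determined by its group of pairs.

  It remains to recognise the pairs \<open>(i, j)\<close> on the coordinate axes from the abstract group alone. If
  \<open>i\<close> or \<open>j\<close> vanishes, then \<open>f\<close> and any conjugate of it are both trivial near one end and
  so commute with a common nontrivial map supported there. If neither vanishes, then a suitable conjugate
  has no fixed point in common with \<open>f\<close>, and only the identity commutes with both. Having a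
  nontrivial common centraliser with each of its conjugates, \<open>conj_centralized\<close>, is a property preserved by
  isomorphisms. In \<open>T\<close> every element is a product of two
  elements with pairs on the axes, so the same holds in an isomorphic \<open>H\<close>, and its group of
  pairs is a product of two infinite cyclic groups (\<open>iso_T_imp_K_T\<close>).
\<close>

section \<open>Dyadic numbers and dyadic piecewise linear germs\<close>

lemma dyadicI: "of_int m / 2 ^ n \<in> dyadic"
  unfolding dyadic_def by blast

lemma dyadic_of_int [simp]: "of_int m \<in> dyadic"
  using dyadicI[of m 0] by simp

lemma dyadic_0 [simp]: "0 \<in> dyadic" and dyadic_1 [simp]: "1 \<in> dyadic"
  using dyadic_of_int[of 0] dyadic_of_int[of 1] by simp_all

lemma dyadic_add: "x \<in> dyadic \<Longrightarrow> y \<in> dyadic \<Longrightarrow> x + y \<in> dyadic"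
proof -
  assume "x \<in> dyadic" "y \<in> dyadic"
  then obtain m n m' n' where "x = of_int m / 2 ^ n" "y = of_int m' / 2 ^ n'"
    unfolding dyadic_def by blast
  then have "x + y = of_int (m * 2 ^ n' + m' * 2 ^ n) / 2 ^ (n + n')"
    by (simp add: add_divide_distrib power_add)
  then show ?thesis using dyadicI by metis
qed

lemma dyadic_mult: "x \<in> dyadic \<Longrightarrow> y \<in> dyadic \<Longrightarrow> x * y \<in> dyadic"
proof -
  assume "x \<in> dyadic" "y \<in> dyadic"
  then obtain m n m' n' where "x = of_int m / 2 ^ n" "y = of_int m' / 2 ^ n'"
    unfolding dyadic_def by blast
  then have "x * y = of_int (m * m') / 2 ^ (n + n')"
    by (simp add: power_add)
  then show ?thesis using dyadicI by metis
qed

lemma dyadic_diff: "x \<in> dyadic \<Longrightarrow> y \<in> dyadic \<Longrightarrow> x - y \<in> dyadic"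
  using dyadic_add[OF _ dyadic_mult[OF dyadic_of_int[of "-1"]]] by simp

lemma dyadic_powi [simp]: "2 powi k \<in> dyadic"
proof (cases "k \<ge> 0")
  case True
  then have "(2::real) powi k = of_int (2 ^ nat k)" by (simp add: power_int_def)
  then show ?thesis by (simp only: dyadic_of_int)
next
  case False
  then have "2 powi k = of_int 1 / (2::real) ^ nat (- k)"
    by (simp add: power_int_def power_one_over)
  then show ?thesis by (simp only: dyadicI)
qed

lemma powi_pos: "(2::real) powi k > 0"
  by simp

lemma dyadic_affine_iff: "c \<in> dyadic \<Longrightarrow> 2 powi k * x + c \<in> dyadic \<longleftrightarrow> x \<in> dyadic"
proof
  assume c: "c \<in> dyadic" and d: "2 powi k * x + c \<in> dyadic"
  have "x = 2 powi (-k) * ((2 powi k * x + c) - c)"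
    by (simp add: power_int_minus)
  then show "x \<in> dyadic" using c d dyadic_mult dyadic_diff dyadic_powi by metis
qed (intro dyadic_add dyadic_mult, auto)

text \<open>
  The slopes to the right and to the left of \<open>x\<close> are \<open>2 powi l\<close> and \<open>2 powi k\<close>. The condition on the
  intercept of the left branch passes to the right branch, because \<open>x\<close> itself is dyadic if the two
  slopes differ. It makes \<open>f\<close> preserve being dyadic in both directions, and this is what makes germs
  compose: the inner map must not move a point that is not dyadic to a break of the outer map.
  A pointwise condition leaves room for maps of the line with infinitely many breaks, such as the charts
  by which groups are conjugated.
\<close>

definition PL_germ :: "(real \<Rightarrow> real) \<Rightarrow> real \<Rightarrow> bool" where
  "PL_germ f x \<longleftrightarrow> (\<exists>e>0. \<exists>k l :: int.
     (\<forall>t\<in>{0..e}. f (x + t) = f x + 2 powi l * t) \<and>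
     (\<forall>t\<in>{0..e}. f (x - t) = f x - 2 powi k * t) \<and>
     f x - 2 powi k * x \<in> dyadic \<and> (k \<noteq> l \<longrightarrow> x \<in> dyadic))"

lemma PL_germI:
  assumes "e > 0" "\<And>t. 0 \<le> t \<Longrightarrow> t \<le> e \<Longrightarrow> f (x + t) = f x + 2 powi l * t"
    "\<And>t. 0 \<le> t \<Longrightarrow> t \<le> e \<Longrightarrow> f (x - t) = f x - 2 powi k * t"
    "f x - 2 powi k * x \<in> dyadic" "k \<noteq> l \<Longrightarrow> x \<in> dyadic"
  shows "PL_germ f x"
  using assms unfolding PL_germ_def by (metis atLeastAtMost_iff)

lemma PL_germE:
  assumes "PL_germ f x"
  obtains e k l where "e > 0" "\<And>t. 0 \<le> t \<Longrightarrow> t \<le> e \<Longrightarrow> f (x + t) = f x + 2 powi l * t"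
    "\<And>t. 0 \<le> t \<Longrightarrow> t \<le> e \<Longrightarrow> f (x - t) = f x - 2 powi k * t"
    "f x - 2 powi k * x \<in> dyadic" "k \<noteq> l \<Longrightarrow> x \<in> dyadic"
  using assms unfolding PL_germ_def by (metis atLeastAtMost_iff)

lemma PL_germ_dyadic_iff:
  assumes "PL_germ f x" shows "f x \<in> dyadic \<longleftrightarrow> x \<in> dyadic"
proof -
  obtain k where k: "f x - 2 powi k * x \<in> dyadic" using assms by (rule PL_germE)
  show ?thesis using dyadic_affine_iff[OF k, of k x] by simp
qed

lemma PL_germ_comp:
  assumes g: "PL_germ g x" and f: "PL_germ f (g x)"
  shows "PL_germ (\<lambda>y. f (g y)) x"
proof -
  obtain e k l where e: "e > 0" "\<And>t. 0 \<le> t \<Longrightarrow> t \<le> e \<Longrightarrow> g (x + t) = g x + 2 powi l * t"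
    "\<And>t. 0 \<le> t \<Longrightarrow> t \<le> e \<Longrightarrow> g (x - t) = g x - 2 powi k * t"
    "g x - 2 powi k * x \<in> dyadic" "k \<noteq> l \<Longrightarrow> x \<in> dyadic"
    using g by (rule PL_germE) blast
  obtain e' k' l' where e': "e' > 0"
    "\<And>t. 0 \<le> t \<Longrightarrow> t \<le> e' \<Longrightarrow> f (g x + t) = f (g x) + 2 powi l' * t"
    "\<And>t. 0 \<le> t \<Longrightarrow> t \<le> e' \<Longrightarrow> f (g x - t) = f (g x) - 2 powi k' * t"
    "f (g x) - 2 powi k' * g x \<in> dyadic" "k' \<noteq> l' \<Longrightarrow> g x \<in> dyadic"
    using f by (rule PL_germE) blast
  define d where "d = min e (min (e' / 2 powi l) (e' / 2 powi k))"
  have d: "d > 0" "d \<le> e" using e e' by (auto simp: d_def)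
  have dl: "2 powi l * t \<le> e'" and dk: "2 powi k * t \<le> e'" if "t \<le> d" for t
  proof -
    have "t \<le> e' / 2 powi l" "t \<le> e' / 2 powi k" using that by (auto simp: d_def)
    then show "2 powi l * t \<le> e'" "2 powi k * t \<le> e'"
      by (simp_all add: pos_le_divide_eq mult.commute)
  qed
  show ?thesis
  proof (rule PL_germI[where e=d and k="k'+k" and l="l'+l"])
    show "f (g (x + t)) = f (g x) + 2 powi (l' + l) * t" if "0 \<le> t" "t \<le> d" for t
      using that d dl[of t] by (simp add: e(2) e'(2) power_int_add)
    show "f (g (x - t)) = f (g x) - 2 powi (k' + k) * t" if "0 \<le> t" "t \<le> d" for t
      using that d dk[of t] by (simp add: e(3) e'(3) power_int_add)
    have "f (g x) - 2 powi (k' + k) * x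
        = (f (g x) - 2 powi k' * g x) + 2 powi k' * (g x - 2 powi k * x)"
      by (simp add: power_int_add algebra_simps)
    then show "f (g x) - 2 powi (k' + k) * x \<in> dyadic"
      using e(4) e'(4) dyadic_add dyadic_mult dyadic_powi by metis
    show "x \<in> dyadic" if "k' + k \<noteq> l' + l"
      using that e(5) e'(5) PL_germ_dyadic_iff[OF g] by auto
  qed (use d in auto)
qed

text \<open>
  A left inverse suffices, since \<open>f\<close> covers a neighbourhood of \<open>f x\<close>. In this form the lemma applies
  to maps that are not surjective.
\<close>

lemma PL_germ_inverse:
  assumes f: "PL_germ f x" and "\<And>y. g (f y) = y"
  shows "PL_germ g (f x)"
proof -
  obtain e k l where e: "e > 0" "\<And>t. 0 \<le> t \<Longrightarrow> t \<le> e \<Longrightarrow> f (x + t) = f x + 2 powi l * t"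
    "\<And>t. 0 \<le> t \<Longrightarrow> t \<le> e \<Longrightarrow> f (x - t) = f x - 2 powi k * t"
    "f x - 2 powi k * x \<in> dyadic" "k \<noteq> l \<Longrightarrow> x \<in> dyadic"
    using f by (rule PL_germE) blast
  define d where "d = min (e * 2 powi l) (e * 2 powi k)"
  have dd: "t / 2 powi l \<le> e" "t / 2 powi k \<le> e" if "t \<le> d" for t
    using that by (simp_all add: d_def pos_divide_le_eq)
  show ?thesis
  proof (rule PL_germI[where e=d and k="-k" and l="-l"])
    show "d > 0" using e by (simp add: d_def)
    show "g (f x + t) = g (f x) + 2 powi (- l) * t" if "0 \<le> t" "t \<le> d" for t
    proof -
      have "f (x + t / 2 powi l) = f x + t" using e(2)[of "t / 2 powi l"] dd that by simp
      then show ?thesis by (metis assms(2) power_int_minus divide_inverse mult.commute)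
    qed
    show "g (f x - t) = g (f x) - 2 powi (- k) * t" if "0 \<le> t" "t \<le> d" for t
    proof -
      have "f (x - t / 2 powi k) = f x - t" using e(3)[of "t / 2 powi k"] dd that by simp
      then show ?thesis by (metis assms(2) power_int_minus divide_inverse mult.commute)
    qed
    have "g (f x) - 2 powi (- k) * f x = 2 powi (-k) * (0 - (f x - 2 powi k * x))"
      by (simp add: assms(2) power_int_minus algebra_simps)
    then show "g (f x) - 2 powi (- k) * f x \<in> dyadic"
      using e(4) dyadic_0 dyadic_diff dyadic_mult dyadic_powi by metis
    show "f x \<in> dyadic" if "- k \<noteq> - l" using that e(5) PL_germ_dyadic_iff[OF f] by auto
  qed
qed

lemma PL_germ_cong:
  assumes "PL_germ f x" "d > 0" "\<And>y. \<bar>y - x\<bar> < d \<Longrightarrow> g y = f y"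
  shows "PL_germ g x"
proof -
  obtain e k l where e: "e > 0" "\<And>t. 0 \<le> t \<Longrightarrow> t \<le> e \<Longrightarrow> f (x + t) = f x + 2 powi l * t"
    "\<And>t. 0 \<le> t \<Longrightarrow> t \<le> e \<Longrightarrow> f (x - t) = f x - 2 powi k * t"
    "f x - 2 powi k * x \<in> dyadic" "k \<noteq> l \<Longrightarrow> x \<in> dyadic"
    using assms(1) by (rule PL_germE) blast
  have "g x = f x" using assms by simp
  then show ?thesis using e assms
    by (intro PL_germI[where e="min e (d/2)" and k=k and l=l]) auto
qed

lemma PL_germ_affine:
  assumes "c \<in> dyadic" shows "PL_germ (\<lambda>x. 2 powi k * x + c) x"
  by (rule PL_germI[where e=1 and k=k and l=k]) (use assms in \<open>auto simp: algebra_simps\<close>)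

lemma PL_germ_glue:
  assumes "x \<in> dyadic" "f x \<in> dyadic" "u < x" "x < v"
    and "\<And>y. x \<le> y \<Longrightarrow> y \<le> v \<Longrightarrow> f y = f x + 2 powi l * (y - x)"
    and "\<And>y. u \<le> y \<Longrightarrow> y \<le> x \<Longrightarrow> f y = f x + 2 powi k * (y - x)"
  shows "PL_germ f x"
proof (rule PL_germI[where e="min (v - x) (x - u)" and k=k and l=l])
  show "f (x + t) = f x + 2 powi l * t" if "0 \<le> t" "t \<le> min (v - x) (x - u)" for t
    using assms(5)[of "x + t"] that by simp
  show "f (x - t) = f x - 2 powi k * t" if "0 \<le> t" "t \<le> min (v - x) (x - u)" for t
    using assms(6)[of "x - t"] that by simp
  show "f x - 2 powi k * x \<in> dyadic"
    using assms(1,2) by (intro dyadic_diff dyadic_mult dyadic_powi)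
qed (use assms(1,3,4) in auto)

lemma PL_germ_isCont: assumes "PL_germ f x" shows "isCont f x"
proof -
  obtain e k l where e: "e > 0" "\<And>t. 0 \<le> t \<Longrightarrow> t \<le> e \<Longrightarrow> f (x + t) = f x + 2 powi l * t"
    "\<And>t. 0 \<le> t \<Longrightarrow> t \<le> e \<Longrightarrow> f (x - t) = f x - 2 powi k * t"
    using assms by (rule PL_germE) blast
  have ev: "\<forall>\<^sub>F y in at_right x. y \<in> {x<..<x+e}" "\<forall>\<^sub>F y in at_left x. y \<in> {x-e<..<x}"
    using e(1) by (auto intro!: eventually_at_rightI eventually_at_leftI)
  have "(f \<longlongrightarrow> f x) (at_right x)"
  proof (rule Lim_transform_eventually)
    show "((\<lambda>y. f x + 2 powi l * (y - x)) \<longlongrightarrow> f x) (at_right x)"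
      by (auto intro!: tendsto_eq_intros)
    show "\<forall>\<^sub>F y in at_right x. f x + 2 powi l * (y - x) = f y"
      using ev(1)
    proof eventually_elim
      case (elim y) then show ?case using e(2)[of "y - x"] by simp
    qed
  qed
  moreover have "(f \<longlongrightarrow> f x) (at_left x)"
  proof (rule Lim_transform_eventually)
    show "((\<lambda>y. f x - 2 powi k * (x - y)) \<longlongrightarrow> f x) (at_left x)"
      by (auto intro!: tendsto_eq_intros)
    show "\<forall>\<^sub>F y in at_left x. f x - 2 powi k * (x - y) = f y"
      using ev(2)
    proof eventually_elim
      case (elim y) then show ?case using e(3)[of "x - y"] by simp
    qed
  qed
  ultimately show ?thesis by (simp add: isCont_def filterlim_split_at)
qed

section \<open>Interpolating a sequence of nodes\<close>

definition interp :: "(int \<Rightarrow> real) \<Rightarrow> real \<Rightarrow> real" where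
  "interp c x = c \<lfloor>x\<rfloor> + (c (\<lfloor>x\<rfloor> + 1) - c \<lfloor>x\<rfloor>) * frac x"

text \<open>
  The increments of \<open>c\<close> are the slopes of the interpolation.
\<close>

definition nodes :: "(int \<Rightarrow> real) \<Rightarrow> bool" where
  "nodes c \<longleftrightarrow> (\<forall>n. c n \<in> dyadic \<and> (\<exists>k::int. c (n + 1) = c n + 2 powi k))"

lemma interp_on:
  assumes "of_int n \<le> x" "x \<le> of_int n + 1"
  shows "interp c x = c n + (c (n + 1) - c n) * (x - of_int n)"
proof (cases "x = of_int n + 1")
  case True then show ?thesis by (simp add: interp_def frac_def)
next
  case False
  then have "\<lfloor>x\<rfloor> = n" using assms by linarith
  then show ?thesis by (simp add: interp_def frac_def)
qed

lemma interp_of_int [simp]: "interp c (of_int n) = c n"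
  by (simp add: interp_def)

lemma nodes_gt: "nodes c \<Longrightarrow> c n < c (n + 1)"
  unfolding nodes_def by (metis less_add_same_cancel1 powi_pos)

lemma nodes_strict_mono: assumes "nodes c" shows "strict_mono c"
proof (rule strict_monoI)
  fix m n :: int assume "m < n"
  then show "c m < c n"
    by (induct n rule: int_gr_induct) (use nodes_gt[OF assms] order.strict_trans in blast)+
qed

lemma interp_strict_mono: assumes "nodes c" shows "strict_mono (interp c)"
proof (rule strict_monoI)
  fix x y :: real assume xy: "x < y"
  have s: "c m < c n" if "m < n" for m n
    using nodes_strict_mono[OF assms] that by (rule strict_monoD)
  have m: "c m \<le> c n" if "m \<le> n" for m n using s[of m n] that by fastforce
  let ?n = "\<lfloor>x\<rfloor>" and ?m = "\<lfloor>y\<rfloor>"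
  have p: "c (?n + 1) - c ?n > 0" "c (?m + 1) - c ?m > 0" using s[of ?n "?n+1"] s[of ?m "?m+1"] by auto
  show "interp c x < interp c y"
  proof (cases "?n = ?m")
    case True
    then have "frac x < frac y" using xy by (simp add: frac_def)
    then have "(c (?n + 1) - c ?n) * frac x < (c (?n + 1) - c ?n) * frac y"
      using p by simp
    then show ?thesis using True by (simp add: interp_def)
  next
    case False
    then have "?n + 1 \<le> ?m" using xy by linarith
    have "(c (?n + 1) - c ?n) * frac x < (c (?n + 1) - c ?n) * 1"
      using p frac_lt_1[of x] by (intro mult_strict_left_mono)
    then have "interp c x < c (?n + 1)" by (simp add: interp_def)
    also have "\<dots> \<le> c ?m" using m \<open>?n + 1 \<le> ?m\<close> by blast
    also have "\<dots> \<le> interp c y"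
      using p by (simp add: interp_def)
    finally show ?thesis .
  qed
qed

lemma interp_PL_germ: assumes "nodes c" shows "PL_germ (interp c) x"
proof (cases "x = of_int \<lfloor>x\<rfloor>")
  case True
  define n where "n = \<lfloor>x\<rfloor>"
  have x: "x = of_int n" using True n_def by simp
  obtain k l where kl: "c (n + 1) = c n + 2 powi k" "c (n - 1 + 1) = c (n - 1) + 2 powi l"
    using assms unfolding nodes_def by meson
  show ?thesis
  proof (rule PL_germ_glue[where u="x - 1" and v="x + 1" and l=k and k=l])
    show "interp c x \<in> dyadic" using assms by (simp add: x nodes_def)
    show "interp c y = interp c x + 2 powi k * (y - x)" if "x \<le> y" "y \<le> x + 1" for y
      using interp_on[of n y c] that kl by (simp add: x)
    show "interp c y = interp c x + 2 powi l * (y - x)" if "x - 1 \<le> y" "y \<le> x" for y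
      using interp_on[of "n - 1" y c] that kl by (simp add: x algebra_simps)
  qed (simp_all add: x)
next
  case False
  define n where "n = \<lfloor>x\<rfloor>"
  obtain k where k: "c (n + 1) = c n + 2 powi k" "c n \<in> dyadic"
    using assms unfolding nodes_def by meson
  have n: "of_int n < x" "x < of_int n + 1" using False unfolding n_def by linarith+
  have "PL_germ (\<lambda>y. 2 powi k * y + (c n - 2 powi k * of_int n)) x"
    using k by (intro PL_germ_affine dyadic_diff dyadic_mult) auto
  then show ?thesis
  proof (rule PL_germ_cong[where d = "min (x - of_int n) (of_int n + 1 - x)"])
    fix y assume "\<bar>y - x\<bar> < min (x - of_int n) (of_int n + 1 - x)"
    then have "of_int n \<le> y" "y \<le> of_int n + 1" by linarith+
    from interp_on[OF this, of c] show "interp c y = 2 powi k * y + (c n - 2 powi k * of_int n)"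
      using k by (simp add: algebra_simps)
  qed (use n in auto)
qed

lemma interp_range:
  assumes "nodes c" "c m \<le> y" "y \<le> c n" shows "y \<in> range (interp c)"
proof -
  have "m \<le> n" using nodes_strict_mono[OF assms(1)] assms(2,3)
    by (meson leD leI order_trans strict_monoD)
  then have "\<exists>x\<ge>of_int m. x \<le> of_int n \<and> interp c x = y"
    using assms PL_germ_isCont[OF interp_PL_germ[OF assms(1)]] by (intro IVT) auto
  then show ?thesis by blast
qed

lemma interp_unique:
  assumes "\<And>n x. of_int n \<le> x \<Longrightarrow> x \<le> of_int n + 1 \<Longrightarrow> f x = c n + (c (n + 1) - c n) * (x - of_int n)"
  shows "interp c = f"
proof
  fix x :: real
  have "of_int \<lfloor>x\<rfloor> \<le> x" "x \<le> of_int \<lfloor>x\<rfloor> + 1" by linarith+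
  then show "interp c x = f x" using interp_on[of "\<lfloor>x\<rfloor>" x c] assms[of "\<lfloor>x\<rfloor>" x] by simp
qed

section \<open>Finitely many breaks on a compact interval\<close>

definition affine_on :: "(real \<Rightarrow> real) \<Rightarrow> real \<Rightarrow> real \<Rightarrow> bool" where
  "affine_on f s t \<longleftrightarrow> (\<exists>(k::int) c. c \<in> dyadic \<and> (\<forall>x\<in>{s..t}. f x = 2 powi k * x + c))"

lemma affine_onI:
  "b \<in> dyadic \<Longrightarrow> (\<And>x. s \<le> x \<Longrightarrow> x \<le> t \<Longrightarrow> f x = 2 powi k * x + b) \<Longrightarrow> affine_on f s t"
  unfolding affine_on_def by (metis atLeastAtMost_iff)

lemma affine_onE:
  assumes "affine_on f s t"
  obtains k c where "c \<in> dyadic" "\<And>x. s \<le> x \<Longrightarrow> x \<le> t \<Longrightarrow> f x = 2 powi k * x + c"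
  using assms unfolding affine_on_def by (metis atLeastAtMost_iff)

lemma affine_on_subset: "affine_on f s t \<Longrightarrow> s \<le> s' \<Longrightarrow> t' \<le> t \<Longrightarrow> affine_on f s' t'"
  unfolding affine_on_def by fastforce

lemma affine_on_right:
  assumes "\<And>t. 0 \<le> t \<Longrightarrow> t \<le> e \<Longrightarrow> f (x + t) = f x + 2 powi l * t" "f x - 2 powi l * x \<in> dyadic"
  shows "affine_on f x (x + e)"
  unfolding affine_on_def
proof (intro exI conjI ballI)
  fix y assume "y \<in> {x..x+e}"
  then show "f y = 2 powi l * y + (f x - 2 powi l * x)"
    using assms(1)[of "y - x"] by (simp add: algebra_simps)
qed (rule assms(2))

lemma affine_on_left:
  assumes "\<And>t. 0 \<le> t \<Longrightarrow> t \<le> e \<Longrightarrow> f (x - t) = f x - 2 powi k * t" "f x - 2 powi k * x \<in> dyadic"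
  shows "affine_on f (x - e) x"
  unfolding affine_on_def
proof (intro exI conjI ballI)
  fix y assume "y \<in> {x - e..x}"
  then show "f y = 2 powi k * y + (f x - 2 powi k * x)"
    using assms(1)[of "x - y"] by (simp add: algebra_simps)
qed (rule assms(2))

text \<open>
  The germ at \<open>b\<close> has only one slope, and both affine pieces must have it.
\<close>

lemma affine_on_join:
  assumes "PL_germ f b" "b \<notin> dyadic" "affine_on f s b" "affine_on f b t" "s < b" "b < t"
  shows "affine_on f s t"
proof -
  obtain k c where k: "c \<in> dyadic" "\<And>x. s \<le> x \<Longrightarrow> x \<le> b \<Longrightarrow> f x = 2 powi k * x + c"
    using assms(3) unfolding affine_on_def by (metis atLeastAtMost_iff)
  obtain l d where l: "d \<in> dyadic" "\<And>x. b \<le> x \<Longrightarrow> x \<le> t \<Longrightarrow> f x = 2 powi l * x + d"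
    using assms(4) unfolding affine_on_def by (metis atLeastAtMost_iff)
  obtain e k' l' where e: "e > 0" "\<And>t. 0 \<le> t \<Longrightarrow> t \<le> e \<Longrightarrow> f (b + t) = f b + 2 powi l' * t"
    "\<And>t. 0 \<le> t \<Longrightarrow> t \<le> e \<Longrightarrow> f (b - t) = f b - 2 powi k' * t" "k' \<noteq> l' \<Longrightarrow> b \<in> dyadic"
    using assms(1) by (rule PL_germE) blast
  have kl: "k' = l'" using e assms by blast
  define h where "h = min e (min (b - s) (t - b))"
  have h: "h > 0" "h \<le> e" "h \<le> b - s" "h \<le> t - b" using e assms by (auto simp: h_def)
  have "2 powi k * h = 2 powi k' * h"
    using e(3)[of h] h k(2)[of "b - h"] k(2)[of b] assms by (simp add: algebra_simps)
  moreover have "2 powi l * h = 2 powi l' * h"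
    using e(2)[of h] h l(2)[of "b + h"] l(2)[of b] assms by (simp add: algebra_simps)
  ultimately have "2 powi k = (2::real) powi l" using h kl by simp
  moreover have "c = d" using k(2)[of b] l(2)[of b] assms calculation by simp
  ultimately have "\<And>x. s \<le> x \<Longrightarrow> x \<le> t \<Longrightarrow> f x = 2 powi k * x + c"
    using k l by (metis linear)
  then show ?thesis using k(1) unfolding affine_on_def by auto
qed

text \<open>
  Local break sets are combined by bisection. Where two intervals meet, the meeting point is
  added to the break set if it is dyadic; otherwise the germ there has no break and the affine pieces
  on both sides fit together.
\<close>

lemma PL_germ_breaks:
  assumes "u \<le> v" and germ: "\<And>x. u \<le> x \<Longrightarrow> x \<le> v \<Longrightarrow> PL_germ f x"
  shows "\<exists>B. finite B \<and> B \<subseteq> dyadic \<and>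
    (\<forall>s t. u \<le> s \<and> s < t \<and> t \<le> v \<and> {s<..<t} \<inter> B = {} \<longrightarrow> affine_on f s t)"
proof -
  define P where "P a b \<longleftrightarrow> (u \<le> a \<and> b \<le> v \<longrightarrow> (\<exists>B. finite B \<and> B \<subseteq> dyadic \<and>
    (\<forall>s t. a \<le> s \<and> s < t \<and> t \<le> b \<and> {s<..<t} \<inter> B = {} \<longrightarrow> affine_on f s t)))" for a b
  have "P u v"
    using \<open>u \<le> v\<close>
  proof (induct rule: Bolzano)
    case (trans a b c)
    show ?case unfolding P_def
    proof
      assume ac: "u \<le> a \<and> c \<le> v"
      obtain B1 where B1: "finite B1" "B1 \<subseteq> dyadic"
        "\<And>s t. a \<le> s \<Longrightarrow> s < t \<Longrightarrow> t \<le> b \<Longrightarrow> {s<..<t} \<inter> B1 = {} \<Longrightarrow> affine_on f s t"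
        using trans ac unfolding P_def by (metis order_trans)
      obtain B2 where B2: "finite B2" "B2 \<subseteq> dyadic"
        "\<And>s t. b \<le> s \<Longrightarrow> s < t \<Longrightarrow> t \<le> c \<Longrightarrow> {s<..<t} \<inter> B2 = {} \<Longrightarrow> affine_on f s t"
        using trans ac unfolding P_def by (metis order_trans)
      show "\<exists>B. finite B \<and> B \<subseteq> dyadic \<and>
          (\<forall>s t. a \<le> s \<and> s < t \<and> t \<le> c \<and> {s<..<t} \<inter> B = {} \<longrightarrow> affine_on f s t)"
      proof (intro exI[of _ "B1 \<union> B2 \<union> ({b} \<inter> dyadic)"] conjI allI impI; (elim conjE)?)
        fix s t assume st: "a \<le> s" "s < t" "t \<le> c" "{s<..<t} \<inter> (B1 \<union> B2 \<union> {b} \<inter> dyadic) = {}"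
        consider "t \<le> b" | "b \<le> s" | "s < b" "b < t" by linarith
        then show "affine_on f s t"
        proof cases
          case 3
          have "b \<notin> dyadic" using 3 st by auto
          have "{s<..<b} \<subseteq> {s<..<t}" "{b<..<t} \<subseteq> {s<..<t}" using 3 by auto
          then have "{s<..<b} \<inter> B1 = {}" "{b<..<t} \<inter> B2 = {}" using st(4) by blast+
          then have "affine_on f s b" "affine_on f b t" using 3 st B1(3) B2(3) by simp_all
          then show ?thesis
            using germ[of b] 3 st ac trans \<open>b \<notin> dyadic\<close> by (auto intro: affine_on_join[of f b s t])
        qed (use st B1(3)[of s t] B2(3)[of s t] in auto)
      qed (use B1 B2 in auto)
    qed
  next
    case (local x)
    obtain e k l where e: "e > 0" "\<And>t. 0 \<le> t \<Longrightarrow> t \<le> e \<Longrightarrow> f (x + t) = f x + 2 powi l * t"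
      "\<And>t. 0 \<le> t \<Longrightarrow> t \<le> e \<Longrightarrow> f (x - t) = f x - 2 powi k * t"
      "f x - 2 powi k * x \<in> dyadic" "k \<noteq> l \<Longrightarrow> x \<in> dyadic"
      using germ[OF local] by (rule PL_germE) blast
    have "f x - 2 powi l * x \<in> dyadic"
      using PL_germ_dyadic_iff[OF germ[OF local]] e(4,5)
      by (cases "k = l") (auto intro!: dyadic_diff dyadic_mult)
    then have aff: "affine_on f x (x + e)" "affine_on f (x - e) x"
      using affine_on_right[of e f x l] affine_on_left[of e f x k] e by auto
    have *: "affine_on f s t" if "x - e \<le> s" "s < t" "t \<le> x + e" "{s<..<t} \<inter> ({x} \<inter> dyadic) = {}" for s t
    proof -
      consider "t \<le> x" | "x \<le> s" | "s < x" "x < t" by linarith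
      then show ?thesis
      proof cases
        case 3
        then have "x \<in> {s<..<t}" by simp
        then have "x \<notin> dyadic" using that(4) by blast
        have "x - e < x" "x < x + e" using e(1) by linarith+
        then have "affine_on f (x - e) (x + e)"
          using affine_on_join[OF germ[OF local(1) local(2)] \<open>x \<notin> dyadic\<close> aff(2) aff(1)] by blast
        then show ?thesis using affine_on_subset that(1,3) by blast
      qed (use aff that(1,3) affine_on_subset in blast)+
    qed
    show ?case
    proof (intro exI[of _ e] conjI allI impI)
      fix a b assume "a \<le> x \<and> x \<le> b \<and> b - a < e"
      then show "P a b" unfolding P_def
        by (intro impI exI[of _ "{x} \<inter> dyadic"]) (auto intro!: *)
    qed (use e(1) in auto)
  qed
  then show ?thesis by (simp add: P_def)
qed

lemma dyadic_common_denominator: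
  assumes "finite B" "B \<subseteq> dyadic"
  shows "\<exists>m. \<forall>b\<in>B. 2 ^ m * b \<in> \<int>"
  using assms
proof (induct rule: finite_induct)
  case (insert b B)
  then obtain m where m: "\<forall>b\<in>B. 2 ^ m * b \<in> \<int>" by blast
  obtain p q where b: "b = of_int p / 2 ^ q" using insert unfolding dyadic_def by blast
  have "2 ^ (m + q) * b \<in> \<int>" by (simp add: b power_add)
  moreover have "2 ^ (m + q) * b' \<in> \<int>" if "b' \<in> B" for b'
    using m that Ints_mult[of "2 ^ q" "2 ^ m * b'"] by (simp add: power_add mult_ac)
  ultimately show ?case by blast
qed simp

section \<open>Piecewise linear homeomorphisms of the line that are translations near infinity\<close>

text \<open>
  The inverse of a function, named so as to keep it apart from the inverse in a group.
\<close>

abbreviation finv :: "(real \<Rightarrow> real) \<Rightarrow> real \<Rightarrow> real" where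
  "finv \<equiv> inv_into UNIV"

definition PL_homeo :: "(real \<Rightarrow> real) \<Rightarrow> bool" where
  "PL_homeo f \<longleftrightarrow> strict_mono f \<and> surj f \<and> (\<forall>x. PL_germ f x)"

lemma PL_homeoI:
  "strict_mono f \<Longrightarrow> surj f \<Longrightarrow> (\<And>x. PL_germ f x) \<Longrightarrow> PL_homeo f"
  unfolding PL_homeo_def by blast

lemma PL_homeo_bij: "PL_homeo f \<Longrightarrow> bij f"
  by (simp add: PL_homeo_def bij_def strict_mono_imp_inj_on)

lemma PL_homeo_inv_f [simp]: "PL_homeo f \<Longrightarrow> finv f (f x) = x"
  and PL_homeo_f_inv [simp]: "PL_homeo f \<Longrightarrow> f (finv f x) = x"
  using PL_homeo_bij by (simp_all add: bij_is_inj bij_is_surj surj_f_inv_f)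

lemma PL_homeo_less_iff: "PL_homeo f \<Longrightarrow> f x < f y \<longleftrightarrow> x < y"
  and PL_homeo_le_iff: "PL_homeo f \<Longrightarrow> f x \<le> f y \<longleftrightarrow> x \<le> y"
  by (auto simp: PL_homeo_def strict_mono_less strict_mono_less_eq)

lemma PL_homeo_comp: assumes "PL_homeo f" "PL_homeo g" shows "PL_homeo (f \<circ> g)"
proof (rule PL_homeoI)
  show "strict_mono (f \<circ> g)" using assms by (auto intro!: strict_monoI simp: PL_homeo_less_iff)
  show "surj (f \<circ> g)" using assms by (intro comp_surj) (auto simp: PL_homeo_def)
  show "PL_germ (f \<circ> g) x" for x
    using PL_germ_comp[of g x f] assms by (simp add: PL_homeo_def comp_def)
qed

lemma PL_homeo_inv: assumes "PL_homeo f" shows "PL_homeo (finv f)"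
proof (rule PL_homeoI)
  show "strict_mono (finv f)"
  proof (rule strict_monoI)
    fix x y :: real assume "x < y"
    then have "f (finv f x) < f (finv f y)" using assms by simp
    then show "finv f x < finv f y" using PL_homeo_less_iff[OF assms] by blast
  qed
  show "surj (finv f)" using PL_homeo_bij[OF assms] by (simp add: bij_imp_bij_inv bij_is_surj)
  show "PL_germ (finv f) x" for x
    using PL_germ_inverse[of f "finv f x" "finv f"] assms by (simp add: PL_homeo_def surj_f_inv_f strict_mono_imp_inj_on)
qed

text \<open>
  The translation numbers \<open>i\<close> at \<open>-\<infinity>\<close> and \<open>j\<close> at \<open>\<infinity>\<close> correspond to the logarithms of the slopes
  at the two endpoints of the unit interval.
\<close>

definition trans_ends :: "(real \<Rightarrow> real) \<Rightarrow> int \<Rightarrow> int \<Rightarrow> bool" where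
  "trans_ends f i j \<longleftrightarrow> (\<exists>N. (\<forall>x\<le>-N. f x = x + of_int i) \<and> (\<forall>x\<ge>N. f x = x + of_int j))"

definition T_set :: "(real \<Rightarrow> real) set" where
  "T_set = {f. PL_homeo f \<and> (\<exists>i j. trans_ends f i j)}"

definition T :: "(real \<Rightarrow> real) monoid" where
  "T = \<lparr>carrier = T_set, mult = (\<lambda>f g. f \<circ> g), one = id\<rparr>"

lemma carrier_T [simp]: "carrier T = T_set" and mult_T [simp]: "f \<otimes>\<^bsub>T\<^esub> g = f \<circ> g"
  and one_T [simp]: "\<one>\<^bsub>T\<^esub> = id"
  by (simp_all add: T_def)

lemma trans_endsE:
  assumes "trans_ends f i j"
  obtains N where "N \<ge> 0" "\<And>x. x \<le> - N \<Longrightarrow> f x = x + of_int i" "\<And>x. x \<ge> N \<Longrightarrow> f x = x + of_int j"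
proof -
  obtain N where N: "\<forall>x\<le>-N. f x = x + of_int i" "\<forall>x\<ge>N. f x = x + of_int j"
    using assms unfolding trans_ends_def by blast
  show ?thesis by (rule that[of "max N 0"]) (use N in auto)
qed

lemma trans_endsI:
  assumes "\<And>x. x \<le> - N \<Longrightarrow> f x = x + of_int i" "\<And>x. x \<ge> M \<Longrightarrow> f x = x + of_int j"
  shows "trans_ends f i j"
  unfolding trans_ends_def by (rule exI[of _ "max N M"]) (use assms in auto)

lemma trans_ends_unique:
  assumes "trans_ends f i j" "trans_ends f i' j'" shows "i = i' \<and> j = j'"
proof -
  obtain N M where "\<And>x. x \<le> - N \<Longrightarrow> f x = x + of_int i" "\<And>x. x \<ge> N \<Longrightarrow> f x = x + of_int j"
    "\<And>x. x \<le> - M \<Longrightarrow> f x = x + of_int i'" "\<And>x. x \<ge> M \<Longrightarrow> f x = x + of_int j'"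
    using assms by (metis trans_endsE)
  from this(1,3)[of "- max N M"] this(2,4)[of "max N M"] show ?thesis by auto
qed

lemma trans_ends_comp:
  assumes "trans_ends f i j" "trans_ends g i' j'"
  shows "trans_ends (f \<circ> g) (i + i') (j + j')"
proof -
  obtain N where N: "\<And>x. x \<le> - N \<Longrightarrow> f x = x + of_int i" "\<And>x. x \<ge> N \<Longrightarrow> f x = x + of_int j"
    using assms(1) by (rule trans_endsE) blast
  obtain M where M: "\<And>x. x \<le> - M \<Longrightarrow> g x = x + of_int i'" "\<And>x. x \<ge> M \<Longrightarrow> g x = x + of_int j'"
    using assms(2) by (rule trans_endsE) blast
  show ?thesis
    by (rule trans_endsI[of "max M (N + of_int i')" _ _ "max M (N - of_int j')"]) (auto simp: N M)
qed

lemma trans_ends_id: "trans_ends id 0 0"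
  by (rule trans_endsI[of 0 _ _ 0]) auto

lemma T_surj: "f \<in> T_set \<Longrightarrow> surj f" and T_strict_mono: "f \<in> T_set \<Longrightarrow> strict_mono f"
  and T_germ: "f \<in> T_set \<Longrightarrow> PL_germ f x"
  by (auto simp: T_set_def PL_homeo_def)

lemma T_trans_ends: assumes "f \<in> T_set" obtains i j where "trans_ends f i j"
  using assms by (auto simp: T_set_def PL_homeo_def)

lemma T_inj: "f \<in> T_set \<Longrightarrow> inj f"
  by (simp add: T_strict_mono strict_mono_imp_inj_on)

lemma T_bij: "f \<in> T_set \<Longrightarrow> bij f"
  by (simp add: bij_def T_surj T_inj)

lemma T_inv_f [simp]: "f \<in> T_set \<Longrightarrow> finv f (f x) = x"
  and T_f_inv [simp]: "f \<in> T_set \<Longrightarrow> f (finv f x) = x"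
  by (simp_all add: T_inj T_surj surj_f_inv_f)

lemma T_inv_comp: "f \<in> T_set \<Longrightarrow> finv f \<circ> f = id"
  and T_comp_inv: "f \<in> T_set \<Longrightarrow> f \<circ> finv f = id"
  by (auto simp: fun_eq_iff)

lemma trans_ends_inv:
  assumes "f \<in> T_set" "trans_ends f i j" shows "trans_ends (finv f) (-i) (-j)"
proof -
  obtain N where N: "\<And>x. x \<le> - N \<Longrightarrow> f x = x + of_int i" "\<And>x. x \<ge> N \<Longrightarrow> f x = x + of_int j"
    using assms(2) by (rule trans_endsE) blast
  show ?thesis
  proof (rule trans_endsI[of "N - of_int i" _ _ "N + of_int j"])
    fix x assume "x \<le> - (N - real_of_int i)"
    then have "f (x - of_int i) = x" by (simp add: N)
    then show "finv f x = x + of_int (- i)" using T_inv_f[OF assms(1), of "x - of_int i"] by simp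
  next
    fix x assume "N + real_of_int j \<le> x"
    then have "f (x - of_int j) = x" by (simp add: N)
    then show "finv f x = x + of_int (- j)" using T_inv_f[OF assms(1), of "x - of_int j"] by simp
  qed
qed

lemma T_less_iff [simp]: "f \<in> T_set \<Longrightarrow> f x < f y \<longleftrightarrow> x < y"
  and T_le_iff [simp]: "f \<in> T_set \<Longrightarrow> f x \<le> f y \<longleftrightarrow> x \<le> y"
  and T_eq_iff: "f \<in> T_set \<Longrightarrow> f x = f y \<longleftrightarrow> x = y"
  by (auto simp: T_strict_mono strict_mono_less strict_mono_less_eq strict_mono_eq)

lemma T_comp [intro]: assumes "f \<in> T_set" "g \<in> T_set" shows "f \<circ> g \<in> T_set"
  using assms PL_homeo_comp trans_ends_comp unfolding T_set_def by blast

lemma T_inv [intro]: assumes "f \<in> T_set" shows "finv f \<in> T_set"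
  using assms PL_homeo_inv trans_ends_inv[of f] unfolding T_set_def by blast

lemma T_id [simp]: "id \<in> T_set"
proof -
  have "PL_germ id x" for x using PL_germ_affine[of 0 0 x] by (simp add: id_def)
  moreover have "strict_mono (id :: real \<Rightarrow> real)" by (simp add: strict_mono_def)
  moreover have "surj (id :: real \<Rightarrow> real)" by simp
  ultimately show ?thesis using trans_ends_id unfolding T_set_def PL_homeo_def by blast
qed

lemma funpow_T_set: "g \<in> T_set \<Longrightarrow> (g ^^ n) \<in> T_set"
  by (induct n) (auto simp del: id_apply)

lemma group_T: "group T"
proof (rule groupI)
  show "\<exists>y\<in>carrier T. y \<otimes>\<^bsub>T\<^esub> x = \<one>\<^bsub>T\<^esub>" if "x \<in> carrier T" for x
    using that by (intro bexI[of _ "finv x"]) (auto simp: T_inv_comp)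
qed (auto simp: comp_assoc)

interpretation T: group T by (rule group_T)

lemma m_inv_T [simp]: "f \<in> T_set \<Longrightarrow> inv\<^bsub>T\<^esub> f = finv f"
  by (rule T.inv_equality) (auto simp: T_inv_comp)

lemma inv_comp_T:
  assumes "f \<in> T_set" "g \<in> T_set" shows "finv (f \<circ> g) = finv g \<circ> finv f"
  using T.inv_mult_group[of f g] T_comp[OF assms] assms by simp

lemma subgroup_T_D:
  assumes "subgroup H T"
  shows "H \<subseteq> T_set" "id \<in> H" "\<And>f g. f \<in> H \<Longrightarrow> g \<in> H \<Longrightarrow> f \<circ> g \<in> H" "\<And>f. f \<in> H \<Longrightarrow> finv f \<in> H"
proof -
  show s: "H \<subseteq> T_set" using subgroup.subset[OF assms] by simp
  show "id \<in> H" using subgroup.one_closed[OF assms] by simp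
  show "f \<circ> g \<in> H" if "f \<in> H" "g \<in> H" for f g using subgroup.m_closed[OF assms that] by simp
  show "finv f \<in> H" if "f \<in> H" for f using subgroup.m_inv_closed[OF assms that] that s by auto
qed

lemma interp_T:
  assumes "nodes c" "\<And>n. n \<le> - N \<Longrightarrow> c n = of_int (n + i)" "\<And>n. n \<ge> N \<Longrightarrow> c n = of_int (n + j)"
  shows "interp c \<in> T_set" "trans_ends (interp c) i j"
proof -
  have lo: "interp c x = x + of_int i" if "x \<le> of_int (- N - 1)" for x
  proof -
    have "\<lfloor>x\<rfloor> \<le> - N - 1" using that by linarith
    then show ?thesis by (simp add: interp_def assms(2) frac_def)
  qed
  have hi: "interp c x = x + of_int j" if "x \<ge> of_int N" for x
  proof -
    have "\<lfloor>x\<rfloor> \<ge> N" using that by linarith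
    then show ?thesis by (simp add: interp_def assms(3) frac_def)
  qed
  show te: "trans_ends (interp c) i j"
    by (rule trans_endsI[of "of_int (N + 1)" _ _ "of_int N"]) (use lo hi in auto)
  have "y \<in> range (interp c)" for y
  proof (rule interp_range[OF assms(1)])
    define n where "n = min (- N) (\<lfloor>y\<rfloor> - i)"
    define m where "m = max N (\<lfloor>y\<rfloor> + 1 - j)"
    have "c n = of_int (n + i)" by (rule assms(2)) (simp add: n_def)
    also have "\<dots> \<le> of_int \<lfloor>y\<rfloor>" by (simp only: of_int_le_iff) (simp add: n_def)
    finally show "c n \<le> y" by linarith
    have "c m = of_int (m + j)" by (rule assms(3)) (simp add: m_def)
    moreover have "of_int (m + j) \<ge> real_of_int (\<lfloor>y\<rfloor> + 1)" by (simp only: of_int_le_iff) (simp add: m_def)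
    ultimately show "y \<le> c m" by linarith
  qed
  then show "interp c \<in> T_set"
    using te interp_strict_mono[OF assms(1)] interp_PL_germ[OF assms(1)]
    unfolding T_set_def PL_homeo_def by blast
qed

section \<open>Normal subgroups containing the commutators of compactly supported maps\<close>

definition shift :: "int \<Rightarrow> real \<Rightarrow> real" where
  "shift i x = x + of_int i"

text \<open>
  The compactly supported maps, which form the kernel of the homomorphism that sends a map to its
  pair of translation numbers.
\<close>

definition T_c :: "(real \<Rightarrow> real) set" where
  "T_c = {f \<in> T_set. trans_ends f 0 0}"

lemma T_c_T: "f \<in> T_c \<Longrightarrow> f \<in> T_set" by (simp add: T_c_def)

lemma T_c_bound:
  assumes "f \<in> T_c"
  obtains N where "N \<ge> 0" "\<And>x. x \<le> - N \<Longrightarrow> f x = x" "\<And>x. x \<ge> N \<Longrightarrow> f x = x"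
  using assms trans_endsE[of f 0 0] unfolding T_c_def by auto

text \<open>
  On the line, these are the standard generators \<open>x\<^sub>n\<close> of Thompson's group.
\<close>

definition stretch :: "int \<Rightarrow> real \<Rightarrow> real" where
  "stretch n x = (if x \<le> of_int n then x else if x \<le> of_int n + 1 then 2 * x - of_int n else x + 1)"

lemma shift_T [simp]: "shift i \<in> T_set" and shift_ends: "trans_ends (shift i) i i"
proof -
  show te: "trans_ends (shift i) i i" by (rule trans_endsI[of 0 _ _ 0]) (auto simp: shift_def)
  have "PL_germ (shift i) x" for x
    using PL_germ_affine[of "of_int i" 0 x] by (simp add: shift_def[abs_def])
  moreover have "strict_mono (shift i)" by (simp add: strict_mono_def shift_def)
  moreover have "surj (shift i)" by (rule surjI[of _ "\<lambda>x. x - of_int i"]) (simp add: shift_def)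
  ultimately show "shift i \<in> T_set" using te unfolding T_set_def PL_homeo_def by blast
qed

lemma nodesI:
  assumes "\<And>n. c n \<in> dyadic" "\<And>n. \<exists>k::int. c (n + 1) = c n + 2 powi k" shows "nodes c"
  using assms by (simp add: nodes_def)

lemma stretch_T [simp]: "stretch n \<in> T_set" and stretch_ends: "trans_ends (stretch n) 0 1"
proof -
  define c :: "int \<Rightarrow> real" where "c m = of_int (if m \<le> n then m else m + 1)" for m
  have eq: "interp c = stretch n"
  proof (rule interp_unique)
    fix m :: int and x :: real assume m: "of_int m \<le> x" "x \<le> of_int m + 1"
    consider "m < n" | "m = n" | "m > n" by linarith
    then show "stretch n x = c m + (c (m + 1) - c m) * (x - of_int m)"
    proof cases
      case 1
      then have "real_of_int m + 1 \<le> of_int n" by linarith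
      then show ?thesis using 1 m by (simp add: stretch_def c_def)
    next
      case 2 then show ?thesis using m by (auto simp: stretch_def c_def)
    next
      case 3
      then have "real_of_int m \<ge> of_int n + 1" by linarith
      then show ?thesis using 3 m by (auto simp: stretch_def c_def)
    qed
  qed
  have "nodes c"
  proof (rule nodesI)
    fix m :: int
    show "c m \<in> dyadic" unfolding c_def by (rule dyadic_of_int)
    show "\<exists>k::int. c (m + 1) = c m + 2 powi k"
      by (rule exI[of _ "if m = n then 1 else 0"]) (auto simp: c_def)
  qed
  then have "interp c \<in> T_set" "trans_ends (interp c) 0 1"
    by (rule interp_T[where N="\<bar>n\<bar> + 1" and i=0 and j=1]; simp add: c_def)+
  then show "stretch n \<in> T_set" "trans_ends (stretch n) 0 1" by (simp_all add: eq)
qed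

text \<open>
  The defining relations of Thompson's group: to the right of \<open>n + 1\<close>, the map \<open>stretch n\<close> is the
  translation by one, and this conjugates \<open>stretch m\<close> to \<open>stretch (m + 1)\<close>.
\<close>

lemma stretch_comm:
  assumes "n < m" shows "stretch n (stretch m x) = stretch (m + 1) (stretch n x)"
proof -
  have "real_of_int n + 1 \<le> of_int m" using assms by linarith
  then show ?thesis unfolding stretch_def by auto
qed

lemma stretch_comm_inv:
  assumes "n < m" shows "finv (stretch (m + 1)) (stretch n x) = stretch n (finv (stretch m) x)"
  using stretch_comm[OF assms, of "finv (stretch m) x"]
  by (metis T_f_inv T_inv_f stretch_T)

lemma stretch_comm_inv_inv:
  assumes "n < m" shows "finv (stretch m) (finv (stretch n) x) = finv (stretch n) (finv (stretch (m + 1)) x)"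
  using stretch_comm[OF assms, of "finv (stretch m) (finv (stretch n) x)"]
  by (metis T_f_inv T_inv_f stretch_T)

lemma T_c_stretch: "stretch n \<circ> finv (stretch m) \<in> T_c"
  using trans_ends_comp[OF stretch_ends trans_ends_inv[OF stretch_T stretch_ends]]
  by (simp add: T_c_def T_comp T_inv)

text \<open>
  A map that is affine on the image of each cell commutes with interpolation.
\<close>

lemma interp_comp:
  assumes "nodes c" and aff: "\<And>n. affine_on g (c n) (c (n + 1))"
  shows "interp (\<lambda>n. g (c n)) = g \<circ> interp c" and "nodes (\<lambda>n. g (c n))"
proof -
  show "interp (\<lambda>n. g (c n)) = g \<circ> interp c"
  proof (rule interp_unique)
    fix n :: int and x :: real assume x: "of_int n \<le> x" "x \<le> of_int n + 1"
    obtain k b where k: "\<And>y. c n \<le> y \<Longrightarrow> y \<le> c (n + 1) \<Longrightarrow> g y = 2 powi k * y + b"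
      using aff[of n] by (rule affine_onE) blast
    define D where "D = c (n + 1) - c n"
    have D: "D > 0" "c (n + 1) = c n + D" using nodes_gt[OF assms(1), of n] by (auto simp: D_def)
    have "D * (x - of_int n) \<le> D * 1" using D x by (intro mult_left_mono) auto
    moreover have "D * (x - of_int n) \<ge> 0" using D x by simp
    ultimately have y: "g (c n + D * (x - of_int n)) = 2 powi k * (c n + D * (x - of_int n)) + b"
      "g (c n) = 2 powi k * c n + b" "g (c n + D) = 2 powi k * (c n + D) + b"
      using D by (auto intro!: k)
    have i: "interp c x = c n + D * (x - of_int n)" using interp_on[OF x] D_def by simp
    show "(g \<circ> interp c) x = g (c n) + (g (c (n + 1)) - g (c n)) * (x - of_int n)"
      unfolding comp_apply i D(2) y by (simp add: algebra_simps)
  qed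
  show "nodes (\<lambda>n. g (c n))"
  proof (rule nodesI)
    fix n
    obtain k b where b: "b \<in> dyadic" and k: "\<And>y. c n \<le> y \<Longrightarrow> y \<le> c (n + 1) \<Longrightarrow> g y = 2 powi k * y + b"
      using aff[of n] by (rule affine_onE) blast
    obtain l where l: "c (n + 1) = c n + 2 powi l" "c n \<in> dyadic"
      using assms(1) unfolding nodes_def by meson
    have e: "g (c n) = 2 powi k * c n + b" "g (c n + 2 powi l) = 2 powi k * (c n + 2 powi l) + b"
      using k[of "c n"] k[of "c (n + 1)"] l by auto
    show "g (c n) \<in> dyadic" using e(1) b l(2) by (simp add: dyadic_add dyadic_mult)
    have "g (c (n + 1)) = g (c n) + 2 powi (k + l)"
      unfolding l(1) e by (simp add: power_int_add algebra_simps)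
    then show "\<exists>k::int. g (c (n + 1)) = g (c n) + 2 powi k" by blast
  qed
qed

text \<open>
  The supports of \<open>f\<close> and \<open>g\<close> lie on different sides of \<open>b\<close>.
\<close>

lemma commute_disjoint:
  assumes "f \<in> T_set" "g \<in> T_set" "\<And>x. x \<ge> b \<Longrightarrow> g x = x" "\<And>x. x \<le> b \<Longrightarrow> f x = x"
  shows "f (g x) = g (f x)"
proof (cases "x \<le> b")
  case True
  then have "g x \<le> b" using T_le_iff[OF assms(2), of x b] assms(3)[of b] by simp
  then show ?thesis using True assms by simp
next
  case False
  then have "f x \<ge> b" using T_le_iff[OF assms(1), of b x] assms(4)[of b] by simp
  then show ?thesis using False assms by simp
qed

lemma powi_Ints_nonneg:
  assumes "(2::real) powi k \<in> \<int>" shows "k \<ge> 0"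
proof (rule ccontr)
  assume "\<not> k \<ge> 0"
  then have "(2::real) powi k < 2 powi 0" by (intro power_int_strict_increasing) auto
  moreover obtain z where z: "(2::real) powi k = of_int z" using assms Ints_cases by blast
  moreover have "(2::real) powi k > 0" by simp
  ultimately show False by simp
qed

text \<open>
  A normal subgroup of \<open>T\<close>, spelled out for functions under composition.
\<close>

locale normal_T =
  fixes C :: "(real \<Rightarrow> real) set"
  assumes sub: "C \<subseteq> T_set" and id_in: "id \<in> C"
    and comp_in: "f \<in> C \<Longrightarrow> g \<in> C \<Longrightarrow> f \<circ> g \<in> C"
    and inv_in: "f \<in> C \<Longrightarrow> finv f \<in> C"
    and conj_in: "f \<in> C \<Longrightarrow> g \<in> T_set \<Longrightarrow> g \<circ> f \<circ> finv g \<in> C"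
begin

lemma inT: "f \<in> C \<Longrightarrow> f \<in> T_set" using sub by blast

lemma move_right:
  assumes "g \<in> T_set" "f \<in> C" shows "\<exists>f'\<in>C. g \<circ> f = f' \<circ> g"
  by (rule bexI[OF _ conj_in[OF assms(2,1)]]) (use assms in \<open>auto simp: fun_eq_iff\<close>)

text \<open>
  Write \<open>x\<^sub>n\<close> for \<open>stretch n\<close>, and put \<open>\<alpha> = x\<^sub>n x\<^sub>n\<^sub>+\<^sub>1\<inverse>\<close> and \<open>\<beta> = x\<^sub>n x\<^sub>n\<^sub>+\<^sub>3\<inverse>\<close>. Both are
  compactly supported, and \<open>x\<^sub>n\<^sub>+\<^sub>3\<close> commutes with \<open>\<alpha>\<close>. Hence conjugating \<open>\<alpha>\<close> by \<open>\<beta>\<close> is the same as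
  conjugating it by \<open>x\<^sub>n\<close>, and this gives \<open>x\<^sub>n x\<^sub>n\<^sub>+\<^sub>2\<inverse>\<close>. So the commutator of \<open>\<beta>\<close> and \<open>\<alpha>\<close> is
  \<open>x\<^sub>n x\<^sub>n\<^sub>+\<^sub>2\<inverse> x\<^sub>n\<^sub>+\<^sub>1 x\<^sub>n\<inverse>\<close>, which is conjugate to \<open>x\<^sub>n\<^sub>+\<^sub>1 x\<^sub>n\<^sub>+\<^sub>2\<inverse>\<close>.
\<close>

lemma stretch_Suc_in:
  assumes comm: "\<And>f g. f \<in> T_c \<Longrightarrow> g \<in> T_c \<Longrightarrow> f \<circ> g \<circ> finv f \<circ> finv g \<in> C"
  shows "stretch (n + 1) \<circ> finv (stretch (n + 2)) \<in> C"
proof -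
  let ?a = "stretch n" and ?b = "stretch (n + 1)" and ?c = "stretch (n + 2)" and ?d = "stretch (n + 3)"
  define al where "al = ?a \<circ> finv ?b"
  define be where "be = ?a \<circ> finv ?d"
  define h where "h = ?a \<circ> finv ?c \<circ> ?b \<circ> finv ?a"
  have c: "al \<in> T_c" "be \<in> T_c" unfolding al_def be_def by (rule T_c_stretch)+
  then have T: "al \<in> T_set" "be \<in> T_set" by (auto simp: T_c_def)
  have "finv ?d (?a x) = ?a (finv ?c x)" "finv ?c (?a x) = ?a (finv ?b x)"
    "finv ?c (finv ?b x) = finv ?b (finv ?d x)" for x
    using stretch_comm_inv[of n "n+2" x] stretch_comm_inv[of n "n+1" x]
      stretch_comm_inv_inv[of "n+1" "n+2" x] by (simp_all add: add.assoc)
  then have *: "be (al x) = h (al (be x))" for x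
    unfolding al_def be_def h_def by simp
  have "be \<circ> al \<circ> finv be \<circ> finv al = h"
    using T by (simp add: fun_eq_iff *)
  then have "h \<in> C" using comm[OF c(2,1)] by simp
  then have "finv ?a \<circ> h \<circ> finv (finv ?a) \<in> C" by (rule conj_in) (simp add: T_inv)
  moreover have "finv ?a \<circ> h \<circ> finv (finv ?a) = finv ?c \<circ> ?b"
    unfolding h_def by (simp add: fun_eq_iff inv_inv_eq T_bij)
  ultimately have "?c \<circ> (finv ?c \<circ> ?b) \<circ> finv ?c \<in> C" by (metis conj_in stretch_T)
  moreover have "?c \<circ> (finv ?c \<circ> ?b) \<circ> finv ?c = ?b \<circ> finv ?c" by (simp add: fun_eq_iff)
  ultimately show ?thesis by simp
qed

lemma stretch_coset:
  assumes "\<And>n. stretch n \<circ> finv (stretch (n + 1)) \<in> C"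
  shows "\<exists>f\<in>C. stretch n = f \<circ> stretch 0"
proof (induct n rule: int_induct[where k=0])
  case base show ?case by (rule bexI[OF _ id_in]) simp
next
  case (step1 i)
  then obtain f where f: "f \<in> C" "stretch i = f \<circ> stretch 0" by blast
  let ?g = "stretch i \<circ> finv (stretch (i + 1))"
  have "stretch (i + 1) = finv ?g \<circ> stretch i"
    by (simp add: inv_comp_T T_inv inv_inv_eq T_bij fun_eq_iff)
  then have "stretch (i + 1) = (finv ?g \<circ> f) \<circ> stretch 0" by (simp add: f(2) comp_assoc)
  then show ?case using comp_in[OF inv_in[OF assms[of i]] f(1)] by blast
next
  case (step2 i)
  then obtain f where f: "f \<in> C" "stretch i = f \<circ> stretch 0" by blast
  let ?g = "stretch (i - 1) \<circ> finv (stretch i)"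
  have "stretch (i - 1) = ?g \<circ> stretch i" by (simp add: fun_eq_iff)
  then have "stretch (i - 1) = (?g \<circ> f) \<circ> stretch 0" by (simp add: f(2) comp_assoc)
  moreover have "?g \<in> C" using assms[of "i - 1"] by simp
  ultimately show ?case using comp_in[OF _ f(1), of ?g] by blast
qed

text \<open>
  If all nodes are integers and some cell \<open>[n, n + 1]\<close> is mapped to an interval of length greater than
  one, then that interval can be halved: the map factors as a map with the halved interval
  after \<open>stretch n\<close>. Each such step lowers the difference \<open>p\<close> of the translation numbers by one; for
  \<open>p = 0\<close> every cell has length one and the map is a translation. So the map is a
  translation times a product of \<open>p\<close> generators, and all generators lie in one coset.
\<close>

lemma interp_coset:
  assumes st: "\<And>n. stretch n \<circ> finv (stretch (n + 1)) \<in> C"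
    and "nodes c" "\<And>n. c n \<in> \<int>"
    and "\<And>n. n \<le> - N \<Longrightarrow> c n = of_int (n + i)" "\<And>n. n \<ge> N \<Longrightarrow> c n = of_int (n + i + int p)"
  shows "\<exists>f\<in>C. interp c = f \<circ> (shift i \<circ> stretch 0 ^^ p)"
  using assms(2-)
proof (induct p arbitrary: c N)
  case 0
  have ge: "c (n + 1) \<ge> c n + 1" for n
  proof -
    obtain z w where "c n = of_int z" "c (n + 1) = of_int w" using 0(2) Ints_cases by metis
    then show ?thesis using nodes_gt[OF 0(1), of n] by simp
  qed
  have mono: "c n - of_int n \<le> c m - of_int m" if "n \<le> m" for n m
    using that
  proof (induct m rule: int_ge_induct)
    case (step m) then show ?case using ge[of m] by simp
  qed simp
  have "c n = of_int (n + i)" for n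
    using mono[of "min n (-N)" n] mono[of n "max n N"] 0(3)[of "min n (-N)"] 0(4)[of "max n N"] by simp
  then have "interp c = shift i"
    by (intro interp_unique) (simp add: shift_def)
  then show ?case by (intro bexI[OF _ id_in]) simp
next
  case (Suc p)
  have "\<exists>n. c (n + 1) \<noteq> c n + 1"
  proof (rule ccontr)
    assume "\<not> ?thesis"
    then have e: "c (n + 1) = c n + 1" for n by blast
    have "c m = c n + (of_int m - of_int n)" if "n \<le> m" for n m
      using that by (induct m rule: int_ge_induct) (auto simp: e)
    from this[of "- \<bar>N\<bar>" "\<bar>N\<bar>"] Suc(4)[of "- \<bar>N\<bar>"] Suc(5)[of "\<bar>N\<bar>"]
    show False by simp
  qed
  then obtain n where n: "c (n + 1) \<noteq> c n + 1" by blast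
  obtain k' :: int where k': "c (n + 1) = c n + 2 powi k'" using Suc(2) unfolding nodes_def by meson
  have "2 powi k' = c (n + 1) - c n" using k' by simp
  then have "k' \<ge> 0" using Suc(3) by (intro powi_Ints_nonneg) (metis Ints_diff)
  moreover have "k' \<noteq> 0" using n k' by auto
  ultimately obtain k where k: "k' = int k + 1" by (metis add.commute nonneg_int_cases of_nat_0 not0_implies_Suc of_nat_Suc)
  have ck: "c (n + 1) = c n + 2 * 2 ^ k" using k' by (simp add: k power_int_add)
  define d where "d m = (if m \<le> n then c m else if m = n + 1 then c n + 2 ^ k else c (m - 1))" for m
  have dn: "nodes d"
  proof (rule nodesI)
    fix m
    have "2 ^ k = (2::real) powi int k" by simp
    then have "c n + 2 ^ k \<in> dyadic" using Suc(2) by (metis dyadic_add dyadic_powi nodes_def)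
    then show "d m \<in> dyadic" using Suc(2) by (auto simp: d_def nodes_def)
    consider "m < n" | "m = n \<or> m = n + 1" | "m > n + 1" by linarith
    then show "\<exists>l::int. d (m + 1) = d m + 2 powi l"
    proof cases
      case 1 then show ?thesis using Suc(2) by (simp add: d_def nodes_def)
    next
      case 2 then show ?thesis by (intro exI[of _ "int k"]) (auto simp: d_def ck)
    next
      case 3
      have "\<exists>l::int. c (m - 1 + 1) = c (m - 1) + 2 powi l" using Suc(2) unfolding nodes_def by blast
      then show ?thesis using 3 by (simp add: d_def)
    qed
  qed
  have "\<exists>f\<in>C. interp d = f \<circ> (shift i \<circ> stretch 0 ^^ p)"
  proof (rule Suc(1)[OF dn])
    show "d m \<in> \<int>" for m using Suc(3) by (simp add: d_def)
    show "d m = of_int (m + i)" if "m \<le> - (\<bar>N\<bar> + \<bar>n\<bar> + 2)" for m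
    proof -
      have "m \<le> n" "m \<le> - N" using that by linarith+
      then show ?thesis using Suc(4)[of m] by (simp add: d_def)
    qed
    show "d m = of_int (m + i + int p)" if "m \<ge> \<bar>N\<bar> + \<bar>n\<bar> + 2" for m
    proof -
      have "m > n + 1" "m - 1 \<ge> N" using that by linarith+
      then show ?thesis using Suc(5)[of "m - 1"] by (simp add: d_def)
    qed
  qed
  then obtain f where f: "f \<in> C" "interp d = f \<circ> (shift i \<circ> stretch 0 ^^ p)" by blast
  have split: "interp c = interp d \<circ> stretch n"
  proof (rule interp_unique)
    fix m :: int and x :: real assume x: "of_int m \<le> x" "x \<le> of_int m + 1"
    consider "m < n" | "m = n" "2 * x \<le> 2 * of_int n + 1" | "m = n" "2 * x \<ge> 2 * of_int n + 1" | "m > n"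
      by linarith
    then show "(interp d \<circ> stretch n) x = c m + (c (m + 1) - c m) * (x - of_int m)"
    proof cases
      case 1
      then have "real_of_int m + 1 \<le> of_int n" by linarith
      then show ?thesis using 1 x by (simp add: stretch_def interp_on[OF x] d_def)
    next
      case 2
      have s: "stretch n x = 2 * x - of_int n" using 2 x by (simp add: stretch_def)
      moreover have "interp d (2 * x - of_int n) = c n + 2 ^ k * (2 * x - of_int n - of_int n)"
        using 2 x by (subst interp_on[of n]) (auto simp: d_def)
      ultimately show ?thesis unfolding comp_apply s 2(1) ck by (simp add: algebra_simps)
    next
      case 3
      have s: "stretch n x = 2 * x - of_int n" using 3 x by (simp add: stretch_def)
      moreover have "interp d (2 * x - of_int n) = c n + 2 ^ k + 2 ^ k * (2 * x - of_int n - of_int (n + 1))"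
        using 3 x ck by (subst interp_on[of "n + 1"]) (auto simp: d_def add.commute[of 1 n])
      ultimately show ?thesis unfolding comp_apply s 3(1) ck by (simp add: algebra_simps)
    next
      case 4
      then have "real_of_int m \<ge> of_int n + 1" by linarith
      then have s: "stretch n x = x + 1" using x by (simp add: stretch_def)
      moreover have "interp d (x + 1) = c m + (c (m + 1) - c m) * (x + 1 - of_int (m + 1))"
        using 4 x by (subst interp_on[of "m + 1"]) (auto simp: d_def add.commute[of 1 m])
      ultimately show ?thesis unfolding comp_apply s by simp
    qed
  qed
  let ?g = "shift i \<circ> stretch 0 ^^ p"
  have g: "?g \<in> T_set" by (intro T_comp funpow_T_set) auto
  obtain h where h: "h \<in> C" "stretch n = h \<circ> stretch 0" using stretch_coset[OF st] by blast
  obtain h' where h': "h' \<in> C" "?g \<circ> h = h' \<circ> ?g" using move_right[OF g h(1)] by blast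
  have "interp c = f \<circ> (?g \<circ> h) \<circ> stretch 0" unfolding split f(2) h(2) by (simp only: comp_assoc)
  also have "\<dots> = (f \<circ> h') \<circ> (shift i \<circ> stretch 0 ^^ Suc p)"
    unfolding h'(2) funpow_Suc_right by (simp only: comp_assoc)
  finally show ?case using comp_in[OF f(1) h'(1)] by blast
qed

end

section \<open>Compactly supported maps lie in such a normal subgroup\<close>

text \<open>
  The homothety by \<open>2 ^ M\<close> on \<open>[-P, P]\<close>, continued by translations.
\<close>

definition dilate :: "int \<Rightarrow> nat \<Rightarrow> real \<Rightarrow> real" where
  "dilate P M x = (if x \<le> - of_int P then x - (2 ^ M - 1) * of_int P
     else if x \<le> of_int P then 2 ^ M * x else x + (2 ^ M - 1) * of_int P)"

lemma dilate_lo: "x \<le> - of_int P \<Longrightarrow> dilate P M x = x - (2 ^ M - 1) * of_int P"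
  and dilate_mid: "- of_int P \<le> x \<Longrightarrow> x \<le> of_int P \<Longrightarrow> dilate P M x = 2 ^ M * x"
  and dilate_hi: "P \<ge> 0 \<Longrightarrow> of_int P \<le> x \<Longrightarrow> dilate P M x = x + (2 ^ M - 1) * of_int P"
  by (auto simp: dilate_def algebra_simps)

lemma dilate_affine:
  assumes "P \<ge> 0" "t \<le> - of_int P \<or> (- of_int P \<le> s \<and> t \<le> of_int P) \<or> of_int P \<le> s"
  shows "affine_on (dilate P M) s t"
proof -
  have d: "(2 ^ M - 1) * real_of_int P \<in> dyadic"
    using dyadic_of_int[of "(2 ^ M - 1) * P"] by simp
  consider "t \<le> - of_int P" | "- of_int P \<le> s \<and> t \<le> of_int P" | "of_int P \<le> s" using assms by blast
  then show ?thesis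
  proof cases
    case 1
    then show ?thesis
      by (intro affine_onI[where k=0 and b="0 - (2 ^ M - 1) * of_int P"] dyadic_diff dyadic_0 d)
        (auto simp: dilate_lo)
  next
    case 2
    then show ?thesis
      by (intro affine_onI[where k="int M" and b="0"] dyadic_0) (auto simp: dilate_mid)
  next
    case 3
    then show ?thesis using assms(1)
      by (intro affine_onI[where k=0 and b="(2 ^ M - 1) * of_int P"] d) (auto simp: dilate_hi)
  qed
qed

lemma dilate_T: assumes "P \<ge> 0" shows "dilate P M \<in> T_set"
proof -
  define c where "c n = dilate P M (of_int n)" for n
  have "nodes (\<lambda>n. dilate P M (real_of_int n))" and "interp (\<lambda>n. dilate P M (real_of_int n)) = dilate P M \<circ> interp of_int"
  proof -
    have n: "nodes of_int"
    proof (rule nodesI)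
      show "\<exists>k. real_of_int (n + 1) = real_of_int n + 2 powi k" for n by (rule exI[of _ 0]) simp
    qed simp
    have a: "affine_on (dilate P M) (of_int n) (of_int (n + 1))" for n
    proof (rule dilate_affine[OF assms])
      consider "n + 1 \<le> - P" | "- P \<le> n \<and> n + 1 \<le> P" | "P \<le> n" by linarith
      then show "of_int (n + 1) \<le> - real_of_int P \<or>
        - real_of_int P \<le> of_int n \<and> real_of_int (n + 1) \<le> of_int P \<or> real_of_int P \<le> of_int n"
        by cases (simp_all flip: of_int_minus)
    qed
    show "nodes (\<lambda>n. dilate P M (real_of_int n))" by (rule interp_comp(2)[OF n a])
    show "interp (\<lambda>n. dilate P M (real_of_int n)) = dilate P M \<circ> interp of_int"
      by (rule interp_comp(1)[OF n a])
  qed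
  moreover have "interp of_int = id" by (rule interp_unique) simp
  ultimately have c: "nodes c" "interp c = dilate P M" by (simp_all add: c_def[abs_def])
  have "interp c \<in> T_set"
  proof (rule interp_T[OF c(1)])
    show "c n = of_int (n + (- (2 ^ M - 1) * P))" if "n \<le> - P" for n
    proof -
      have "real_of_int n \<le> - of_int P" using that by linarith
      then show ?thesis by (simp add: c_def dilate_lo algebra_simps)
    qed
    show "c n = of_int (n + (2 ^ M - 1) * P)" if "n \<ge> P" for n
      using that assms by (simp add: c_def dilate_hi)
  qed
  then show ?thesis by (simp add: c(2))
qed

context normal_T
begin

text \<open>
  Let \<open>f\<close> be supported in \<open>[-P, P]\<close>. Choose nodes \<open>e\<close> so fine that \<open>f\<close> is affine between
  consecutive ones, and dilate by a map \<open>t\<close> that makes all nodes and their images under \<open>f\<close> integers. Then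
  \<open>t \<circ> interp e\<close> and \<open>t \<circ> f \<circ> interp e\<close> are interpolations of integer nodes with the same
  translation numbers, so by \<open>interp_coset\<close> they lie in the same coset. Their quotient is
  \<open>t \<circ> f \<circ> finv t\<close>.
\<close>

theorem T_c_subset:
  assumes comm: "\<And>f g. f \<in> T_c \<Longrightarrow> g \<in> T_c \<Longrightarrow> f \<circ> g \<circ> finv f \<circ> finv g \<in> C"
  shows "T_c \<subseteq> C"
proof
  fix f assume "f \<in> T_c"
  then have fT: "f \<in> T_set" and "trans_ends f 0 0" by (auto simp: T_c_def)
  then obtain N where N: "N \<ge> 0" "\<And>x. x \<le> - N \<Longrightarrow> f x = x" "\<And>x. x \<ge> N \<Longrightarrow> f x = x"
    using trans_endsE[of f 0 0] by auto
  define P where "P = \<lceil>N\<rceil> + 1"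
  have P: "P \<ge> 1" "\<And>x. x \<le> - of_int P \<Longrightarrow> f x = x" "\<And>x. x \<ge> of_int P \<Longrightarrow> f x = x"
  proof -
    have "real_of_int P \<ge> N" unfolding P_def by linarith
    then show "\<And>x. x \<le> - of_int P \<Longrightarrow> f x = x" "\<And>x. x \<ge> of_int P \<Longrightarrow> f x = x"
      using N(2,3) by (meson le_minus_iff order_trans)+
    show "P \<ge> 1" using N(1) unfolding P_def by linarith
  qed
  have "- real_of_int P \<le> of_int P" using P(1) by simp
  then obtain B where B: "finite B" "B \<subseteq> dyadic" "\<And>s t. - of_int P \<le> s \<Longrightarrow> s < t \<Longrightarrow> t \<le> of_int P
      \<Longrightarrow> {s<..<t} \<inter> B = {} \<Longrightarrow> affine_on f s t"
    using PL_germ_breaks[of "- of_int P" "of_int P" f] T_germ[OF fT] by metis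
  obtain m where m: "\<And>b. b \<in> B \<Longrightarrow> 2 ^ m * b \<in> \<int>" using dyadic_common_denominator[OF B(1,2)] by blast
  define Q where "Q = P * 2 ^ m"
  have Q: "Q \<ge> P" "P \<ge> 0" using P(1) by (simp_all add: Q_def mult_le_cancel_left1)
  \<comment> \<open>a mesh of width \<open>1 / 2 ^ m\<close> on \<open>[-P, P]\<close>, which contains all breaks, and of width one outside\<close>
  define e :: "int \<Rightarrow> real" where "e i = (if i < - Q then of_int (i + (Q - P)) else if i \<le> Q then of_int i / 2 ^ m
     else of_int (i - (Q - P)))" for i
  have Qr: "real_of_int Q / 2 ^ m = of_int P" by (simp add: Q_def)
  have e_lo: "e i = of_int (i + (Q - P))" if "i \<le> - Q" for i
    using that Qr Q by (cases "i = - Q") (auto simp: e_def)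
  have e_mid: "e i = of_int i / 2 ^ m" if "- Q \<le> i" "i \<le> Q" for i
    using that by (simp add: e_def)
  have e_hi: "e i = of_int (i - (Q - P))" if "i \<ge> Q" for i
    using that Qr Q by (cases "i = Q") (auto simp: e_def)
  have e_le: "e i \<le> - of_int P" if "i \<le> - Q" for i
    using that by (simp add: e_lo)
  have e_ge: "e i \<ge> of_int P" if "i \<ge> Q" for i
    using that by (simp add: e_hi)
  have e_in: "- of_int P \<le> e i \<and> e i \<le> of_int P" if "- Q \<le> i" "i \<le> Q" for i
  proof -
    have "- real_of_int Q \<le> of_int i" "real_of_int i \<le> of_int Q" using that by linarith+
    then have "- (of_int Q / 2 ^ m) \<le> real_of_int i / 2 ^ m" "real_of_int i / 2 ^ m \<le> of_int Q / 2 ^ m"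
      by (simp_all add: field_simps)
    then show ?thesis using that by (simp add: e_mid Qr)
  qed
  have cases: "i + 1 \<le> - Q \<or> (- Q \<le> i \<and> i + 1 \<le> Q) \<or> Q \<le> i" for i :: int by linarith
  have e: "nodes e"
  proof (rule nodesI)
    fix i :: int
    show "e i \<in> dyadic" using dyadic_of_int dyadicI unfolding e_def by presburger
    from cases[of i] consider "i + 1 \<le> - Q" | "- Q \<le> i \<and> i + 1 \<le> Q" | "Q \<le> i" by blast
    then show "\<exists>k::int. e (i + 1) = e i + 2 powi k"
    proof cases
      case 1 then show ?thesis by (intro exI[of _ 0]) (simp add: e_lo)
    next
      case 2
      have "(2::real) powi (- int m) = 1 / 2 ^ m" by (simp add: power_int_minus divide_inverse)
      then show ?thesis using 2 by (intro exI[of _ "- int m"]) (simp add: e_mid add_divide_distrib)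
    next
      case 3 then show ?thesis by (intro exI[of _ 0]) (simp add: e_hi)
    qed
  qed
  have f_aff: "affine_on f (e i) (e (i + 1))" for i
  proof -
    from cases[of i] consider "i + 1 \<le> - Q" | "- Q \<le> i" "i + 1 \<le> Q" | "Q \<le> i" by blast
    then show ?thesis
    proof cases
      case 1
      then show ?thesis using P(2) e_le[of "i + 1"]
        by (intro affine_onI[where k=0 and b=0]) auto
    next
      case 2
      have "{e i<..<e (i + 1)} \<inter> B = {}"
      proof (rule ccontr)
        assume "\<not> ?thesis"
        then obtain b where b: "b \<in> B" "e i < b" "b < e (i + 1)" by auto
        obtain z where z: "2 ^ m * b = of_int z" using m[OF b(1)] Ints_cases by blast
        have "real_of_int i < 2 ^ m * b" "2 ^ m * b < of_int (i + 1)"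
          using b(2,3) 2 by (simp_all add: e_mid field_simps)
        then show False unfolding z by simp
      qed
      then show ?thesis using 2 e_in[of i] e_in[of "i + 1"] nodes_gt[OF e, of i] by (intro B(3)) auto
    next
      case 3
      then show ?thesis using P(3) e_ge[of i]
        by (intro affine_onI[where k=0 and b=0]) auto
    qed
  qed
  define B' where "B' = e ` {-Q..Q} \<union> f ` e ` {-Q..Q}"
  have ed: "e i \<in> dyadic" for i using e by (simp add: nodes_def)
  then have "finite B'" "B' \<subseteq> dyadic" using PL_germ_dyadic_iff[OF T_germ[OF fT]] by (auto simp: B'_def)
  then obtain M0 where M0: "\<And>b. b \<in> B' \<Longrightarrow> 2 ^ M0 * b \<in> \<int>" using dyadic_common_denominator[of B'] by metis
  \<comment> \<open>the summand \<open>m\<close> makes the dilated mesh at least as wide as the integers, so that the difference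
    \<open>- 2 * i0\<close> of the translation numbers below is a natural number\<close>
  define M where "M = M0 + m"
  have M: "2 ^ M * b \<in> \<int>" if "b \<in> B'" for b
    using Ints_mult[OF _ M0[OF that], of "2 ^ m"] by (simp add: M_def power_add mult_ac)
  define t where "t = dilate P M"
  have t: "t \<in> T_set" unfolding t_def using P(1) by (intro dilate_T) simp
  have f_fix: "f (of_int P) = of_int P" "f (- of_int P) = - of_int P" using P by auto
  have f_le: "f x \<le> of_int P \<longleftrightarrow> x \<le> of_int P" "of_int P \<le> f x \<longleftrightarrow> of_int P \<le> x"
    "f x \<le> - of_int P \<longleftrightarrow> x \<le> - of_int P" "- of_int P \<le> f x \<longleftrightarrow> - of_int P \<le> x" for x
    using T_le_iff[OF fT] f_fix by metis+
  have pos: "e (i + 1) \<le> - of_int P \<or> (- of_int P \<le> e i \<and> e (i + 1) \<le> of_int P) \<or> of_int P \<le> e i" for i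
    using cases[of i] e_le[of "i + 1"] e_in[of i] e_in[of "i + 1"] e_ge[of i] by auto
  have t_aff: "affine_on t (e i) (e (i + 1))" "affine_on t (f (e i)) (f (e (i + 1)))" for i
    unfolding t_def using pos[of i] Q(2) by (auto intro!: dilate_affine simp: f_le)
  define c where "c i = t (e i)" for i
  define d where "d i = t (f (e i))" for i
  have c: "nodes c" "interp c = t \<circ> interp e"
    using interp_comp[OF e t_aff(1)] by (simp_all add: c_def[abs_def])
  have d: "nodes d" "interp d = t \<circ> (f \<circ> interp e)"
    using interp_comp[OF interp_comp(2)[OF e f_aff] t_aff(2)] interp_comp(1)[OF e f_aff]
    by (simp_all add: d_def[abs_def])
  define i0 where "i0 = Q - 2 ^ M * P"
  have i0: "i0 \<le> 0" using P(1) by (simp add: i0_def Q_def M_def power_add mult_ac)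
  have lo: "c i = of_int (i + i0)" "d i = of_int (i + i0)" if "i \<le> - Q" for i
    using that e_le[OF that] P(2)
    by (simp_all add: c_def d_def t_def dilate_lo e_lo i0_def algebra_simps)
  have hi: "c i = of_int (i - i0)" "d i = of_int (i - i0)" if "i \<ge> Q" for i
    using that e_ge[OF that] P(3) Q
    by (simp_all add: c_def d_def t_def dilate_hi e_hi i0_def algebra_simps)
  have mid: "c i \<in> \<int>" "d i \<in> \<int>" if "- Q \<le> i" "i \<le> Q" for i
  proof -
    have "e i \<in> B'" "f (e i) \<in> B'" using that by (auto simp: B'_def)
    then show "c i \<in> \<int>" "d i \<in> \<int>"
      using M e_in[OF that] by (simp_all add: c_def d_def t_def dilate_mid f_le)
  qed
  have int: "c i \<in> \<int>" "d i \<in> \<int>" for i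
    using lo[of i] hi[of i] mid[of i] by (metis Ints_of_int linear)+
  have p: "i + i0 + int (nat (- 2 * i0)) = i - i0" for i using i0 by simp
  have st: "stretch n \<circ> finv (stretch (n + 1)) \<in> C" for n
    using stretch_Suc_in[OF comm, of "n - 1"] by (simp add: algebra_simps)
  let ?g = "shift i0 \<circ> stretch 0 ^^ nat (- 2 * i0)"
  obtain u where u: "u \<in> C" "interp c = u \<circ> ?g"
    using interp_coset[where c=c and N=Q and i=i0 and p="nat (- 2 * i0)", OF st c(1) int(1) lo(1)] hi(1)
    unfolding p by blast
  obtain v where v: "v \<in> C" "interp d = v \<circ> ?g"
    using interp_coset[where c=d and N=Q and i=i0 and p="nat (- 2 * i0)", OF st d(1) int(2) lo(2)] hi(2)
    unfolding p by blast
  have uv: "u \<in> T_set" "v \<in> T_set" using u v inT by blast+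
  have g: "?g \<in> T_set" by (intro T_comp funpow_T_set) auto
  have "t \<circ> f \<circ> finv t = v \<circ> finv u"
  proof
    fix y
    obtain x where "y = (u \<circ> ?g) x" using T_surj[OF T_comp[OF uv(1) g]] by blast
    then have y: "y = u (?g x)" "y = t (interp e x)" using c(2) u(2) by (auto simp: fun_eq_iff)
    have "(t \<circ> f \<circ> finv t) y = interp d x" unfolding d(2) y(2) using t by simp
    also have "\<dots> = (v \<circ> finv u) y" unfolding v(2) y(1) using uv by simp
    finally show "(t \<circ> f \<circ> finv t) y = (v \<circ> finv u) y" .
  qed
  then have "t \<circ> f \<circ> finv t \<in> C" using comp_in[OF v(1) inv_in[OF u(1)]] by simp
  then have "finv t \<circ> (t \<circ> f \<circ> finv t) \<circ> finv (finv t) \<in> C" by (rule conj_in) (simp add: t T_inv)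
  moreover have "finv t \<circ> (t \<circ> f \<circ> finv t) \<circ> finv (finv t) = f"
    using t by (simp add: fun_eq_iff inv_inv_eq T_bij)
  ultimately show "f \<in> C" by simp
qed

end

lemma shift_funpow: "(shift i ^^ n) x = x + of_int (i * int n)"
  by (induct n) (simp_all add: shift_def algebra_simps)

text \<open>
  The hypothesis on powers is the trace left by finite index. It puts long translations into the
  normal core \<open>C\<close> of \<open>H\<close>. For compactly supported \<open>f\<close> and \<open>g\<close> and such a translation \<open>c\<close>, the product
  \<open>h = f c f\<inverse> c\<inverse>\<close> lies in \<open>C\<close> and is \<open>f\<close> times a map whose support misses that of \<open>g\<close>; so the commutator of
  \<open>h\<close> and \<open>g\<close> is that of \<open>f\<close> and \<open>g\<close>.
\<close>

theorem T_c_subset_of_powers: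
  assumes H: "subgroup H T" and "k > 0"
    and pow: "\<And>f g. f \<in> T_set \<Longrightarrow> g \<in> T_set \<Longrightarrow> g \<circ> f ^^ k \<circ> finv g \<in> H"
  shows "T_c \<subseteq> H"
proof -
  note HD = subgroup_T_D[OF H]
  define C where "C = {f \<in> T_set. \<forall>g\<in>T_set. g \<circ> f \<circ> finv g \<in> H}"
  interpret normal_T C
  proof
    show "C \<subseteq> T_set" by (auto simp: C_def)
    show "id \<in> C" using HD(2) by (auto simp: C_def T_comp_inv)
    show "f1 \<circ> f2 \<in> C" if "f1 \<in> C" "f2 \<in> C" for f1 f2
    proof -
      have "g \<circ> (f1 \<circ> f2) \<circ> finv g = (g \<circ> f1 \<circ> finv g) \<circ> (g \<circ> f2 \<circ> finv g)" if "g \<in> T_set" for g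
        using that by (simp add: fun_eq_iff)
      then show ?thesis using that HD(3) by (auto simp: C_def)
    qed
    show "finv f \<in> C" if "f \<in> C" for f
    proof -
      have "g \<circ> finv f \<circ> finv g = finv (g \<circ> f \<circ> finv g)" if "g \<in> T_set" for g
        using that \<open>f \<in> C\<close> by (simp add: C_def inv_comp_T T_comp T_inv inv_inv_eq T_bij comp_assoc)
      then show ?thesis using that HD(4) by (auto simp: C_def)
    qed
    show "u \<circ> f \<circ> finv u \<in> C" if "f \<in> C" "u \<in> T_set" for f u
    proof -
      have "g \<circ> (u \<circ> f \<circ> finv u) \<circ> finv g = (g \<circ> u) \<circ> f \<circ> finv (g \<circ> u)" if "g \<in> T_set" for g
        using that \<open>u \<in> T_set\<close> by (simp add: inv_comp_T comp_assoc)
      then show ?thesis using that by (auto simp: C_def)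
    qed
  qed
  have "f \<circ> g \<circ> finv f \<circ> finv g \<in> C" if f: "f \<in> T_c" and g: "g \<in> T_c" for f g
  proof -
    have fT: "f \<in> T_set" and gT: "g \<in> T_set" using f g by (auto simp: T_c_def)
    obtain N where N: "N \<ge> 0" "\<And>x. x \<le> - N \<Longrightarrow> f x = x" "\<And>x. x \<ge> N \<Longrightarrow> f x = x"
      using f by (rule T_c_bound) blast
    obtain N' where N': "N' \<ge> 0" "\<And>x. x \<le> - N' \<Longrightarrow> g x = x" "\<And>x. x \<ge> N' \<Longrightarrow> g x = x"
      using g by (rule T_c_bound) blast
    define c where "c = shift \<lceil>N + N'\<rceil> ^^ k"
    have "c \<in> C" unfolding C_def c_def using pow funpow_T_set by auto
    have cT: "c \<in> T_set" using \<open>c \<in> C\<close> inT by blast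
    have c: "c x \<ge> x + N + N'" for x
    proof -
      have "\<lceil>N + N'\<rceil> * 1 \<le> \<lceil>N + N'\<rceil> * int k" using N(1) N'(1) \<open>k > 0\<close> by (intro mult_left_mono) auto
      then have "real_of_int \<lceil>N + N'\<rceil> \<le> of_int (\<lceil>N + N'\<rceil> * int k)" by linarith
      then show ?thesis unfolding c_def shift_funpow by linarith
    qed
    \<comment> \<open>the translate of \<open>f\<inverse>\<close>, supported to the right of the support of \<open>g\<close>\<close>
    define f' where "f' = c \<circ> finv f \<circ> finv c"
    have f'T: "f' \<in> T_set" unfolding f'_def using cT fT by (simp add: T_comp T_inv)
    have f'id: "f' x = x" if "x \<le> N'" for x
    proof -
      have "finv c x \<le> - N" using c[of "finv c x"] that cT by simp
      then have "f (finv c x) = finv c x" by (rule N)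
      then have "finv f (finv c x) = finv c x" using T_inv_f[OF fT, of "finv c x"] by simp
      then show ?thesis by (simp add: f'_def cT)
    qed
    have com: "f' (g x) = g (f' x)" for x
      using commute_disjoint[OF f'T gT, of N'] N' f'id by blast
    define h where "h = f \<circ> c \<circ> finv f \<circ> finv c"
    have hC: "h \<in> C" unfolding h_def using comp_in[OF conj_in[OF \<open>c \<in> C\<close> fT] inv_in[OF \<open>c \<in> C\<close>]] .
    have h: "h = f \<circ> f'" by (simp add: h_def f'_def comp_assoc)
    have "h \<circ> (g \<circ> finv h \<circ> finv g) \<in> C" by (rule comp_in[OF hC conj_in[OF inv_in[OF hC] gT]])
    moreover have "h \<circ> (g \<circ> finv h \<circ> finv g) = f \<circ> g \<circ> finv f \<circ> finv g"
      unfolding h by (simp add: inv_comp_T fT f'T gT fun_eq_iff com)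
    ultimately show ?thesis by simp
  qed
  then have "T_c \<subseteq> C" by (rule T_c_subset)
  moreover have "f \<in> H" if "f \<in> C" for f
    using that by (force simp: C_def dest: bspec[where x=id])
  ultimately show ?thesis by blast
qed

section \<open>Maps that are translations at only one end\<close>

text \<open>
  In terms of the group alone, this property singles out the maps that are trivial
  near one of the two ends.
\<close>

definition conj_centralized :: "('a, 'b) monoid_scheme \<Rightarrow> 'a \<Rightarrow> bool" where
  "conj_centralized G f \<longleftrightarrow> (\<forall>g\<in>carrier G. \<exists>h\<in>carrier G. h \<noteq> \<one>\<^bsub>G\<^esub> \<and>
     h \<otimes>\<^bsub>G\<^esub> f = f \<otimes>\<^bsub>G\<^esub> h \<and>
     h \<otimes>\<^bsub>G\<^esub> (g \<otimes>\<^bsub>G\<^esub> f \<otimes>\<^bsub>G\<^esub> inv\<^bsub>G\<^esub> g) = (g \<otimes>\<^bsub>G\<^esub> f \<otimes>\<^bsub>G\<^esub> inv\<^bsub>G\<^esub> g) \<otimes>\<^bsub>G\<^esub> h)"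

lemma conj_centralized_iso:
  assumes "group G" "group G'" "\<phi> \<in> iso G G'" "f \<in> carrier G" "conj_centralized G f"
  shows "conj_centralized G' (\<phi> f)"
  unfolding conj_centralized_def
proof
  interpret G: group G by fact
  interpret G': group G' by fact
  interpret group_hom G G' \<phi>
    using assms(3) by unfold_locales (simp add: iso_def)
  have bij: "bij_betw \<phi> (carrier G) (carrier G')" using assms(3) by (simp add: iso_def)
  fix g' assume "g' \<in> carrier G'"
  then obtain g where g: "g \<in> carrier G" "g' = \<phi> g" using bij by (auto simp: bij_betw_def)
  obtain h where h: "h \<in> carrier G" "h \<noteq> \<one>\<^bsub>G\<^esub>" "h \<otimes>\<^bsub>G\<^esub> f = f \<otimes>\<^bsub>G\<^esub> h"
     "h \<otimes>\<^bsub>G\<^esub> (g \<otimes>\<^bsub>G\<^esub> f \<otimes>\<^bsub>G\<^esub> inv\<^bsub>G\<^esub> g) = (g \<otimes>\<^bsub>G\<^esub> f \<otimes>\<^bsub>G\<^esub> inv\<^bsub>G\<^esub> g) \<otimes>\<^bsub>G\<^esub> h"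
    using assms(5) g(1) unfolding conj_centralized_def by blast
  have k: "\<phi> (g \<otimes>\<^bsub>G\<^esub> f \<otimes>\<^bsub>G\<^esub> inv\<^bsub>G\<^esub> g) = \<phi> g \<otimes>\<^bsub>G'\<^esub> \<phi> f \<otimes>\<^bsub>G'\<^esub> inv\<^bsub>G'\<^esub> \<phi> g"
    using g assms(4) by simp
  show "\<exists>h'\<in>carrier G'. h' \<noteq> \<one>\<^bsub>G'\<^esub> \<and> h' \<otimes>\<^bsub>G'\<^esub> \<phi> f = \<phi> f \<otimes>\<^bsub>G'\<^esub> h' \<and>
     h' \<otimes>\<^bsub>G'\<^esub> (g' \<otimes>\<^bsub>G'\<^esub> \<phi> f \<otimes>\<^bsub>G'\<^esub> inv\<^bsub>G'\<^esub> g') = (g' \<otimes>\<^bsub>G'\<^esub> \<phi> f \<otimes>\<^bsub>G'\<^esub> inv\<^bsub>G'\<^esub> g') \<otimes>\<^bsub>G'\<^esub> h'"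
  proof (intro bexI[of _ "\<phi> h"] conjI)
    show "\<phi> h \<noteq> \<one>\<^bsub>G'\<^esub>"
      using h(1,2) bij G.one_closed hom_one unfolding bij_betw_def inj_on_def by metis
    show "\<phi> h \<otimes>\<^bsub>G'\<^esub> \<phi> f = \<phi> f \<otimes>\<^bsub>G'\<^esub> \<phi> h"
      using h(1,3) assms(4) by (metis hom_mult)
    show "\<phi> h \<otimes>\<^bsub>G'\<^esub> (g' \<otimes>\<^bsub>G'\<^esub> \<phi> f \<otimes>\<^bsub>G'\<^esub> inv\<^bsub>G'\<^esub> g') =
        (g' \<otimes>\<^bsub>G'\<^esub> \<phi> f \<otimes>\<^bsub>G'\<^esub> inv\<^bsub>G'\<^esub> g') \<otimes>\<^bsub>G'\<^esub> \<phi> h"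
      unfolding g(2) k[symmetric] using h(1,4) g(1) assms(4)
      by (metis G.m_closed G.inv_closed hom_mult)
  qed (use h(1) in simp)
qed

lemma conj_centralized_T_iff:
  assumes "subgroup H T"
  shows "conj_centralized (T\<lparr>carrier := H\<rparr>) f \<longleftrightarrow> (\<forall>g\<in>H. \<exists>h\<in>H. h \<noteq> id \<and>
     h \<circ> f = f \<circ> h \<and> h \<circ> (g \<circ> f \<circ> finv g) = (g \<circ> f \<circ> finv g) \<circ> h)"
proof -
  have "inv\<^bsub>T\<lparr>carrier := H\<rparr>\<^esub> g = finv g" if "g \<in> H" for g
    using T.m_inv_consistent[OF assms that] subgroup_T_D(1)[OF assms] that by auto
  then show ?thesis unfolding conj_centralized_def by simp
qed

text \<open>
  A nontrivial map supported in the interval from \<open>n\<close> to \<open>n + 3\<close>.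
\<close>

definition bump :: "int \<Rightarrow> real \<Rightarrow> real" where
  "bump n = stretch n \<circ> finv (stretch (n + 1))"

lemma bump_T_c: "bump n \<in> T_c" unfolding bump_def by (rule T_c_stretch)

lemma stretch_lo: "x \<le> of_int n \<Longrightarrow> stretch n x = x"
  and stretch_hi: "x \<ge> of_int n + 1 \<Longrightarrow> stretch n x = x + 1"
  by (auto simp: stretch_def)

lemma finv_eqI: "f \<in> T_set \<Longrightarrow> f x = y \<Longrightarrow> finv f y = x"
  using T_inv_f by blast

lemma bump_lo: assumes "x \<le> of_int n" shows "bump n x = x"
proof -
  have "finv (stretch (n + 1)) x = x" by (rule finv_eqI) (use assms in \<open>auto simp: stretch_lo\<close>)
  then show ?thesis using assms by (simp add: bump_def stretch_lo)
qed

lemma bump_hi: assumes "x \<ge> of_int n + 3" shows "bump n x = x"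
proof -
  have "finv (stretch (n + 1)) x = x - 1" by (rule finv_eqI) (use assms in \<open>auto simp: stretch_hi\<close>)
  then show ?thesis using assms by (simp add: bump_def stretch_hi)
qed

lemma bump_neq_id: "bump n \<noteq> id"
proof -
  have "finv (stretch (n + 1)) (of_int n + 1) = of_int n + 1"
    by (rule finv_eqI) (auto simp: stretch_lo)
  then have "bump n (of_int n + 1) = of_int n + 2" by (simp add: bump_def stretch_hi)
  then show ?thesis by (metis add_left_cancel id_apply one_eq_numeral_iff semiring_norm(85))
qed

lemma trans_ends_conj:
  assumes "g \<in> T_set" "trans_ends f i j" shows "trans_ends (g \<circ> f \<circ> finv g) i j"
proof -
  obtain p q where pq: "trans_ends g p q" using assms(1) by (rule T_trans_ends)
  have "trans_ends (g \<circ> f \<circ> finv g) (p + i + - p) (q + j + - q)"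
    by (intro trans_ends_comp trans_ends_inv pq assms)
  then show ?thesis by simp
qed

text \<open>
  All conjugates of \<open>f\<close> are trivial near the same end as \<open>f\<close>, and a map with its support far
  out commutes with any two of them.
\<close>

lemma one_sided_conj_centralized:
  assumes H: "subgroup H T" "T_c \<subseteq> H" and f: "f \<in> H" "trans_ends f i j" and "i = 0 \<or> j = 0"
  shows "conj_centralized (T\<lparr>carrier := H\<rparr>) f"
  unfolding conj_centralized_T_iff[OF H(1)]
proof
  fix g assume "g \<in> H"
  then have T: "g \<in> T_set" "f \<in> T_set" using f subgroup_T_D(1)[OF H(1)] by auto
  define k where "k = g \<circ> f \<circ> finv g"
  have kT: "k \<in> T_set" unfolding k_def using T by (simp add: T_comp T_inv)
  have k: "trans_ends k i j" unfolding k_def using trans_ends_conj[OF T(1) f(2)] .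
  obtain N where N: "\<And>x. x \<le> - N \<Longrightarrow> f x = x + of_int i" "\<And>x. x \<ge> N \<Longrightarrow> f x = x + of_int j"
    using f(2) by (rule trans_endsE) blast
  obtain M where M: "\<And>x. x \<le> - M \<Longrightarrow> k x = x + of_int i" "\<And>x. x \<ge> M \<Longrightarrow> k x = x + of_int j"
    using k by (rule trans_endsE) blast
  define m where "m = \<lceil>max N M\<rceil>"
  have m: "N \<le> of_int m" "M \<le> of_int m" unfolding m_def by linarith+
  have "\<exists>n. bump n \<circ> f = f \<circ> bump n \<and> bump n \<circ> k = k \<circ> bump n"
  proof (cases "j = 0")
    case True
    have "bump m (f x) = f (bump m x)" for x
      by (rule commute_disjoint[of _ _ "of_int m"])
        (use True m N(2) T in \<open>auto simp: bump_lo T_c_T[OF bump_T_c]\<close>)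
    moreover have "bump m (k x) = k (bump m x)" for x
      by (rule commute_disjoint[of _ _ "of_int m"])
        (use True m M(2) kT in \<open>auto simp: bump_lo T_c_T[OF bump_T_c]\<close>)
    ultimately show ?thesis by (auto simp: fun_eq_iff)
  next
    case False
    then have i: "i = 0" using assms by simp
    have "f (bump (- m - 3) x) = bump (- m - 3) (f x)" for x
      by (rule commute_disjoint[of _ _ "- of_int m"])
        (use i m N(1) T in \<open>auto simp: bump_hi T_c_T[OF bump_T_c]\<close>)
    moreover have "k (bump (- m - 3) x) = bump (- m - 3) (k x)" for x
      by (rule commute_disjoint[of _ _ "- of_int m"])
        (use i m M(1) kT in \<open>auto simp: bump_hi T_c_T[OF bump_T_c]\<close>)
    ultimately show ?thesis by (intro exI[of _ "- m - 3"]) (simp add: fun_eq_iff)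
  qed
  then show "\<exists>h\<in>H. h \<noteq> id \<and> h \<circ> f = f \<circ> h \<and> h \<circ> (g \<circ> f \<circ> finv g) = g \<circ> f \<circ> finv g \<circ> h"
    unfolding k_def[symmetric] using bump_T_c bump_neq_id H(2) by blast
qed

lemma invariant_Inf:
  assumes "u \<in> T_set" "A \<noteq> {}" "bdd_below A" "\<And>x. u x \<in> A \<longleftrightarrow> x \<in> A"
  shows "u (Inf A) = Inf A"
proof (rule antisym)
  have "finv u (Inf A) \<le> x" if "x \<in> A" for x
  proof -
    have "Inf A \<le> u x" using that assms by (intro cInf_lower) auto
    then show ?thesis using T_le_iff[OF assms(1), of "finv u (Inf A)" x] assms(1) by simp
  qed
  then have "finv u (Inf A) \<le> Inf A" using assms(2) by (intro cInf_greatest)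
  then show "Inf A \<le> u (Inf A)" using T_le_iff[OF assms(1), of "finv u (Inf A)" "Inf A"] assms(1) by simp
  have "u (Inf A) \<le> x" if "x \<in> A" for x
  proof -
    have "finv u x \<in> A" using assms(4)[of "finv u x"] that assms(1) by simp
    then have "Inf A \<le> finv u x" using assms by (intro cInf_lower) auto
    then show ?thesis using T_le_iff[OF assms(1), of "Inf A" "finv u x"] assms(1) by simp
  qed
  then show "u (Inf A) \<le> Inf A" using assms(2) by (intro cInf_greatest)
qed

lemma funpow_stretch_hi: "x \<ge> of_int n + 1 \<Longrightarrow> (stretch n ^^ k) x = x + real k"
  and funpow_stretch_lo: "x \<le> of_int n \<Longrightarrow> (stretch n ^^ k) x = x"
  by (induct k) (auto simp: stretch_hi stretch_lo)

lemma trans_ends_funpow: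
  assumes "trans_ends f i j" shows "trans_ends (f ^^ k) (int k * i) (int k * j)"
proof (induct k)
  case 0 show ?case using trans_ends_id by (simp add: id_def)
next
  case (Suc k)
  have "int (Suc k) * n = n + int k * n" for n by (simp add: algebra_simps)
  then show ?case unfolding funpow.simps(2) using trans_ends_comp[OF assms Suc] by (simp only:)
qed

lemma exists_pusher:
  fixes P :: int assumes "P \<ge> 0"
  shows "\<exists>g\<in>T_c. \<forall>x. - of_int P \<le> x \<longrightarrow> of_int P \<le> g x"
proof
  define k where "k = nat (2 * P)"
  define g where "g = stretch (- P - 1) ^^ k \<circ> finv (stretch P ^^ k)"
  have "trans_ends g (int k * 0 + - (int k * 0)) (int k * 1 + - (int k * 1))"
    unfolding g_def by (intro trans_ends_comp trans_ends_inv trans_ends_funpow stretch_ends funpow_T_set) auto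
  moreover have gT: "g \<in> T_set" unfolding g_def by (intro T_comp T_inv funpow_T_set) auto
  ultimately show "g \<in> T_c" by (simp add: T_c_def)
  have "finv (stretch P ^^ k) (- of_int P) = - of_int P"
    by (rule finv_eqI) (use assms in \<open>auto intro!: funpow_T_set funpow_stretch_lo\<close>)
  then have "g (- of_int P) = of_int P"
    using assms by (simp add: g_def funpow_stretch_hi k_def)
  then show "\<forall>x. - of_int P \<le> x \<longrightarrow> of_int P \<le> g x" using T_le_iff[OF gT] by metis
qed

text \<open>
  All fixed points of \<open>f\<close> lie in a compact interval. Conjugating by a compactly supported \<open>g\<close> that pushes
  this interval off itself yields \<open>k\<close> without fixed points in common with \<open>f\<close>. By \<open>invariant_Inf\<close> no
  nonempty set invariant under both is bounded below. If \<open>h\<close> commutes with both, then the sets of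
  fixed and of moved points of \<open>h\<close> are invariant, so each is empty or unbounded below. But \<open>h\<close> is a
  translation on the far left, so only one of them can be unbounded below. A fixed point
  of \<open>h\<close> exists, namely the infimum of the support of \<open>k \<circ> finv f\<close>; hence no point is moved.
\<close>

lemma two_sided_not_conj_centralized:
  assumes H: "subgroup H T" "T_c \<subseteq> H" and f: "f \<in> H" "trans_ends f i j" and ij: "i \<noteq> 0" "j \<noteq> 0"
  shows "\<not> conj_centralized (T\<lparr>carrier := H\<rparr>) f"
proof
  assume cc: "conj_centralized (T\<lparr>carrier := H\<rparr>) f"
  have fT: "f \<in> T_set" using f subgroup_T_D(1)[OF H(1)] by auto
  obtain N where N: "N \<ge> 0" "\<And>x. x \<le> - N \<Longrightarrow> f x = x + of_int i" "\<And>x. x \<ge> N \<Longrightarrow> f x = x + of_int j"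
    using f(2) by (rule trans_endsE) blast
  define P where "P = \<lceil>N\<rceil> + 1"
  have P: "N \<le> of_int P" "P \<ge> 1" using N(1) unfolding P_def by linarith+
  have fixf: "- of_int P < x \<and> x < of_int P" if "f x = x" for x
    using N(2)[of x] N(3)[of x] that P ij by (cases "x \<le> - N"; cases "x \<ge> N") auto
  obtain g where g: "g \<in> T_c" "\<And>x. - of_int P \<le> x \<Longrightarrow> of_int P \<le> g x"
    using exists_pusher[of P] P(2) by auto
  have gT: "g \<in> T_set" using g(1) by (rule T_c_T)
  define k where "k = g \<circ> f \<circ> finv g"
  have kT: "k \<in> T_set" unfolding k_def using fT gT by (simp add: T_comp T_inv)
  have nofix: False if "f x = x" "k x = x" for x
  proof -
    have "f (finv g x) = finv g x" using that(2) gT unfolding k_def comp_apply by (metis T_inv_f)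
    then have "of_int P \<le> g (finv g x)" using fixf g(2) by (meson less_imp_le)
    then show False using fixf[OF that(1)] gT by simp
  qed
  have unbounded: "\<not> bdd_below A"
    if "A \<noteq> {}" "\<And>x. f x \<in> A \<longleftrightarrow> x \<in> A" "\<And>x. k x \<in> A \<longleftrightarrow> x \<in> A" for A
    using invariant_Inf[OF fT that(1) _ that(2)] invariant_Inf[OF kT that(1) _ that(3)] nofix by blast
  obtain h where h: "h \<in> H" "h \<noteq> id" "h \<circ> f = f \<circ> h" "h \<circ> k = k \<circ> h"
    using cc g(1) H(2) unfolding conj_centralized_T_iff[OF H(1)] k_def by blast
  have hT: "h \<in> T_set" using h(1) subgroup_T_D(1)[OF H(1)] by auto
  have hf: "h (f x) = f (h x)" and hk: "h (k x) = k (h x)" for x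
    using h(3,4) by (metis comp_apply)+
  define w where "w = k \<circ> finv f"
  have wT: "w \<in> T_set" unfolding w_def using fT kT by (simp add: T_comp T_inv)
  have "trans_ends k i j" unfolding k_def using trans_ends_conj[OF gT f(2)] .
  then have "trans_ends w (i + - i) (j + - j)"
    unfolding w_def by (intro trans_ends_comp trans_ends_inv fT f(2))
  then have wc: "w \<in> T_c" using wT by (simp add: T_c_def)
  have bdd: "bdd_below {x. u x \<noteq> x}" if "u \<in> T_c" for u
  proof -
    obtain M where M: "\<And>x. x \<le> - M \<Longrightarrow> u x = x" using \<open>u \<in> T_c\<close> by (rule T_c_bound) blast
    show ?thesis
    proof (rule bdd_belowI[of _ "- M"])
      show "- M \<le> x" if "x \<in> {x. u x \<noteq> x}" for x using that M[of x] by fastforce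
    qed
  qed
  \<comment> \<open>otherwise \<open>f\<close> and \<open>g\<close> commute, and the support of \<open>g\<close> is a bounded invariant set\<close>
  have "\<exists>x. w x \<noteq> x"
  proof (rule ccontr)
    assume "\<not> ?thesis"
    then have "k (finv f x) = x" for x by (simp add: w_def)
    then have kf: "k x = f x" for x using fT by (metis T_inv_f)
    then have gf: "g (f x) = f (g x)" for x using gT unfolding k_def comp_apply by (metis T_inv_f)
    have "of_int P \<le> g (- of_int P)" using g(2) by simp
    then have "{x. g x \<noteq> x} \<noteq> {}" using P(2) by (auto intro!: exI[of _ "- of_int P"])
    then have "\<not> bdd_below {x. g x \<noteq> x}"
    proof (rule unbounded)
      show "f x \<in> {x. g x \<noteq> x} \<longleftrightarrow> x \<in> {x. g x \<noteq> x}" for x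
        using gf T_eq_iff[OF fT] by simp
      then show "k x \<in> {x. g x \<noteq> x} \<longleftrightarrow> x \<in> {x. g x \<noteq> x}" for x using kf by simp
    qed
    then show False using bdd[OF g(1)] by blast
  qed
  then have ne: "{x. w x \<noteq> x} \<noteq> {}" by blast
  define s where "s = Inf {x. w x \<noteq> x}"
  have hw: "h (w x) = w (h x)" for x
  proof -
    have "h (finv f x) = finv f (h x)" using hf[of "finv f x"] fT by simp
    then show ?thesis by (simp add: w_def hk)
  qed
  have "h s = s" unfolding s_def
    by (rule invariant_Inf[OF hT ne bdd[OF wc]]) (simp add: hw[symmetric] T_eq_iff[OF hT])
  then have "{x. h x = x} \<noteq> {}" by blast
  then have "\<not> bdd_below {x. h x = x}"
    by (rule unbounded) (simp_all add: hf hk T_eq_iff[OF fT] T_eq_iff[OF kT])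
  then have unb: "\<not> bdd_below {x. h x = x}" .
  obtain p q where "trans_ends h p q" using hT by (rule T_trans_ends)
  then obtain M where M: "\<And>x. x \<le> - M \<Longrightarrow> h x = x + of_int p" by (rule trans_endsE) blast
  have "\<exists>x0\<le>- M. h x0 = x0"
  proof (rule ccontr)
    assume "\<not> ?thesis"
    then have "- M \<le> x" if "x \<in> {x. h x = x}" for x using that linear[of "- M" x] by blast
    then have "bdd_below {x. h x = x}" by (rule bdd_belowI)
    then show False using unb by blast
  qed
  then obtain x0 where x0: "x0 \<le> - M" "h x0 = x0" by blast
  then have "p = 0" using M[of x0] by simp
  have "bdd_below {x. h x \<noteq> x}"
  proof (rule bdd_belowI[of _ "- M"])
    show "- M \<le> x" if "x \<in> {x. h x \<noteq> x}" for x using that M[of x] \<open>p = 0\<close> by fastforce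
  qed
  moreover have "{x. h x \<noteq> x} \<noteq> {}" using h(2) by (auto simp: fun_eq_iff)
  then have "\<not> bdd_below {x. h x \<noteq> x}"
    by (rule unbounded) (simp_all add: hf hk T_eq_iff[OF fT] T_eq_iff[OF kT])
  ultimately show False by blast
qed

section \<open>Translation numbers of subgroups isomorphic to the whole group\<close>

text \<open>
  The counterpart of \<open>K a b\<close> on the line.
\<close>

definition K_T :: "int \<Rightarrow> int \<Rightarrow> (real \<Rightarrow> real) set" where
  "K_T a b = {f \<in> T_set. \<exists>i j. trans_ends f (a * i) (b * j)}"

lemma int_subgroup:
  fixes A :: "int set"
  assumes "\<And>x y. x \<in> A \<Longrightarrow> y \<in> A \<Longrightarrow> x - y \<in> A" "k \<in> A" "k > 0"
  shows "\<exists>a>0. A = range ((*) a)"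
proof -
  have 0: "0 \<in> A" using assms(1)[OF assms(2,2)] by simp
  have neg: "- x \<in> A" if "x \<in> A" for x using assms(1)[OF 0 that] by simp
  have add: "x + y \<in> A" if "x \<in> A" "y \<in> A" for x y using assms(1)[OF that(1) neg[OF that(2)]] by simp
  define n where "n = (LEAST n. n > 0 \<and> int n \<in> A)"
  have "nat k > 0 \<and> int (nat k) \<in> A" using assms by simp
  then have n: "n > 0" "int n \<in> A" unfolding n_def by (metis (mono_tags, lifting) LeastI)+
  have least: "n \<le> m" if "m > 0" "int m \<in> A" for m
    unfolding n_def using that by (simp add: Least_le)
  have nat_mult: "int m * int n \<in> A" for m
    by (induct m) (auto simp: 0 algebra_simps intro: add n)
  have mult: "int n * z \<in> A" for z
  proof (cases "z \<ge> 0")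
    case True then show ?thesis using nat_mult[of "nat z"] by (simp add: mult.commute)
  next
    case False then show ?thesis using neg[OF nat_mult[of "nat (- z)"]] by (simp add: mult.commute)
  qed
  have "x \<in> range ((*) (int n))" if "x \<in> A" for x
  proof -
    have "x mod int n \<in> A" using assms(1)[OF that mult[of "x div int n"]] by (simp add: minus_mult_div_eq_mod)
    moreover have "0 \<le> x mod int n" "x mod int n < int n" using n(1) by simp_all
    ultimately have "x mod int n = 0" using least[of "nat (x mod int n)"] by fastforce
    then show ?thesis by (metis mult_div_mod_eq add.right_neutral rangeI)
  qed
  then have "A = range ((*) (int n))" using mult by auto
  then show ?thesis using n(1) by (intro exI[of _ "int n"]) simp
qed

lemma exists_left_translation: "\<exists>f\<in>T_set. trans_ends f i 0"
proof -
  define u where "u = shift 1 \<circ> finv (stretch 0)"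
  have uT: "u \<in> T_set" unfolding u_def by (intro T_comp T_inv) auto
  have "trans_ends u (1 + - 0) (1 + - 1)"
    unfolding u_def by (intro trans_ends_comp trans_ends_inv shift_ends stretch_ends) auto
  then have u: "trans_ends (u ^^ n) (int n) 0" for n
    using trans_ends_funpow[of u 1 0 n] by simp
  show ?thesis
  proof (cases "i \<ge> 0")
    case True
    then show ?thesis using u[of "nat i"] funpow_T_set[OF uT] by auto
  next
    case False
    then have "trans_ends (finv (u ^^ nat (- i))) i 0"
      using trans_ends_inv[OF funpow_T_set[OF uT] u[of "nat (- i)"]] by simp
    then show ?thesis using funpow_T_set[OF uT] by auto
  qed
qed

text \<open>
  The axes of the pairs of translation numbers of \<open>H\<close> are cyclic groups, generated by some \<open>a\<close>
  and \<open>b\<close>, which are positive because \<open>H\<close> contains a power of every element. An element of \<open>T\<close> is a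
  product \<open>f1 \<circ> f2\<close> of maps each of which is trivial near one end. An isomorphism onto \<open>H\<close> sends these to
  elements of \<open>H\<close> with pairs on the axes, since \<open>conj_centralized\<close> characterises such elements
  in both groups. So the pair of every element of \<open>H\<close> is a sum of pairs on the axes. The
  converse inclusion holds because \<open>H\<close> contains all compactly supported maps.
\<close>

theorem iso_T_imp_K_T:
  assumes H: "subgroup H T" and k: "k > 0"
    and pow: "\<And>f g. f \<in> T_set \<Longrightarrow> g \<in> T_set \<Longrightarrow> g \<circ> f ^^ k \<circ> finv g \<in> H"
    and iso: "T \<cong> T\<lparr>carrier := H\<rparr>"
  shows "\<exists>a b. a > 0 \<and> b > 0 \<and> H = K_T a b"
proof -
  note HD = subgroup_T_D[OF H]
  have TcH: "T_c \<subseteq> H" by (rule T_c_subset_of_powers[OF H k pow])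
  have powH: "f ^^ k \<in> H" if "f \<in> T_set" for f
    using pow[OF that T_id] by (simp add: comp_def id_def)
  define A where "A = {i. \<exists>f\<in>H. trans_ends f i 0}"
  define B where "B = {j. \<exists>f\<in>H. trans_ends f 0 j}"
  have "\<exists>a>0. A = range ((*) a)"
  proof (rule int_subgroup)
    obtain f where f: "f \<in> T_set" "trans_ends f 1 0" using exists_left_translation by blast
    show "int k \<in> A" using powH[OF f(1)] trans_ends_funpow[OF f(2), of k] by (auto simp: A_def)
    show "x - y \<in> A" if xy: "x \<in> A" "y \<in> A" for x y
    proof -
      obtain f g where fg: "f \<in> H" "trans_ends f x 0" "g \<in> H" "trans_ends g y 0"
        using xy by (auto simp: A_def)
      have "trans_ends (f \<circ> finv g) (x + - y) (0 + - 0)"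
        using fg HD(1) by (intro trans_ends_comp trans_ends_inv) auto
      then show ?thesis using HD(3)[OF fg(1) HD(4)[OF fg(3)]] by (auto simp: A_def)
    qed
  qed (use k in simp)
  then obtain a where a: "a > 0" "A = range ((*) a)" by blast
  have "\<exists>b>0. B = range ((*) b)"
  proof (rule int_subgroup)
    show "int k \<in> B" using powH[OF stretch_T] trans_ends_funpow[OF stretch_ends, of k 0] by (auto simp: B_def)
    show "x - y \<in> B" if xy: "x \<in> B" "y \<in> B" for x y
    proof -
      obtain f g where fg: "f \<in> H" "trans_ends f 0 x" "g \<in> H" "trans_ends g 0 y"
        using xy by (auto simp: B_def)
      have "trans_ends (f \<circ> finv g) (0 + - 0) (x + - y)"
        using fg HD(1) by (intro trans_ends_comp trans_ends_inv) auto
      then show ?thesis using HD(3)[OF fg(1) HD(4)[OF fg(3)]] by (auto simp: B_def)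
    qed
  qed (use k in simp)
  then obtain b where b: "b > 0" "B = range ((*) b)" by blast
  obtain \<phi> where \<phi>: "\<phi> \<in> iso T (T\<lparr>carrier := H\<rparr>)" using iso by (auto simp: is_iso_def)
  have TT: "T\<lparr>carrier := T_set\<rparr> = T" by (simp add: T_def)
  have gH: "group (T\<lparr>carrier := H\<rparr>)" using T.subgroup_imp_group[OF H] .
  have phiH: "\<phi> f \<in> H" if "f \<in> T_set" for f
    using \<phi> that by (auto simp: iso_def hom_def)
  have axis: "\<exists>p q. trans_ends (\<phi> f) (a * p) (b * q)"
    if f: "f \<in> T_set" "trans_ends f i j" "i = 0 \<or> j = 0" for f i j
  proof -
    have "T_c \<subseteq> T_set" using T_c_T by blast
    then have "conj_centralized T f"
      using one_sided_conj_centralized[of T_set f i j] T.subgroup_self f by (simp add: TT)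
    then have c: "conj_centralized (T\<lparr>carrier := H\<rparr>) (\<phi> f)"
      using conj_centralized_iso[OF group_T gH \<phi>] f by simp
    obtain p q where pq: "trans_ends (\<phi> f) p q" using T_trans_ends phiH[OF f(1)] HD(1) by blast
    have "p = 0 \<or> q = 0" using two_sided_not_conj_centralized[OF H TcH phiH[OF f(1)] pq] c by blast
    then have "p \<in> A \<and> q \<in> B"
    proof
      assume p: "p = 0"
      have "trans_ends id 0 0" by (rule trans_ends_id)
      then show ?thesis using pq p phiH[OF f(1)] HD(2) unfolding A_def B_def by blast
    next
      assume q: "q = 0"
      have "trans_ends id 0 0" by (rule trans_ends_id)
      then show ?thesis using pq q phiH[OF f(1)] HD(2) unfolding A_def B_def by blast
    qed
    then show ?thesis using pq a(2) b(2) by blast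
  qed
  have "H = K_T a b"
  proof
    show "H \<subseteq> K_T a b"
    proof
      fix l assume l: "l \<in> H"
      obtain f where f: "f \<in> T_set" "l = \<phi> f" using \<phi> l by (auto simp: iso_def bij_betw_def)
      obtain i j where ij: "trans_ends f i j" using f(1) by (rule T_trans_ends)
      obtain f1 where f1: "f1 \<in> T_set" "trans_ends f1 i 0" using exists_left_translation by blast
      define f2 where "f2 = finv f1 \<circ> f"
      have f2: "f2 \<in> T_set" unfolding f2_def using f1 f by (intro T_comp T_inv)
      have "trans_ends f2 (- i + i) (- 0 + j)"
        unfolding f2_def by (intro trans_ends_comp trans_ends_inv f1 ij)
      then obtain p q where pq: "trans_ends (\<phi> f2) (a * p) (b * q)" using axis[OF f2, of 0 j] by auto
      obtain p' q' where pq': "trans_ends (\<phi> f1) (a * p') (b * q')" using axis[OF f1] by auto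
      have "f = f1 \<circ> f2" using f1(1) by (simp add: f2_def fun_eq_iff)
      then have "l = \<phi> f1 \<circ> \<phi> f2" using \<phi> f1(1) f2 by (simp add: f(2) iso_def hom_def)
      then have "trans_ends l (a * p' + a * p) (b * q' + b * q)" using trans_ends_comp[OF pq' pq] by simp
      then have "trans_ends l (a * (p' + p)) (b * (q' + q))" by (simp add: distrib_left)
      then show "l \<in> K_T a b" using l HD(1) by (auto simp: K_T_def)
    qed
    show "K_T a b \<subseteq> H"
    proof
      fix f assume "f \<in> K_T a b"
      then obtain i j where f: "f \<in> T_set" "trans_ends f (a * i) (b * j)" by (auto simp: K_T_def)
      have "a * i \<in> A" "b * j \<in> B" using a b by auto
      then obtain f1 f2 where f1: "f1 \<in> H" "trans_ends f1 (a * i) 0" and f2: "f2 \<in> H" "trans_ends f2 0 (b * j)"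
        by (auto simp: A_def B_def)
      let ?g = "f \<circ> finv (f1 \<circ> f2)"
      have T: "f1 \<circ> f2 \<in> T_set" using HD(1,3) f1 f2 by blast
      have "trans_ends ?g (a * i + - (a * i + 0)) (b * j + - (0 + b * j))"
        by (intro trans_ends_comp trans_ends_inv f f1 f2 T)
      then have "?g \<in> T_c" using f(1) T by (simp add: T_c_def T_comp T_inv)
      then have "?g \<circ> (f1 \<circ> f2) \<in> H" using TcH HD(3) f1 f2 by blast
      moreover have "?g \<circ> (f1 \<circ> f2) = f" using T_inv_f[OF T] by (simp add: fun_eq_iff)
      ultimately show "f \<in> H" by simp
    qed
  qed
  then show ?thesis using a b by blast
qed

section \<open>Unwinding the translations at the two ends\<close>

lemma conj_group_iso:
  assumes h: "PL_homeo h" and "H \<subseteq> T_set"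
    and forth: "\<And>f. f \<in> H \<Longrightarrow> \<exists>i j. trans_ends (h \<circ> f \<circ> finv h) i j"
    and fro: "\<And>f. f \<in> T_set \<Longrightarrow> finv h \<circ> f \<circ> h \<in> H"
  shows "T\<lparr>carrier := H\<rparr> \<cong> T"
proof -
  let ?\<Phi> = "\<lambda>f. h \<circ> f \<circ> finv h"
  have PL: "PL_homeo f" if "f \<in> T_set" for f using that by (simp add: T_set_def)
  have hom: "?\<Phi> \<in> hom (T\<lparr>carrier := H\<rparr>) T"
  proof (rule homI)
    show "?\<Phi> f \<in> carrier T" if "f \<in> carrier (T\<lparr>carrier := H\<rparr>)" for f
      using that forth PL assms(2) PL_homeo_comp[OF PL_homeo_comp[OF h] PL_homeo_inv[OF h]]
      by (auto simp: T_set_def)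
    show "?\<Phi> (f \<otimes>\<^bsub>T\<lparr>carrier := H\<rparr>\<^esub> g) = ?\<Phi> f \<otimes>\<^bsub>T\<^esub> ?\<Phi> g" for f g
      using h by (simp add: fun_eq_iff)
  qed
  have "bij_betw ?\<Phi> H T_set"
  proof (rule bij_betw_byWitness[where f' = "\<lambda>f. finv h \<circ> f \<circ> h"])
    show "?\<Phi> ` H \<subseteq> T_set" using hom by (auto simp: hom_def)
  qed (use fro h in \<open>auto simp: fun_eq_iff\<close>)
  then have "?\<Phi> \<in> iso (T\<lparr>carrier := H\<rparr>) T" using hom by (simp add: iso_def)
  then show ?thesis unfolding is_iso_def by blast
qed

text \<open>
  Each unit interval is cut into \<open>b\<close> pieces. Piece number \<open>r\<close>, counted from \<open>0\<close>, takes half of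
  what is left, except that the last piece takes all of it, so all lengths are powers of two.
\<close>

definition fold_nodes :: "int \<Rightarrow> int \<Rightarrow> real" where
  "fold_nodes b n = of_int (n div b) + 1 - 2 powi (- (n mod b))"

lemma fold_nodes_periodic: "b > 0 \<Longrightarrow> fold_nodes b (n + b * j) = fold_nodes b n + of_int j"
  by (simp add: fold_nodes_def)

lemma fold_nodes_step:
  assumes "b > 0" shows "\<exists>k::int. fold_nodes b (n + 1) = fold_nodes b n + 2 powi k"
proof (cases "n mod b = b - 1")
  case True
  have "b * (n div b + 1) = b * (n div b) + b" by (simp add: algebra_simps)
  then have n: "n + 1 = 0 + b * (n div b + 1)" using True mult_div_mod_eq[of b n] by linarith
  have "fold_nodes b (n + 1) = fold_nodes b 0 + of_int (n div b + 1)"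
    unfolding n by (rule fold_nodes_periodic[OF assms])
  then have "fold_nodes b (n + 1) = fold_nodes b n + 2 powi (- (n mod b))"
    by (simp add: fold_nodes_def)
  then show ?thesis by blast
next
  case False
  define r where "r = n mod b"
  have "r < b" "r \<noteq> b - 1" using False assms pos_mod_bound[of b n] by (simp_all add: r_def)
  then have "r + 1 < b" by linarith
  then have r: "0 \<le> r" "r + 1 < b" "n = r + b * (n div b)" using assms by (auto simp: r_def)
  have d: "(n + 1) div b = n div b" "(n + 1) mod b = r + 1"
  proof -
    have n: "n + 1 = (r + 1) + b * (n div b)" using r(3) by linarith
    show "(n + 1) mod b = r + 1" by (subst n) (use r in simp)
    show "(n + 1) div b = n div b" by (subst n) (use r in \<open>simp add: div_pos_pos_trivial\<close>)
  qed
  have "2 powi (- r) = 2 * (2::real) powi (- (r + 1))"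
    using power_int_add[of "2::real" 1 "- (r + 1)"] by simp
  then have "fold_nodes b (n + 1) = fold_nodes b n + 2 powi (- (r + 1))"
    by (simp add: fold_nodes_def d flip: r_def)
  then show ?thesis by blast
qed

definition two_sided_nodes :: "int \<Rightarrow> int \<Rightarrow> int \<Rightarrow> real" where
  "two_sided_nodes a b n = (if n \<ge> 0 then fold_nodes b n else fold_nodes a n)"

text \<open>
  The interpolation \<open>h\<close> of \<open>two_sided_nodes a b\<close> satisfies \<open>h (x + b) = h x + 1\<close> on the right and
  \<open>h (x + a) = h x + 1\<close> on the left. Conjugation by \<open>h\<close> thus turns translations by multiples of \<open>b\<close> and
  \<open>a\<close> into translations by arbitrary integers. In between, it preserves
  the property of being dyadic piecewise linear, since \<open>h\<close> has it.
\<close>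

lemma K_T_iso_T:
  assumes a: "a > 0" and b: "b > 0" shows "T\<lparr>carrier := K_T a b\<rparr> \<cong> T"
proof -
  define c where "c = two_sided_nodes a b"
  have c0: "fold_nodes n 0 = 0" for n by (simp add: fold_nodes_def)
  have cb: "c n = fold_nodes b n" if "n \<ge> 0" for n using that by (simp add: c_def two_sided_nodes_def)
  have ca: "c n = fold_nodes a n" if "n \<le> 0" for n
    using that c0 by (cases "n = 0") (auto simp: c_def two_sided_nodes_def)
  have nodes: "nodes c"
  proof (rule nodesI)
    show "\<exists>k::int. c (n + 1) = c n + 2 powi k" for n
      using fold_nodes_step[OF a, of n] fold_nodes_step[OF b, of n]
      by (cases "n \<ge> 0") (auto simp: ca cb)
    have "fold_nodes b n \<in> dyadic" for b n
      unfolding fold_nodes_def using dyadic_of_int[of "n div b + 1"] by (auto intro!: dyadic_diff)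
    then show "c n \<in> dyadic" for n by (simp add: c_def two_sided_nodes_def)
  qed
  define h where "h = interp c"
  have hi: "h (x + of_int (b * j)) = h x + of_int j" if "x \<ge> 0" "x + of_int (b * j) \<ge> 0" for x j
  proof -
    have fl: "\<lfloor>x + of_int (b * j)\<rfloor> = \<lfloor>x\<rfloor> + b * j" "frac (x + of_int (b * j)) = frac x"
      by (simp_all add: frac_def del: of_int_mult)
    have "\<lfloor>x\<rfloor> \<ge> 0" "\<lfloor>x\<rfloor> + b * j \<ge> 0"
      using that by (simp_all only: fl(1)[symmetric] zero_le_floor)
    then show ?thesis
      using fold_nodes_periodic[OF b, of "\<lfloor>x\<rfloor>" j] fold_nodes_periodic[OF b, of "\<lfloor>x\<rfloor> + 1" j]
      unfolding h_def interp_def fl by (simp add: cb add_ac)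
  qed
  have lo: "h (x + of_int (a * j)) = h x + of_int j" if "x < 0" "x + of_int (a * j) < 0" for x j
  proof -
    have fl: "\<lfloor>x + of_int (a * j)\<rfloor> = \<lfloor>x\<rfloor> + a * j" "frac (x + of_int (a * j)) = frac x"
      by (simp_all add: frac_def del: of_int_mult)
    have "\<lfloor>x\<rfloor> < 0" "\<lfloor>x\<rfloor> + a * j < 0"
      using that by (simp_all only: fl(1)[symmetric] floor_less_zero)
    then have c: "c \<lfloor>x\<rfloor> = fold_nodes a \<lfloor>x\<rfloor>" "c (\<lfloor>x\<rfloor> + 1) = fold_nodes a (\<lfloor>x\<rfloor> + 1)"
      "c (\<lfloor>x\<rfloor> + a * j) = fold_nodes a (\<lfloor>x\<rfloor> + a * j)"
      "c (\<lfloor>x\<rfloor> + a * j + 1) = fold_nodes a (\<lfloor>x\<rfloor> + a * j + 1)"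
      by - (rule ca, linarith)+
    have eq: "\<lfloor>x\<rfloor> + a * j + 1 = \<lfloor>x\<rfloor> + 1 + a * j" by simp
    show ?thesis
      unfolding h_def interp_def fl c unfolding eq fold_nodes_periodic[OF a] by (simp add: algebra_simps)
  qed
  have h: "PL_homeo h"
  proof (rule PL_homeoI)
    show "strict_mono h" unfolding h_def by (rule interp_strict_mono[OF nodes])
    show "PL_germ h x" for x unfolding h_def by (rule interp_PL_germ[OF nodes])
    have "y \<in> range h" for y
      unfolding h_def
    proof (rule interp_range[OF nodes])
      define j where "j = \<bar>\<lceil>y\<rceil>\<bar>"
      define i where "i = - \<bar>\<lfloor>y\<rfloor>\<bar>"
      have "c (a * i) = of_int i"
        using fold_nodes_periodic[OF a, of 0 i] c0 a by (simp add: i_def ca mult_le_0_iff)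
      then show "c (a * i) \<le> y" unfolding i_def by linarith
      have "c (b * j) = of_int j"
        using fold_nodes_periodic[OF b, of 0 j] c0 b by (simp add: j_def cb)
      then show "y \<le> c (b * j)" unfolding j_def by linarith
    qed
    then show "surj h" by auto
  qed
  show ?thesis
  proof (rule conj_group_iso[OF h])
    show "K_T a b \<subseteq> T_set" by (auto simp: K_T_def)
    show "\<exists>i j. trans_ends (h \<circ> f \<circ> finv h) i j" if f: "f \<in> K_T a b" for f
    proof -
      obtain i j where ij: "trans_ends f (a * i) (b * j)" using f by (auto simp: K_T_def)
      then obtain N where N: "\<And>x. x \<le> - N \<Longrightarrow> f x = x + of_int (a * i)" "\<And>x. x \<ge> N \<Longrightarrow> f x = x + of_int (b * j)"
        by (rule trans_endsE) blast
      define p where "p = min (- N) (min (- 1) (- 1 - of_int (a * i)))"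
      define q where "q = max N (max 0 (- of_int (b * j)))"
      have "trans_ends (h \<circ> f \<circ> finv h) i j"
      proof (rule trans_endsI[of "- h p" _ _ "h q"])
        fix y assume "y \<le> - (- h p)"
        then have x: "finv h y \<le> p" using PL_homeo_le_iff[OF h, of "finv h y" p] h by simp
        have "h (f (finv h y)) = h (finv h y + of_int (a * i))"
          using x by (subst N(1)) (auto simp: p_def)
        also have "\<dots> = h (finv h y) + of_int i" using x by (intro lo) (auto simp: p_def)
        finally show "(h \<circ> f \<circ> finv h) y = y + of_int i" using h by simp
      next
        fix y assume "h q \<le> y"
        then have x: "q \<le> finv h y" using PL_homeo_le_iff[OF h, of q "finv h y"] h by simp
        have "h (f (finv h y)) = h (finv h y + of_int (b * j))"
          using x by (subst N(2)) (auto simp: q_def)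
        also have "\<dots> = h (finv h y) + of_int j" using x by (intro hi) (auto simp: q_def)
        finally show "(h \<circ> f \<circ> finv h) y = y + of_int j" using h by simp
      qed
      then show ?thesis by blast
    qed
    show "finv h \<circ> f \<circ> h \<in> K_T a b" if f: "f \<in> T_set" for f
    proof -
      obtain i j where ij: "trans_ends f i j" using f by (rule T_trans_ends)
      then obtain N where N: "\<And>x. x \<le> - N \<Longrightarrow> f x = x + of_int i" "\<And>x. x \<ge> N \<Longrightarrow> f x = x + of_int j"
        by (rule trans_endsE) blast
      define p where "p = min (finv h (- N)) (min (- 1) (- 1 - of_int (a * i)))"
      define q where "q = max (finv h N) (max 0 (- of_int (b * j)))"
      have te: "trans_ends (finv h \<circ> f \<circ> h) (a * i) (b * j)"
      proof (rule trans_endsI[of "- p" _ _ q])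
        fix x assume x: "x \<le> - (- p)"
        then have "h x \<le> - N" using PL_homeo_le_iff[OF h, of x "finv h (- N)"] h by (simp add: p_def)
        then have "f (h x) = h x + of_int i" by (rule N)
        also have "\<dots> = h (x + of_int (a * i))" using x by (intro lo[symmetric]) (auto simp: p_def)
        finally show "(finv h \<circ> f \<circ> h) x = x + of_int (a * i)" using h by (simp del: of_int_mult)
      next
        fix x assume x: "q \<le> x"
        then have "h x \<ge> N" using PL_homeo_le_iff[OF h, of "finv h N" x] h by (simp add: q_def)
        then have "f (h x) = h x + of_int j" by (rule N)
        also have "\<dots> = h (x + of_int (b * j))" using x by (intro hi[symmetric]) (auto simp: q_def)
        finally show "(finv h \<circ> f \<circ> h) x = x + of_int (b * j)" using h by (simp del: of_int_mult)
      qed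
      have "PL_homeo f" using f by (simp add: T_set_def)
      then have "PL_homeo (finv h \<circ> f \<circ> h)" by (intro PL_homeo_comp PL_homeo_inv h)
      then show ?thesis using te by (auto simp: K_T_def T_set_def)
    qed
  qed
qed

section \<open>Powers in a subgroup of finite index\<close>

lemma (in group) conj_nat_pow:
  assumes "x \<in> carrier G" "h \<in> carrier G"
  shows "(x \<otimes> h \<otimes> inv x) [^] (q::nat) = x \<otimes> h [^] q \<otimes> inv x"
proof (induct q)
  case (Suc q)
  have "inv x \<otimes> (x \<otimes> (h \<otimes> inv x)) = h \<otimes> inv x"
    using assms by (metis inv_closed l_inv l_one m_assoc m_closed)
  then have "(x \<otimes> h [^] q \<otimes> inv x) \<otimes> (x \<otimes> h \<otimes> inv x) = x \<otimes> h [^] Suc q \<otimes> inv x"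
    using assms by (simp add: m_assoc)
  then show ?case using Suc by simp
qed (use assms in simp)

text \<open>
  Two of the cosets \<open>H x g\<^sup>i\<close> with \<open>i \<le> n\<close> agree, where \<open>n\<close> is the index; so some \<open>x g\<^sup>d x\<inverse>\<close> with
  \<open>0 < d \<le> n\<close> lies in \<open>H\<close>. The exponent \<open>d\<close> divides \<open>n!\<close>, which depends neither on \<open>g\<close> nor on \<open>x\<close>.
\<close>

lemma (in group) finite_index_conj_pow:
  assumes H: "subgroup H G" and fin: "finite (rcosets H)"
  shows "\<exists>k::nat. k > 0 \<and> (\<forall>g\<in>carrier G. \<forall>x\<in>carrier G. x \<otimes> g [^] k \<otimes> inv x \<in> H)"
proof (intro exI[of _ "fact (card (rcosets H))"] conjI ballI)
  let ?n = "card (rcosets H)"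
  fix g x assume g: "g \<in> carrier G" and x: "x \<in> carrier G"
  let ?f = "\<lambda>i::nat. H #> (x \<otimes> g [^] i)"
  have "?f ` {0..?n} \<subseteq> rcosets H"
    using rcosetsI[OF subgroup.subset[OF H]] g x by auto
  then have "card (?f ` {0..?n}) \<le> ?n" using fin by (rule card_mono[rotated])
  then have "\<not> inj_on ?f {0..?n}" by (intro pigeonhole) simp
  then obtain i j where ij: "i < j" "j \<le> ?n" "?f i = ?f j"
    unfolding inj_on_def by (metis atLeastAtMost_iff linorder_neqE_nat)
  have "x \<otimes> g [^] j \<in> ?f i"
    unfolding ij(3) using g x by (intro rcos_self H) simp
  then have m: "x \<otimes> g [^] j \<otimes> inv (x \<otimes> g [^] i) \<in> H"
    using subgroup.rcos_module_imp[OF H is_group] g x by simp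
  have "g [^] j = g [^] (j - i) \<otimes> g [^] i" using ij(1) g by (simp add: nat_pow_mult)
  then have "x \<otimes> g [^] j \<otimes> inv (x \<otimes> g [^] i) = x \<otimes> g [^] (j - i) \<otimes> inv x"
    using g x by (simp add: inv_mult_group m_assoc[symmetric]) (simp add: m_assoc)
  with m have d: "x \<otimes> g [^] (j - i) \<otimes> inv x \<in> H" by simp
  have "(j - i) dvd fact ?n" using ij by (intro dvd_fact) auto
  then obtain q where q: "fact ?n = (j - i) * q" by (auto elim: dvdE)
  have "(x \<otimes> g [^] (j - i) \<otimes> inv x) [^] q \<in> H"
    by (induct q) (use d H in \<open>auto intro: subgroup.m_closed subgroup.one_closed\<close>)
  then show "x \<otimes> g [^] (fact ?n :: nat) \<otimes> inv x \<in> H"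
    using g x by (simp add: conj_nat_pow nat_pow_pow q)
qed simp

section \<open>From the line to the unit interval\<close>

text \<open>
  The nodes \<open>\<dots>, 1/8, 1/4, 1/2, 3/4, 7/8, \<dots>\<close>, with \<open>1/2\<close> at \<open>0\<close>.
\<close>

definition chart_nodes :: "int \<Rightarrow> real" where
  "chart_nodes n = (if n \<le> 0 then 2 powi (n - 1) else 1 - 2 powi (- n - 1))"

definition chart :: "real \<Rightarrow> real" where
  "chart = interp chart_nodes"

abbreviation chart_inv :: "real \<Rightarrow> real" where
  "chart_inv \<equiv> inv_into UNIV chart"

lemma powi_double: "2 * (2::real) powi n = 2 powi (n + 1)"
  by (simp add: power_int_add)

lemma chart_nodes_nonneg: "n \<ge> 0 \<Longrightarrow> chart_nodes n = 1 - 2 powi (- n - 1)"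
  by (auto simp: chart_nodes_def power_int_minus)

lemma chart_nodes_nonpos: "n \<le> 0 \<Longrightarrow> chart_nodes n = 2 powi (n - 1)"
  by (simp add: chart_nodes_def)

lemma nodes_chart: "nodes chart_nodes"
proof (rule nodesI)
  show "chart_nodes n \<in> dyadic" for n
    unfolding chart_nodes_def by (auto intro!: dyadic_diff)
  fix n :: int
  show "\<exists>k::int. chart_nodes (n + 1) = chart_nodes n + 2 powi k"
  proof (cases "n < 0")
    case True
    then show ?thesis
      using powi_double[of "n - 1"] by (intro exI[of _ "n - 1"]) (simp add: chart_nodes_nonpos)
  next
    case False
    have i: "- (n + 1) - 1 = - n - 2" "- n - 2 + 1 = - n - 1" by simp_all
    have "chart_nodes (n + 1) = 1 - 2 powi (- n - 2)" "chart_nodes n = 1 - 2 powi (- n - 1)"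
      using False chart_nodes_nonneg[of "n + 1"] chart_nodes_nonneg[of n] unfolding i by simp_all
    then show ?thesis
      using powi_double[of "- n - 2"] unfolding i by (intro exI[of _ "- n - 2"]) simp
  qed
qed

lemma chart_strict_mono: "strict_mono chart"
  unfolding chart_def by (rule interp_strict_mono[OF nodes_chart])

lemma chart_less_iff [simp]: "chart x < chart y \<longleftrightarrow> x < y"
  and chart_le_iff [simp]: "chart x \<le> chart y \<longleftrightarrow> x \<le> y"
  using chart_strict_mono by (simp_all add: strict_mono_less strict_mono_less_eq)

lemma chart_germ: "PL_germ chart x"
  unfolding chart_def by (rule interp_PL_germ[OF nodes_chart])

lemma chart_inv_chart [simp]: "chart_inv (chart x) = x"
  using chart_strict_mono by (simp add: strict_mono_imp_inj_on)

lemma chart_of_int: "chart (of_int n) = chart_nodes n"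
  by (simp add: chart_def)

lemma chart_nodes_bounds: "0 < chart_nodes n" "chart_nodes n < 1"
proof -
  have "(2::real) powi (- n - 1) < 2 powi 0" if "n > 0" using that by (intro power_int_strict_increasing) auto
  moreover have "(2::real) powi (n - 1) < 2 powi 0" if "n \<le> 0" using that by (intro power_int_strict_increasing) auto
  ultimately show "0 < chart_nodes n" "chart_nodes n < 1" by (auto simp: chart_nodes_def)
qed

lemma chart_bounds [simp]: "0 < chart x" "chart x < 1"
proof -
  have "chart_nodes \<lfloor>x\<rfloor> \<le> chart x" "chart x < chart_nodes (\<lfloor>x\<rfloor> + 1)"
    unfolding chart_of_int[symmetric] by simp_all
  then show "0 < chart x" "chart x < 1"
    using chart_nodes_bounds[of "\<lfloor>x\<rfloor>"] chart_nodes_bounds[of "\<lfloor>x\<rfloor> + 1"] by linarith+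
qed

lemma chart_not_outside [simp]: "\<not> chart x < 0" "\<not> 1 < chart x" "0 \<le> chart x" "chart x \<le> 1"
  "chart x \<noteq> 0" "chart x \<noteq> 1"
  using chart_bounds[of x] by linarith+

lemma chart_chart_inv [simp]:
  assumes "0 < y" "y < 1" shows "chart (chart_inv y) = y"
proof -
  obtain m where m: "(1 / 2 :: real) ^ m < y" using real_arch_pow_inv[of y "1 / 2"] assms by auto
  obtain n where n: "(1 / 2 :: real) ^ n < 1 - y" using real_arch_pow_inv[of "1 - y" "1 / 2"] assms by auto
  have p: "(2::real) powi (- int k) = (1 / 2) ^ k" for k by (simp add: power_int_minus power_one_over inverse_eq_divide)
  have p1: "(2::real) powi (- int k - 1) \<le> (1 / 2) ^ k" for k
  proof -
    have "0 < (2::real) powi (- int k - 1)" by simp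
    moreover have "2 * (2::real) powi (- int k - 1) = (1 / 2) ^ k"
      using powi_double[of "- int k - 1"] p[of k] by simp
    ultimately show ?thesis by linarith
  qed
  have "chart_nodes (- int m) \<le> y" using m p1[of m] by (simp add: chart_nodes_nonpos)
  moreover have "y \<le> chart_nodes (int n)" using n p1[of n] by (simp add: chart_nodes_nonneg)
  ultimately have "y \<in> range chart" unfolding chart_def by (rule interp_range[OF nodes_chart])
  then show ?thesis by (simp add: f_inv_into_f)
qed

text \<open>
  Doubling near \<open>0\<close> is a shift of the nodes; likewise for the distance to \<open>1\<close> in the next lemma.
\<close>

lemma chart_translate_neg:
  assumes "x < 0" "x + of_int i < 0" shows "chart (x + of_int i) = 2 powi i * chart x"
proof -
  have fl: "\<lfloor>x + of_int i\<rfloor> = \<lfloor>x\<rfloor> + i" "frac (x + of_int i) = frac x" by (simp_all add: frac_def)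
  have "\<lfloor>x\<rfloor> < 0" "\<lfloor>x\<rfloor> + i < 0" using assms by (simp_all only: fl(1)[symmetric] floor_less_zero)
  moreover have "chart_nodes (n + i) = 2 powi i * chart_nodes n" if "n \<le> 0" "n + i \<le> 0" for n
  proof -
    have i: "n + i - 1 = i + (n - 1)" by simp
    have "(2::real) powi (n + i - 1) = 2 powi i * 2 powi (n - 1)"
      by (subst i, subst power_int_add) auto
    then show ?thesis using that by (simp only: chart_nodes_nonpos)
  qed
  from this[of "\<lfloor>x\<rfloor>"] this[of "\<lfloor>x\<rfloor> + 1"] calculation
  have c: "chart_nodes (\<lfloor>x\<rfloor> + i) = 2 powi i * chart_nodes \<lfloor>x\<rfloor>"
    "chart_nodes (\<lfloor>x\<rfloor> + i + 1) = 2 powi i * chart_nodes (\<lfloor>x\<rfloor> + 1)"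
    by (simp_all add: add_ac)
  show ?thesis unfolding chart_def interp_def fl c by (simp add: algebra_simps)
qed

lemma chart_translate_nonneg:
  assumes "x \<ge> 0" "x + of_int i \<ge> 0" shows "1 - chart (x + of_int i) = 2 powi (- i) * (1 - chart x)"
proof -
  have fl: "\<lfloor>x + of_int i\<rfloor> = \<lfloor>x\<rfloor> + i" "frac (x + of_int i) = frac x" by (simp_all add: frac_def)
  have "\<lfloor>x\<rfloor> \<ge> 0" "\<lfloor>x\<rfloor> + i \<ge> 0" using assms by (simp_all only: fl(1)[symmetric] zero_le_floor)
  moreover have "chart_nodes (n + i) = 1 - 2 powi (- i) * (1 - chart_nodes n)" if "n \<ge> 0" "n + i \<ge> 0" for n
  proof -
    have i: "- (n + i) - 1 = - i + (- n - 1)" by simp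
    have "(2::real) powi (- (n + i) - 1) = 2 powi (- i) * 2 powi (- n - 1)"
      by (subst i, subst power_int_add) auto
    moreover have "1 - (1 - 2 powi (- n - 1)) = (2::real) powi (- n - 1)" by simp
    ultimately have "1 - (2::real) powi (- (n + i) - 1) = 1 - 2 powi (- i) * (1 - (1 - 2 powi (- n - 1)))"
      by (simp only:)
    then show ?thesis using that by (simp only: chart_nodes_nonneg)
  qed
  from this[of "\<lfloor>x\<rfloor>"] this[of "\<lfloor>x\<rfloor> + 1"] calculation
  have c: "chart_nodes (\<lfloor>x\<rfloor> + i) = 1 - 2 powi (- i) * (1 - chart_nodes \<lfloor>x\<rfloor>)"
    "chart_nodes (\<lfloor>x\<rfloor> + i + 1) = 1 - 2 powi (- i) * (1 - chart_nodes (\<lfloor>x\<rfloor> + 1))"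
    by (simp_all add: add_ac)
  show ?thesis unfolding chart_def interp_def fl c by (simp add: algebra_simps)
qed

text \<open>
  Conjugation by the chart, extended to the endpoints of the unit interval and made
  extensional as required of the elements of \<open>thompson_F\<close>.
\<close>

definition transfer :: "(real \<Rightarrow> real) \<Rightarrow> real \<Rightarrow> real" where
  "transfer f = (\<lambda>x\<in>{0..1}. if 0 < x \<and> x < 1 then chart (f (chart_inv x)) else x)"

lemma transfer_mid [simp]: "0 < x \<Longrightarrow> x < 1 \<Longrightarrow> transfer f x = chart (f (chart_inv x))"
  and transfer_0 [simp]: "transfer f 0 = 0" and transfer_1 [simp]: "transfer f 1 = 1"
  and transfer_ext: "transfer f \<in> extensional {0..1}"
  by (auto simp: transfer_def)

lemma transfer_undefined: "x < 0 \<or> x > 1 \<Longrightarrow> transfer f x = undefined"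
  by (auto simp: transfer_def)

lemma transfer_in: "x \<in> {0..1} \<Longrightarrow> transfer f x \<in> {0..1}"
  by (auto simp: transfer_def less_imp_le)

lemma transfer_comp: "transfer (f \<circ> g) = compose {0..1} (transfer f) (transfer g)"
  by (rule ext) (auto simp: transfer_def compose_def)

lemma unit_cases:
  assumes "x \<in> {0..1::real}"
  obtains "x = 0" | "x = 1" | y where "x = chart y"
proof -
  consider "x = 0" | "x = 1" | "0 < x" "x < 1" using assms by fastforce
  then show ?thesis using that chart_chart_inv[of x] by cases metis+
qed

lemma transfer_chart [simp]: "transfer f (chart y) = chart (f y)"
  by simp

lemma transfer_strict_mono:
  assumes "f \<in> T_set" shows "strict_mono_on {0..1} (transfer f)"
proof (rule strict_mono_onI)
  fix x y :: real assume "x \<in> {0..1}" "y \<in> {0..1}" "x < y"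
  then show "transfer f x < transfer f y"
    by (elim unit_cases) (auto simp: assms simp del: transfer_mid dest: order.strict_trans)
qed

lemma transfer_image:
  assumes "f \<in> T_set" shows "transfer f ` {0..1} = {0..1}"
proof
  show "transfer f ` {0..1} \<subseteq> {0..1}" using transfer_in by blast
  show "{0..1} \<subseteq> transfer f ` {0..1}"
  proof
    fix y :: real assume "y \<in> {0..1}"
    then show "y \<in> transfer f ` {0..1}"
    proof (cases rule: unit_cases)
      case (3 z)
      then have "y = transfer f (chart (finv f z))" using assms by simp
      then show ?thesis by (intro image_eqI[where x = "chart (finv f z)"]) (auto simp: less_imp_le)
    qed (auto intro: image_eqI[where x=0] image_eqI[where x=1])
  qed
qed

lemma transfer_Bij:
  assumes "f \<in> T_set" shows "transfer f \<in> Bij {0..1}"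
  using transfer_ext transfer_image[OF assms] strict_mono_on_imp_inj_on[OF transfer_strict_mono[OF assms]]
  by (simp add: Bij_def bij_betw_def)

lemma transfer_near_0:
  assumes "trans_ends f i j"
  shows "\<exists>N. \<forall>n\<le>N. \<forall>x. 0 \<le> x \<and> x \<le> chart (of_int n) \<longrightarrow> transfer f x = 2 powi i * x"
proof -
  obtain N where N: "\<And>x. x \<le> - N \<Longrightarrow> f x = x + of_int i" using assms by (rule trans_endsE) blast
  define M where "M = min (\<lfloor>- N\<rfloor>) (min (- 1) (- 1 - i))"
  have "transfer f x = 2 powi i * x" if "n \<le> M" "0 \<le> x" "x \<le> chart (of_int n)" for n x
  proof (cases "x = 0")
    case False
    have "x < 1" using that(3) chart_bounds(2) by (rule le_less_trans)
    then have "x \<in> {0..1}" using that by simp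
    then obtain y where y: "x = chart y" using False \<open>x < 1\<close> by (metis unit_cases less_irrefl)
    then have "y \<le> of_int n" using that by simp
    moreover have "of_int n \<le> real_of_int M" using that by simp
    moreover have "real_of_int M \<le> - N" "real_of_int M \<le> - 1" "real_of_int M \<le> - 1 - of_int i"
      unfolding M_def by linarith+
    ultimately have "y \<le> - N" "y < 0" "y + of_int i < 0" by linarith+
    then show ?thesis unfolding y transfer_chart using N chart_translate_neg by simp
  qed simp
  then show ?thesis by blast
qed

lemma transfer_near_1:
  assumes "trans_ends f i j"
  shows "\<exists>N. \<forall>n\<ge>N. \<forall>x. chart (of_int n) \<le> x \<and> x \<le> 1 \<longrightarrow> 1 - transfer f x = 2 powi (- j) * (1 - x)"
proof -
  obtain N where N: "\<And>x. x \<ge> N \<Longrightarrow> f x = x + of_int j" using assms by (rule trans_endsE) blast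
  define M where "M = max (\<lceil>N\<rceil>) (max 0 (- j))"
  have "1 - transfer f x = 2 powi (- j) * (1 - x)" if "n \<ge> M" "chart (of_int n) \<le> x" "x \<le> 1" for n x
  proof (cases "x = 1")
    case False
    have "0 < x" using chart_bounds(1) that(2) by (rule less_le_trans)
    then have "x \<in> {0..1}" using that by simp
    then obtain y where y: "x = chart y" using False \<open>0 < x\<close> by (metis unit_cases less_irrefl)
    then have "y \<ge> of_int n" using that by simp
    moreover have "of_int n \<ge> real_of_int M" using that by simp
    moreover have "real_of_int M \<ge> N" "real_of_int M \<ge> 0" "real_of_int M \<ge> - of_int j"
      unfolding M_def by linarith+
    ultimately have "y \<ge> N" "y \<ge> 0" "y + of_int j \<ge> 0" by linarith+
    then show ?thesis unfolding y transfer_chart using N chart_translate_nonneg by simp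
  qed simp
  then show ?thesis by blast
qed

lemma transfer_germ:
  assumes "f \<in> T_set" "0 < x" "x < 1" shows "PL_germ (transfer f) x"
proof (rule PL_germ_cong)
  have "PL_germ chart_inv x" using PL_germ_inverse[OF chart_germ, of chart_inv "chart_inv x"] assms by simp
  then have "PL_germ (\<lambda>x. f (chart_inv x)) x" using T_germ[OF assms(1)] by (rule PL_germ_comp)
  then show "PL_germ (\<lambda>x. chart (f (chart_inv x))) x" by (rule PL_germ_comp[OF _ chart_germ])
  show "min x (1 - x) > 0" using assms by simp
qed auto

lemma transfer_affine:
  assumes f: "f \<in> T_set"
  shows "\<exists>B. finite B \<and> B \<subseteq> dyadic \<and>
    (\<forall>u v. 0 \<le> u \<and> u < v \<and> v \<le> 1 \<and> {u<..<v} \<inter> B = {} \<longrightarrow> affine_on (transfer f) u v)"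
proof -
  obtain i j where ij: "trans_ends f i j" using f by (rule T_trans_ends)
  obtain N M where N: "\<And>x. 0 \<le> x \<Longrightarrow> x \<le> chart (of_int N) \<Longrightarrow> transfer f x = 2 powi i * x"
    and M: "\<And>x. chart (of_int M) \<le> x \<Longrightarrow> x \<le> 1 \<Longrightarrow> 1 - transfer f x = 2 powi (- j) * (1 - x)"
    and NM: "N \<le> M"
  proof -
    obtain N where N: "\<And>n x. n \<le> N \<Longrightarrow> 0 \<le> x \<Longrightarrow> x \<le> chart (of_int n) \<Longrightarrow> transfer f x = 2 powi i * x"
      using transfer_near_0[OF ij] by blast
    obtain M where M: "\<And>n x. n \<ge> M \<Longrightarrow> chart (of_int n) \<le> x \<Longrightarrow> x \<le> 1 \<Longrightarrow> 1 - transfer f x = 2 powi (- j) * (1 - x)"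
      using transfer_near_1[OF ij] by blast
    show ?thesis
      by (rule that[of "min N M" "max N M"]) (use N[of "min N M"] M[of "max N M"] in simp_all)
  qed
  define d where "d = chart (of_int N)"
  define e where "e = chart (of_int M)"
  have de: "0 < d" "d \<le> e" "e < 1" "d \<in> dyadic" "e \<in> dyadic"
    using NM nodes_chart by (auto simp: d_def e_def chart_of_int nodes_def chart_nodes_bounds
        simp flip: chart_of_int)
  obtain B where B: "finite B" "B \<subseteq> dyadic"
    "\<And>u v. d \<le> u \<Longrightarrow> u < v \<Longrightarrow> v \<le> e \<Longrightarrow> {u<..<v} \<inter> B = {} \<Longrightarrow> affine_on (transfer f) u v"
    using PL_germ_breaks[OF de(2), of "transfer f"] transfer_germ[OF f] de by (metis le_less_trans less_le_trans)
  have "affine_on (transfer f) u v" if uv: "0 \<le> u" "u < v" "v \<le> 1" "{u<..<v} \<inter> (B \<union> {d, e}) = {}" for u v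
  proof -
    have "\<not> (u < d \<and> d < v)" "\<not> (u < e \<and> e < v)" using uv by auto
    then consider "v \<le> d" | "d \<le> u" "v \<le> e" | "e \<le> u" using uv(2) de(2) by linarith
    then show ?thesis
    proof cases
      case 1
      then show ?thesis using uv N by (intro affine_onI[where b=0 and k=i]) (auto simp: d_def)
    next
      case 2 then show ?thesis using uv by (intro B(3)) auto
    next
      case 3
      show ?thesis
      proof (rule affine_onI)
        show "1 - 2 powi (- j) \<in> dyadic" by (intro dyadic_diff) auto
        show "transfer f x = 2 powi (- j) * x + (1 - 2 powi (- j))" if "u \<le> x" "x \<le> v" for x
          using M[of x] 3 that uv by (simp add: e_def algebra_simps)
      qed
    qed
  qed
  then show ?thesis using B(1,2) de by (intro exI[of _ "B \<union> {d, e}"]) auto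
qed

lemma transfer_continuous:
  assumes f: "f \<in> T_set" shows "continuous_on {0..1} (transfer f)"
proof -
  obtain i j where ij: "trans_ends f i j" using f by (rule T_trans_ends)
  obtain N where N: "\<And>x. 0 \<le> x \<Longrightarrow> x \<le> chart (of_int N) \<Longrightarrow> transfer f x = 2 powi i * x"
    using transfer_near_0[OF ij] by blast
  obtain M where M: "\<And>x. chart (of_int M) \<le> x \<Longrightarrow> x \<le> 1 \<Longrightarrow> 1 - transfer f x = 2 powi (- j) * (1 - x)"
    using transfer_near_1[OF ij] by blast
  have 1: "continuous_on {0..chart (of_int N)} (transfer f)"
    by (subst continuous_on_cong[OF refl, where g = "\<lambda>x. 2 powi i * x"]) (auto simp: N intro!: continuous_intros)
  have 2: "continuous_on {chart (of_int M)..1} (transfer f)"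
  proof (subst continuous_on_cong[OF refl])
    show "transfer f x = 1 - 2 powi (- j) * (1 - x)" if "x \<in> {chart (of_int M)..1}" for x
      using M[of x] that by simp
  qed (intro continuous_intros)
  have 3: "continuous_on {chart (of_int N)..chart (of_int M)} (transfer f)"
    using PL_germ_isCont[OF transfer_germ[OF f]] less_le_trans[OF chart_bounds(1)] le_less_trans[OF _ chart_bounds(2)]
    by (intro continuous_at_imp_continuous_on) auto
  have "{0..1} = {0..a} \<union> ({a..b} \<union> {b..1})" if "0 \<le> a" "a \<le> 1" "0 \<le> b" "b \<le> 1" for a b :: real
    using that by auto
  from this[of "chart (of_int N)" "chart (of_int M)"] show ?thesis
    using continuous_on_closed_Un[OF _ _ 1 continuous_on_closed_Un[OF _ _ 3 2]] by (simp add: closed_Un)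
qed

lemma transfer_F: assumes "f \<in> T_set" shows "transfer f \<in> thompson_F_set"
proof -
  have "\<exists>g. homeomorphism {0..1} {0..1} (transfer f) g"
    using transfer_continuous[OF assms] transfer_image[OF assms]
      strict_mono_on_imp_inj_on[OF transfer_strict_mono[OF assms]]
    by (intro homeomorphism_compact) auto
  moreover have "dyadic_PL (transfer f)"
    using transfer_affine[OF assms] unfolding dyadic_PL_def affine_on_def by metis
  ultimately show ?thesis
    using transfer_ext transfer_strict_mono[OF assms] unfolding thompson_F_set_def by blast
qed

section \<open>Every element of the group on the unit interval is transferred\<close>

lemma F_fixes_ends:
  assumes "f \<in> thompson_F_set" shows "f ` {0..1} = {0..1}" "f 0 = 0" "f 1 = 1"
proof -
  show im: "f ` {0..1} = {0..1}" using assms by (auto simp: thompson_F_set_def homeomorphism_def)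
  have mono: "f x \<le> f y" if "x \<in> {0..1}" "y \<in> {0..1}" "x \<le> y" for x y
    using assms that strict_mono_on_leD[of "{0..1}" f x y] by (simp add: thompson_F_set_def)
  have "0 \<in> f ` {0..1}" "1 \<in> f ` {0..1}" unfolding im by simp_all
  moreover have "f x \<in> {0..1}" if "x \<in> {0..1}" for x using imageI[OF that, of f] by (simp only: im)
  then have "f 0 \<in> {0..1}" "f 1 \<in> {0..1}" by simp_all
  ultimately obtain x y where "x \<in> {0..1}" "f x = 0" "y \<in> {0..1}" "f y = 1" by (metis imageE)
  then show "f 0 = 0" "f 1 = 1" using mono[of 0 x] mono[of y 1] \<open>f 0 \<in> _\<close> \<open>f 1 \<in> _\<close> by auto
qed

lemma F_less_iff:
  assumes "f \<in> thompson_F_set" "x \<in> {0..1}" "y \<in> {0..1}" shows "f x < f y \<longleftrightarrow> x < y"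
proof -
  have m: "strict_mono_on {0..1} f" using assms(1) by (simp add: thompson_F_set_def)
  show ?thesis
    using strict_mono_onD[OF m assms(2,3)] strict_mono_onD[OF m assms(3,2)] by (metis less_asym linorder_neqE)
qed

lemma F_interior:
  assumes "f \<in> thompson_F_set" "0 < x" "x < 1" shows "0 < f x" "f x < 1"
  using F_less_iff[OF assms(1), of 0 x] F_less_iff[OF assms(1), of x 1] F_fixes_ends[OF assms(1)] assms
  by auto

lemma interval_avoids:
  fixes u v :: real
  shows "(\<And>b. b \<in> B \<Longrightarrow> b \<le> u \<or> v \<le> b) \<Longrightarrow> {u<..<v} \<inter> B = {}"
  by fastforce

text \<open>
  The definition of \<open>dyadic_PL\<close> constrains only the slopes. The intercepts are dyadic because \<open>f\<close> fixes
  \<open>0\<close> and therefore, from one break to the next, takes dyadic values at the breaks.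
\<close>

lemma F_affine:
  assumes f: "f \<in> thompson_F_set"
  shows "\<exists>B. finite B \<and> B \<subseteq> dyadic \<and>
    (\<forall>u v. 0 \<le> u \<and> u < v \<and> v \<le> 1 \<and> {u<..<v} \<inter> B = {} \<longrightarrow> affine_on f u v)"
proof -
  obtain B where B: "finite B" "B \<subseteq> dyadic" "\<And>u v. 0 \<le> u \<Longrightarrow> u < v \<Longrightarrow> v \<le> 1 \<Longrightarrow> {u<..<v} \<inter> B = {} \<Longrightarrow>
      \<exists>(k :: int) c. \<forall>x\<in>{u..v}. f x = 2 powi k * x + c"
    using f unfolding thompson_F_set_def dyadic_PL_def mem_Collect_eq by meson
  define D where "D = insert 0 (B \<inter> {0..1})"
  have D: "finite D" "D \<subseteq> dyadic" "D \<subseteq> {0..1}" "0 \<in> D" using B by (auto simp: D_def)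
  have pred: "\<exists>p\<in>D. p < x \<and> {p<..<x} \<inter> D = {}" if "0 < x" for x
  proof -
    define p where "p = Max {y \<in> D. y < x}"
    have fin: "finite {y \<in> D. y < x}" "{y \<in> D. y < x} \<noteq> {}" using D that by auto
    have "p \<in> {y \<in> D. y < x}" unfolding p_def by (rule Max_in[OF fin])
    moreover have "y \<le> p" if "y \<in> D" "y < x" for y unfolding p_def using fin that by (intro Max_ge) auto
    ultimately show ?thesis by (intro bexI[of _ p]) fastforce+
  qed
  have BD: "{p<..<x} \<inter> B = {}" if "{p<..<x} \<inter> D = {}" "0 \<le> p" "x \<le> 1" for p x
    using that by (force simp: D_def)
  have dy: "f x \<in> dyadic" if "x \<in> D" for x
    using that
  proof (induct "card {y \<in> D. y < x}" arbitrary: x rule: less_induct)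
    case less
    show ?case
    proof (cases "x = 0")
      case True then show ?thesis using F_fixes_ends(2)[OF f] by simp
    next
      case False
      then have x: "0 < x" "x \<le> 1" using less(2) D(3) by force+
      then obtain p where p: "p \<in> D" "p < x" "{p<..<x} \<inter> D = {}" using pred by blast
      have "{y \<in> D. y < p} \<subset> {y \<in> D. y < x}" using p by auto
      then have "card {y \<in> D. y < p} < card {y \<in> D. y < x}" using D(1) by (intro psubset_card_mono) auto
      then have fp: "f p \<in> dyadic" using less(1) p(1) by blast
      have p0: "0 \<le> p" using p(1) D(3) by auto
      obtain k :: int and c where k: "\<And>y. y \<in> {p..x} \<Longrightarrow> f y = 2 powi k * y + c"
        using B(3)[OF p0 p(2) x(2) BD[OF p(3) p0 x(2)]] by blast
      have "f x = f p + 2 powi k * (x - p)" using k[of x] k[of p] p by (simp add: algebra_simps)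
      moreover have "x \<in> dyadic" "p \<in> dyadic" using less(2) p(1) D(2) by auto
      ultimately show ?thesis using fp by (simp add: dyadic_add dyadic_mult dyadic_diff)
    qed
  qed
  have "affine_on f u v" if uv: "0 \<le> u" "u < v" "v \<le> 1" "{u<..<v} \<inter> D = {}" for u v
  proof -
    obtain p where p: "p \<in> D" "p < v" "{p<..<v} \<inter> D = {}" using pred[of v] uv by auto
    have "p \<le> u" using p uv by (meson disjoint_iff greaterThanLessThan_iff not_le)
    have p0: "0 \<le> p" using p(1) D(3) by auto
    obtain k :: int and c where k: "\<And>y. y \<in> {p..v} \<Longrightarrow> f y = 2 powi k * y + c"
      using B(3)[OF p0 p(2) uv(3) BD[OF p(3) p0 uv(3)]] by blast
    have "c = f p - 2 powi k * p" using k[of p] p by simp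
    then have "c \<in> dyadic" using dy[OF p(1)] p(1) D(2) by (auto intro!: dyadic_diff dyadic_mult)
    then show ?thesis using k \<open>p \<le> u\<close> by (intro affine_onI) auto
  qed
  then show ?thesis using D by (intro exI[of _ D]) auto
qed

lemma affine_on_germ:
  assumes "affine_on f u x" "affine_on f x v" "u < x" "x < v" "x \<in> dyadic"
  shows "PL_germ f x"
proof -
  obtain k b where k: "b \<in> dyadic" "\<And>y. u \<le> y \<Longrightarrow> y \<le> x \<Longrightarrow> f y = 2 powi k * y + b"
    using assms(1) by (rule affine_onE) blast
  obtain l c where l: "\<And>y. x \<le> y \<Longrightarrow> y \<le> v \<Longrightarrow> f y = 2 powi l * y + c"
    using assms(2) by (rule affine_onE) blast
  show ?thesis
  proof (rule PL_germ_glue[OF assms(5) _ assms(3,4)])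
    show "f x \<in> dyadic" using k assms by (simp add: dyadic_add dyadic_mult)
    show "f y = f x + 2 powi l * (y - x)" if "x \<le> y" "y \<le> v" for y
      using l[of y] l[of x] that assms by (simp add: algebra_simps)
    show "f y = f x + 2 powi k * (y - x)" if "u \<le> y" "y \<le> x" for y
      using k(2)[of y] k(2)[of x] that assms by (simp add: algebra_simps)
  qed
qed

lemma affine_on_germ_inside:
  assumes "affine_on f u v" "u < x" "x < v" shows "PL_germ f x"
proof -
  obtain k b where k: "b \<in> dyadic" "\<And>y. u \<le> y \<Longrightarrow> y \<le> v \<Longrightarrow> f y = 2 powi k * y + b"
    using assms(1) by (rule affine_onE) blast
  show ?thesis
    by (rule PL_germ_cong[OF PL_germ_affine[OF k(1), of k], of "min (x - u) (v - x)"])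
      (use assms k(2) in \<open>auto\<close>)
qed

lemma F_germ:
  assumes f: "f \<in> thompson_F_set" and x: "0 < x" "x < 1" shows "PL_germ f x"
proof -
  obtain B where B: "finite B" "B \<subseteq> dyadic"
    "\<And>u v. 0 \<le> u \<Longrightarrow> u < v \<Longrightarrow> v \<le> 1 \<Longrightarrow> {u<..<v} \<inter> B = {} \<Longrightarrow> affine_on f u v"
    using F_affine[OF f] by meson
  define u where "u = Max (insert 0 {b \<in> B. b < x})"
  define v where "v = Min (insert 1 {b \<in> B. x < b})"
  have finu: "finite (insert 0 {b \<in> B. b < x})" and finv: "finite (insert 1 {b \<in> B. x < b})" using B(1) by auto
  have "u \<in> insert 0 {b \<in> B. b < x}" unfolding u_def by (rule Max_in[OF finu]) simp
  then have u: "u < x" using x by auto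
  have "v \<in> insert 1 {b \<in> B. x < b}" unfolding v_def by (rule Min_in[OF finv]) simp
  then have v: "x < v" using x by auto
  have u0: "0 \<le> u" unfolding u_def using finu by (intro Max_ge) auto
  have v1: "v \<le> 1" unfolding v_def using finv by (intro Min_le) auto
  have ub: "b \<le> u" if "b \<in> B" "b < x" for b unfolding u_def using finu that by (intro Max_ge) auto
  have vb: "v \<le> b" if "b \<in> B" "x < b" for b unfolding v_def using finv that by (intro Min_le) auto
  show ?thesis
  proof (cases "x \<in> B")
    case True
    have "{u<..<x} \<inter> B = {}" using ub by (intro interval_avoids) (metis linear less_le)
    then have "affine_on f u x" using u u0 x by (intro B(3)) auto
    have "{x<..<v} \<inter> B = {}" using vb by (intro interval_avoids) (metis linear less_le)
    then have "affine_on f x v" using v v1 x by (intro B(3)) auto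
    show ?thesis
      using affine_on_germ[OF \<open>affine_on f u x\<close> \<open>affine_on f x v\<close> u v] True B(2) by blast
  next
    case False
    have "affine_on f u v"
    proof (rule B(3)[OF u0 _ v1])
      show "u < v" using u v by simp
      have "b \<le> u \<or> v \<le> b" if "b \<in> B" for b using ub[OF that] vb[OF that] that False by (metis linorder_neqE)
      then show "{u<..<v} \<inter> B = {}" by (rule interval_avoids)
    qed
    then show ?thesis using u v by (rule affine_on_germ_inside)
  qed
qed

text \<open>
  Conjugating back by the chart, the linear pieces of \<open>f\<close> at the endpoints become translations.
\<close>

lemma F_is_transfer:
  assumes f: "f \<in> thompson_F_set" shows "\<exists>g\<in>T_set. f = transfer g"
proof
  define g where "g = (\<lambda>y. chart_inv (f (chart y)))"
  have cg: "chart (g y) = f (chart y)" for y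
    unfolding g_def using F_interior[OF f] by simp
  show "f = transfer g"
  proof
    fix x show "f x = transfer g x"
    proof (cases "x \<in> {0..1}")
      case True
      then show ?thesis using F_fixes_ends[OF f] by (cases rule: unit_cases) (auto simp: cg simp del: transfer_mid)
    next
      case False
      then show ?thesis using f transfer_undefined[of x g]
        by (auto simp: thompson_F_set_def extensional_def)
    qed
  qed
  have "PL_homeo g"
  proof (rule PL_homeoI)
    show "strict_mono g"
    proof (rule strict_monoI)
      fix x y :: real assume "x < y"
      then have "chart (g x) < chart (g y)" unfolding cg using F_less_iff[OF f] by simp
      then show "g x < g y" by simp
    qed
    have "y \<in> range g" for y
    proof -
      have "chart y \<in> f ` {0..1}" using F_fixes_ends(1)[OF f] by simp
      then obtain x where x: "x \<in> {0..1}" "chart y = f x" by blast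
      then have "x \<noteq> 0" "x \<noteq> 1" using F_fixes_ends[OF f] by (metis chart_not_outside(5,6))+
      then obtain z where "x = chart z" using x(1) by (metis unit_cases)
      then have "g z = y" using x(2) by (metis chart_inv_chart g_def)
      then show ?thesis by blast
    qed
    then show "surj g" by blast
    show "PL_germ g x" for x
    proof -
      have "PL_germ chart_inv (chart (g x))" by (rule PL_germ_inverse[OF chart_germ]) simp
      then have "PL_germ chart_inv (f (chart x))" by (simp only: cg)
      moreover have "PL_germ (\<lambda>y. f (chart y)) x"
        by (rule PL_germ_comp[OF chart_germ F_germ[OF f]]) simp_all
      ultimately show ?thesis unfolding g_def by (rule PL_germ_comp[rotated])
    qed
  qed
  moreover have "\<exists>i j. trans_ends g i j"
  proof -
    obtain B where B: "finite B"
      "\<And>u v. 0 \<le> u \<Longrightarrow> u < v \<Longrightarrow> v \<le> 1 \<Longrightarrow> {u<..<v} \<inter> B = {} \<Longrightarrow> affine_on f u v"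
      using F_affine[OF f] by meson
    define v where "v = Min (insert 1 (B \<inter> {0<..}))"
    have "finite (insert 1 (B \<inter> {0<..}))" using B by simp
    then have v: "0 < v" "v \<le> 1" "{0<..<v} \<inter> B = {}" by (auto simp: v_def)
    obtain i b where i: "\<And>x. 0 \<le> x \<Longrightarrow> x \<le> v \<Longrightarrow> f x = 2 powi i * x + b"
      using B(2)[OF _ v(1,2,3)] by (auto elim: affine_onE)
    have b: "b = 0" using i[of 0] v F_fixes_ends[OF f] by simp
    define u where "u = Max (insert 0 (B \<inter> {..<1}))"
    have "finite (insert 0 (B \<inter> {..<1}))" using B by simp
    then have u: "0 \<le> u" "u < 1" "{u<..<1} \<inter> B = {}" by (auto simp: u_def)
    obtain j c where j: "\<And>x. u \<le> x \<Longrightarrow> x \<le> 1 \<Longrightarrow> f x = 2 powi j * x + c"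
      using B(2)[OF u(1,2) _ u(3)] by (auto elim: affine_onE)
    have c: "c = 1 - 2 powi j" using j[of 1] u F_fixes_ends[OF f] by simp
    define p where "p = chart_inv (v / 2)"
    define q where "q = chart_inv ((u + 1) / 2)"
    have p: "chart p = v / 2" unfolding p_def using v by simp
    have q: "chart q = (u + 1) / 2" unfolding q_def using u by simp
    have "trans_ends g i (- j)"
    proof (rule trans_endsI)
      fix y assume y: "y \<le> - (- min p (min (- 1) (- 1 - of_int i)))"
      then have "chart y \<le> chart p" by simp
      then have "chart y \<le> v" using p v by simp
      then have "f (chart y) = 2 powi i * chart y" using i[of "chart y"] b by simp
      also have "\<dots> = chart (y + of_int i)" using y by (intro chart_translate_neg[symmetric]) auto
      finally show "g y = y + of_int i" unfolding g_def by simp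
    next
      fix y assume y: "max q (max 0 (of_int j)) \<le> y"
      then have "chart q \<le> chart y" by simp
      then have "u \<le> chart y" using q u by simp
      then have "1 - f (chart y) = 2 powi (- (- j)) * (1 - chart y)"
        using j[of "chart y"] c by (simp add: algebra_simps)
      also have "\<dots> = 1 - chart (y + of_int (- j))" using y by (intro chart_translate_nonneg[symmetric]) auto
      finally have "f (chart y) = chart (y + of_int (- j))" by simp
      then show "g y = y + of_int (- j)" unfolding g_def by simp
    qed
    then show ?thesis by blast
  qed
  ultimately show "g \<in> T_set" by (simp add: T_set_def)
qed

lemma transfer_inj: "inj_on transfer T_set"
proof (rule inj_onI)
  fix f g assume "transfer f = transfer g"
  then have "chart (f y) = chart (g y)" for y using transfer_chart by metis
  then show "f = g" using chart_inv_chart by (metis ext)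
qed

lemma transfer_image_T: "transfer ` T_set = thompson_F_set"
  using transfer_F F_is_transfer by blast

lemma transfer_mult:
  assumes "f \<in> T_set" "g \<in> T_set"
  shows "transfer (f \<circ> g) = transfer f \<otimes>\<^bsub>thompson_F\<^esub> transfer g"
  using assms by (simp add: thompson_F_def BijGroup_def transfer_Bij transfer_comp)

text \<open>
  Closure of \<open>thompson_F_set\<close> under composition and inverses comes from the line, as it is the
  image of \<open>T\<close> under a homomorphism into the group of all bijections.
\<close>

lemma group_F: "group thompson_F"
proof -
  interpret B: group "BijGroup {0..1::real}" by (rule group_BijGroup)
  have "transfer \<in> hom T (BijGroup {0..1})"
    by (rule homI) (simp_all add: BijGroup_def transfer_Bij transfer_comp)
  then interpret h: group_hom T "BijGroup {0..1}" transfer by unfold_locales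
  have "subgroup thompson_F_set (BijGroup {0..1})"
    using h.img_is_subgroup by (simp add: transfer_image_T)
  then show ?thesis unfolding thompson_F_def by (rule B.subgroup_imp_group)
qed

lemma carrier_F [simp]: "carrier thompson_F = thompson_F_set"
  by (simp add: thompson_F_def)

lemma transfer_iso: "transfer \<in> iso T thompson_F"
  using transfer_inj transfer_image_T
  by (auto simp: iso_def bij_betw_def transfer_mult intro!: homI)

section \<open>Slopes at the endpoints\<close>

text \<open>
  The sign of \<open>j\<close> is reversed: a translation to the right brings points closer to \<open>1\<close>.
\<close>

lemma thompson_phi_transfer:
  assumes f: "f \<in> T_set" "trans_ends f i j" shows "thompson_phi (transfer f) = (i, - j)"
proof -
  have lg: "\<lfloor>log 2 (2 powi n)\<rfloor> = n" for n :: int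
    by (simp flip: powr_real_of_int')
  obtain N where N: "\<And>x. 0 \<le> x \<Longrightarrow> x \<le> chart (of_int N) \<Longrightarrow> transfer f x = 2 powi i * x"
    using transfer_near_0[OF f(2)] by blast
  obtain M where M: "\<And>x. chart (of_int M) \<le> x \<Longrightarrow> x \<le> 1 \<Longrightarrow> 1 - transfer f x = 2 powi (- j) * (1 - x)"
    using transfer_near_1[OF f(2)] by blast
  have d0: "vector_derivative (transfer f) (at_right 0) = 2 powi i"
    by (rule vector_derivative_affine_end[where S = "{0..}" and d = "chart (of_int N)" and c = 0])
       (use N in \<open>auto simp: dist_real_def\<close>)
  have M': "transfer f x = 2 powi (- j) * x + (1 - 2 powi (- j))" if "chart (of_int M) \<le> x" "x \<le> 1" for x
    using M[OF that] by (simp add: algebra_simps)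
  have d1: "vector_derivative (transfer f) (at_left 1) = 2 powi (- j)"
    by (rule vector_derivative_affine_end[where S = "{..1}" and d = "1 - chart (of_int M)" and c = "1 - 2 powi (- j)"])
       (use M' in \<open>auto simp: dist_real_def\<close>)
  show ?thesis by (simp only: thompson_phi_def d0 d1 lg)
qed

lemma K_tilde_eq: "K_tilde a b = {(a * i, b * j) | i j. True}"
proof
  let ?G = "integer_group \<times>\<times> integer_group"
  interpret G: group ?G by (intro DirProd_group group_integer_group)
  have inv: "inv\<^bsub>?G\<^esub> (x, y) = (- x, - y)" for x y by simp
  show "K_tilde a b \<subseteq> {(a * i, b * j) | i j. True}"
  proof
    fix z assume "z \<in> K_tilde a b"
    then show "z \<in> {(a * i, b * j) | i j. True}"
      unfolding K_tilde_def
    proof (induct rule: generate.induct)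
      case one show ?case by (auto intro!: exI[of _ 0])
    next
      case (incl h)
      then consider "h = (a * 1, b * 0)" | "h = (a * 0, b * 1)" by auto
      then show ?case by cases blast+
    next
      case (inv h)
      then consider "inv\<^bsub>?G\<^esub> h = (a * (- 1), b * 0)" | "inv\<^bsub>?G\<^esub> h = (a * 0, b * (- 1))" by auto
      then show ?case by cases blast+
    next
      case (eng h1 h2)
      then obtain i j i' j' where "h1 = (a * i, b * j)" "h2 = (a * i', b * j')" by blast
      then have "h1 \<otimes>\<^bsub>?G\<^esub> h2 = (a * (i + i'), b * (j + j'))" by (simp add: distrib_left)
      then show ?case by blast
    qed
  qed
  have S: "subgroup (K_tilde a b) ?G"
    unfolding K_tilde_def by (rule G.generate_is_subgroup) auto
  have base: "(a, 0) \<in> K_tilde a b" "(0, b) \<in> K_tilde a b"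
    unfolding K_tilde_def by (auto intro: generate.incl)
  have add: "(x + x', y + y') \<in> K_tilde a b" if "(x, y) \<in> K_tilde a b" "(x', y') \<in> K_tilde a b" for x y x' y'
    using subgroup.m_closed[OF S that] by simp
  have neg: "(- x, - y) \<in> K_tilde a b" if "(x, y) \<in> K_tilde a b" for x y
    using subgroup.m_inv_closed[OF S that] by simp
  have zero: "(0, 0) \<in> K_tilde a b" using subgroup.one_closed[OF S] by simp
  have mult: "(i * x, i * y) \<in> K_tilde a b" if "(x, y) \<in> K_tilde a b" for i x y
  proof (induct i rule: int_induct[where k=0])
    case (step1 i) then show ?case using add[OF step1(2) that] by (simp add: algebra_simps)
  next
    case (step2 i) then show ?case using add[OF step2(2) neg[OF that]] by (simp add: algebra_simps)
  qed (simp add: zero)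
  have "(a * i, b * j) \<in> K_tilde a b" for i j
    using add[OF mult[OF base(1), of i] mult[OF base(2), of j]] by (simp add: mult.commute)
  then show "{(a * i, b * j) | i j. True} \<subseteq> K_tilde a b" by blast
qed

lemma transfer_in_K_iff:
  assumes "f \<in> T_set" shows "transfer f \<in> K a b \<longleftrightarrow> f \<in> K_T a b"
proof -
  obtain i j where ij: "trans_ends f i j" using assms by (rule T_trans_ends)
  have "transfer f \<in> K a b \<longleftrightarrow> (\<exists>p q. i = a * p \<and> - j = b * q)"
    by (auto simp: K_def transfer_F[OF assms] thompson_phi_transfer[OF assms ij] K_tilde_eq)
  also have "\<dots> \<longleftrightarrow> (\<exists>p q. i = a * p \<and> j = b * q)"
    by (metis minus_mult_right minus_minus)
  also have "\<dots> \<longleftrightarrow> f \<in> K_T a b"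
    using assms ij trans_ends_unique[OF ij] unfolding K_T_def by blast
  finally show ?thesis .
qed

section \<open>Finite index subgroups isomorphic to the whole group\<close>

theorem theorem1p1:
  fixes H :: "(real \<Rightarrow> real) set"
  assumes "subgroup H thompson_F"
    and "finite (rcosets\<^bsub>thompson_F\<^esub> H)"
  shows "(thompson_F\<lparr>carrier := H\<rparr>) \<cong> thompson_F \<longleftrightarrow>
         (\<exists>a b :: int. a > 0 \<and> b > 0 \<and> H = K a b)"
proof -
  interpret F: group thompson_F by (rule group_F)
  interpret h: group_hom T thompson_F transfer
    using transfer_iso by unfold_locales (simp add: iso_def)
  define S where "S = {f \<in> T_set. transfer f \<in> H}"
  have HF: "H \<subseteq> thompson_F_set" using subgroup.subset[OF assms(1)] by simp
  have im: "transfer ` S = H"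
    using HF transfer_image_T by (auto simp: S_def)
  have S: "subgroup S T"
  proof (rule T.subgroupI)
    have "id \<in> S" using subgroup.one_closed[OF assms(1)] h.hom_one by (simp add: S_def)
    then show "S \<noteq> {}" by blast
    show "inv\<^bsub>T\<^esub> f \<in> S" if "f \<in> S" for f
    proof -
      have "transfer (inv\<^bsub>T\<^esub> f) = inv\<^bsub>thompson_F\<^esub> transfer f" using that by (intro h.hom_inv) (simp add: S_def)
      then show ?thesis using that subgroup.m_inv_closed[OF assms(1)] by (auto simp: S_def)
    qed
    show "f \<otimes>\<^bsub>T\<^esub> g \<in> S" if "f \<in> S" "g \<in> S" for f g
      using that subgroup.m_closed[OF assms(1)] by (auto simp: S_def transfer_mult)
  qed (auto simp: S_def)
  have isoS: "T\<lparr>carrier := S\<rparr> \<cong> thompson_F\<lparr>carrier := H\<rparr>"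
    using iso_restrict[OF transfer_iso group_T group_F S] unfolding im is_iso_def by blast
  have isoT: "T \<cong> thompson_F" using transfer_iso unfolding is_iso_def by blast
  have gS: "group (T\<lparr>carrier := S\<rparr>)" by (rule T.subgroup_imp_group[OF S])
  have gH: "group (thompson_F\<lparr>carrier := H\<rparr>)" by (rule F.subgroup_imp_group[OF assms(1)])
  have iso_iff: "thompson_F\<lparr>carrier := H\<rparr> \<cong> thompson_F \<longleftrightarrow> T\<lparr>carrier := S\<rparr> \<cong> T"
    using isoS isoT group.iso_sym[OF gS isoS] T.iso_sym[OF isoT] iso_trans by blast
  have K_iff: "H = K a b \<longleftrightarrow> S = K_T a b" for a b
  proof
    assume "H = K a b"
    then show "S = K_T a b" using transfer_in_K_iff by (auto simp: S_def K_T_def)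
  next
    assume eq: "S = K_T a b"
    have "f \<in> H \<longleftrightarrow> f \<in> K a b" if f: "f \<in> thompson_F_set" for f
    proof -
      obtain g where g: "g \<in> T_set" "f = transfer g" using F_is_transfer[OF f] by blast
      have "f \<in> H \<longleftrightarrow> g \<in> S" using g by (simp add: S_def)
      then show ?thesis using eq transfer_in_K_iff[OF g(1)] g(2) by simp
    qed
    moreover have "K a b \<subseteq> thompson_F_set" by (auto simp: K_def)
    ultimately show "H = K a b" using HF by blast
  qed
  obtain k :: nat where k: "k > 0" "\<And>g x. g \<in> thompson_F_set \<Longrightarrow> x \<in> thompson_F_set \<Longrightarrow>
      x \<otimes>\<^bsub>thompson_F\<^esub> g [^]\<^bsub>thompson_F\<^esub> k \<otimes>\<^bsub>thompson_F\<^esub> inv\<^bsub>thompson_F\<^esub> x \<in> H"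
    using F.finite_index_conj_pow[OF assms] by auto
  have pow: "g \<circ> f ^^ k \<circ> finv g \<in> S" if "f \<in> T_set" "g \<in> T_set" for f g
  proof -
    have "f [^]\<^bsub>T\<^esub> n = f ^^ n" for n :: nat
      by (induct n) (simp_all add: id_def[symmetric] funpow_swap1 fun_eq_iff)
    then have "transfer (f ^^ k) = transfer f [^]\<^bsub>thompson_F\<^esub> k"
      using h.hom_nat_pow[of f k] that by simp
    moreover have "transfer (finv g) = inv\<^bsub>thompson_F\<^esub> transfer g"
      using h.hom_inv[of g] that by simp
    ultimately have "transfer (g \<circ> f ^^ k \<circ> finv g) \<in> H"
      using k(2)[of "transfer f" "transfer g"] that
      by (simp add: transfer_mult transfer_F T_comp T_inv funpow_T_set)
    then show ?thesis using that by (simp add: S_def T_comp T_inv funpow_T_set)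
  qed
  have "T\<lparr>carrier := S\<rparr> \<cong> T \<longleftrightarrow> (\<exists>a b. a > 0 \<and> b > 0 \<and> S = K_T a b)"
    using iso_T_imp_K_T[OF S k(1) pow] group.iso_sym[OF gS] K_T_iso_T by blast
  then show ?thesis using iso_iff K_iff by blast
qed

end
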